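(* Let $n\geqslant 1$, let $\Omega\subset\mathbb{H}^n$ be a domain and set $X:=\{(q_0,q_1,\dots,q_{n-1})\in\Omega: q_0=0\}$. For every integer $k\geqslant 0$, the sequence $$0\longrightarrow \mathcal{R}^{(k+2)} \xrightarrow{\ \widetilde{\mathscr{L}}^{(k)}\ } \mathcal{R}^{(k+1)}\oplus \mathcal{R}^{(k+1)} \xrightarrow{\ \mathscr{L}^{(k)}\ } \mathcal{I}_X^{(k)} \longrightarrow 0$$ is an exact sequence of sheaves on $\Omega$, where $$\widetilde{\mathscr{L}}^{(k)}h=\bigl(-L_1^{(k+2)}h,\ L_0^{(k+2)}h\bigr)^T,\qquad \mathscr{L}^{(k)}(f,g)^T=L_0^{(k+1)}f+L_1^{(k+1)}g .$$
   Context: Identify $\mathbb{H}^n$ with $\mathbb{R}^{4n}$ via $q_t=x_{4t}+\mathbf{i}x_{4t+1}+\mathbf{j}x_{4t+2}+\mathbf{k}x_{4t+3}$, $t=0,\dots,n-1$. With $\partial_m=\partial/\partial x_m$ and $i\in\mathbb{C}$ the imaginary unit, put $\nabla_{2t}^{0'}=-\partial_{4t+2}-i\partial_{4t+3}$, $\nabla_{2t}^{1'}=-\partial_{4t}-i\partial_{4t+1}$, $\nabla_{2t+1}^{0'}=\partial_{4t}-i\partial_{4t+1}$, $\nabla_{2t+1}^{1'}=-\partial_{4t+2}+i\partial_{4t+3}$. Fix a basis $\omega^0,\dots,\omega^{2n-1}$ of $\mathbb{C}^{2n}$. For $A'\in\{0',1'\}$ and a $\Lambda^p\mathbb{C}^{2n}$-valued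 function $f=\sum_I f_I\,\omega^I$ put $d^{A'}f=\sum_{A=0}^{2n-1}\sum_I\nabla_A^{A'}f_I\;\omega^A\wedge\omega^I$. Elements of the symmetric power $\odot^k\mathbb{C}^2$ are written $(f_{A_0'\cdots A_{k-1}'})$ with indices in $\{0',1'\}$ and components symmetric in the indices; $\odot^0\mathbb{C}^2=\mathbb{C}$. For $k\geqslant1$, a $C^1$ function $f:U\to\odot^k\mathbb{C}^2$ on an open set $U\subset\mathbb{R}^{4n}$ is $k$-regular if $d^{0'}f_{0'A_1'\cdots A_{k-1}'}+d^{1'}f_{1'A_1'\cdots A_{k-1}'}=0$ on $U$ for all $A_1',\dots,A_{k-1}'$. A ($C^2$) function $f:U\to\mathbb{C}$ is $0$-regular if $d^{0'}d^{1'}f=0$ on $U$. $\mathcal{R}^{(k)}$ is the sheaf of $k$-regular functions on $\Omega$, and $\mathcal{I}_X^{(k)}\subset\mathcal{R}^{(k)}$ is the subsheaf $\mathcal{I}_X^{(k)}(U)=\{f\in\mathcal{R}^{(k)}(U): f=0\text{ on }X\cap U\}$. Put $z_{2t}^{0'}=x_{4t+2}+ix_{4t+3}$, $z_{2t}^{1'}=x_{4t}+ix_{4t+1}$, $z_{2t+1}^{0'}=-x_{4t}+ix_{4t+1}$, $z_{2t+1}^{1'}=x_{4t+2}-ix_{4t+3}$. For $k\geqslant1$ and $A=0,\dots,2n-1$ the operator $L_A^{(k)}$ sends a $\odot^k\mathbb{C}^2$-valued function $f$ to the $\odot^{k-1}\mathbb{C}^2$-valued function $(L_A^{(k)}f)_{A_0'\cdots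 A_{k-2}'}=z_A^{0'}f_{0'A_0'\cdots A_{k-2}'}+z_A^{1'}f_{1'A_0'\cdots A_{k-2}'}$; it maps $k$-regular functions to $(k-1)$-regular functions. *)

theory Defs
  imports "HOL-Analysis.Analysis" "HOL-Library.Function_Algebras" "HOL-Library.Multiset"
begin

section \<open>Sheaves of functions\<close>

text \<open>
  A sheaf of functions on an open set \<open>\<Omega>\<close> assigns to every open \<open>U \<subseteq> \<Omega>\<close> an additive group of
  functions on \<open>U\<close>.  A function on \<open>U\<close> is encoded as a total function that is \<open>0\<close> off \<open>U\<close>, so
  equality of sections over \<open>U\<close> is equality in HOL and the group operations are pointwise
  (via \<open>Function_Algebras\<close>).  Values of a sheaf at sets that are not open subsets of \<open>\<Omega>\<close> are irrelevant.
\<close>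

definition restr :: "'x set \<Rightarrow> ('x \<Rightarrow> 'v::zero) \<Rightarrow> 'x \<Rightarrow> 'v" where
  "restr V s = (\<lambda>x. if x \<in> V then s x else 0)"

definition sheaf_on ::
  "'x::topological_space set \<Rightarrow> ('x set \<Rightarrow> ('x \<Rightarrow> 'v::ab_group_add) set) \<Rightarrow> bool" where
  "sheaf_on \<Omega> F \<longleftrightarrow>
     (\<forall>U. open U \<and> U \<subseteq> \<Omega> \<longrightarrow>
        (\<forall>s\<in>F U. \<forall>x. x \<notin> U \<longrightarrow> s x = 0) \<and>
        0 \<in> F U \<and> (\<forall>s\<in>F U. \<forall>t\<in>F U. s - t \<in> F U) \<and>
        (\<forall>V s. open V \<and> V \<subseteq> U \<and> s \<in> F U \<longrightarrow> restr V s \<in> F V)) \<and>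
     (\<forall>\<U> s. (\<forall>U\<in>\<U>. open U \<and> U \<subseteq> \<Omega> \<and> s U \<in> F U) \<and>
        (\<forall>U\<in>\<U>. \<forall>V\<in>\<U>. restr (U \<inter> V) (s U) = restr (U \<inter> V) (s V)) \<longrightarrow>
        (\<exists>!t. t \<in> F (\<Union>\<U>) \<and> (\<forall>U\<in>\<U>. restr U t = s U)))"

definition sheaf_hom ::
  "'x::topological_space set \<Rightarrow> ('x set \<Rightarrow> ('x \<Rightarrow> 'v::ab_group_add) set) \<Rightarrow>
   ('x set \<Rightarrow> ('x \<Rightarrow> 'w::ab_group_add) set) \<Rightarrow> ('x set \<Rightarrow> ('x \<Rightarrow> 'v) \<Rightarrow> ('x \<Rightarrow> 'w)) \<Rightarrow> bool" where
  "sheaf_hom \<Omega> F G \<phi> \<longleftrightarrow>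
     (\<forall>U. open U \<and> U \<subseteq> \<Omega> \<longrightarrow>
        (\<forall>s\<in>F U. \<phi> U s \<in> G U) \<and>
        (\<forall>s\<in>F U. \<forall>t\<in>F U. \<phi> U (s + t) = \<phi> U s + \<phi> U t) \<and>
        (\<forall>V s. open V \<and> V \<subseteq> U \<and> s \<in> F U \<longrightarrow> \<phi> V (restr V s) = restr V (\<phi> U s)))"

definition kernel_sheaf ::
  "('x set \<Rightarrow> ('x \<Rightarrow> 'v) set) \<Rightarrow> ('x set \<Rightarrow> ('x \<Rightarrow> 'v) \<Rightarrow> ('x \<Rightarrow> 'w::zero)) \<Rightarrow>
   'x set \<Rightarrow> ('x \<Rightarrow> 'v) set" where
  "kernel_sheaf F \<phi> U = {s \<in> F U. \<phi> U s = 0}"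

text \<open>The image sheaf is the sheafification of the presheaf image, realised inside \<open>G\<close>:
  the sections that locally lift along \<open>\<phi>\<close>.\<close>

definition image_sheaf ::
  "('x::topological_space set \<Rightarrow> ('x \<Rightarrow> 'v) set) \<Rightarrow> ('x set \<Rightarrow> ('x \<Rightarrow> 'w::zero) set) \<Rightarrow>
   ('x set \<Rightarrow> ('x \<Rightarrow> 'v) \<Rightarrow> ('x \<Rightarrow> 'w)) \<Rightarrow> 'x set \<Rightarrow> ('x \<Rightarrow> 'w) set" where
  "image_sheaf F G \<phi> U =
     {t \<in> G U. \<forall>p\<in>U. \<exists>V. open V \<and> p \<in> V \<and> V \<subseteq> U \<and> (\<exists>s\<in>F V. \<phi> V s = restr V t)}"

definition exact_at ::
  "'x::topological_space set \<Rightarrow> ('x set \<Rightarrow> ('x \<Rightarrow> 'u) set) \<Rightarrow>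
   ('x set \<Rightarrow> ('x \<Rightarrow> 'u) \<Rightarrow> ('x \<Rightarrow> 'v)) \<Rightarrow> ('x set \<Rightarrow> ('x \<Rightarrow> 'v::zero) set) \<Rightarrow>
   ('x set \<Rightarrow> ('x \<Rightarrow> 'v) \<Rightarrow> ('x \<Rightarrow> 'w::zero)) \<Rightarrow> bool" where
  "exact_at \<Omega> F \<phi> G \<psi> \<longleftrightarrow>
     (\<forall>U. open U \<and> U \<subseteq> \<Omega> \<longrightarrow> image_sheaf F G \<phi> U = kernel_sheaf G \<psi> U)"

definition zero_sheaf :: "'x set \<Rightarrow> ('x \<Rightarrow> 'v::zero) set" where
  "zero_sheaf U = {\<lambda>x. 0}"

definition zero_hom :: "'x set \<Rightarrow> ('x \<Rightarrow> 'v) \<Rightarrow> ('x \<Rightarrow> 'w::zero)" where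
  "zero_hom U s = (\<lambda>x. 0)"

text \<open>Exactness of \<open>0 \<rightarrow> F \<rightarrow> G \<rightarrow> H \<rightarrow> 0\<close>; the type annotations only fix the (immaterial) value
  types of the two zero sheaves.\<close>

definition short_exact_sequence_of_sheaves ::
  "'x::topological_space set \<Rightarrow> ('x set \<Rightarrow> ('x \<Rightarrow> 'u::ab_group_add) set) \<Rightarrow>
   ('x set \<Rightarrow> ('x \<Rightarrow> 'u) \<Rightarrow> ('x \<Rightarrow> 'v)) \<Rightarrow> ('x set \<Rightarrow> ('x \<Rightarrow> 'v::ab_group_add) set) \<Rightarrow>
   ('x set \<Rightarrow> ('x \<Rightarrow> 'v) \<Rightarrow> ('x \<Rightarrow> 'w)) \<Rightarrow> ('x set \<Rightarrow> ('x \<Rightarrow> 'w::ab_group_add) set) \<Rightarrow> bool" where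
  "short_exact_sequence_of_sheaves \<Omega> F \<phi> G \<psi> H \<longleftrightarrow>
     sheaf_on \<Omega> F \<and> sheaf_on \<Omega> G \<and> sheaf_on \<Omega> H \<and>
     sheaf_hom \<Omega> F G \<phi> \<and> sheaf_hom \<Omega> G H \<psi> \<and>
     exact_at \<Omega> (zero_sheaf :: 'x set \<Rightarrow> ('x \<Rightarrow> 'u) set) zero_hom F \<phi> \<and>
     exact_at \<Omega> F \<phi> G \<psi> \<and>
     exact_at \<Omega> G \<psi> H (zero_hom :: 'x set \<Rightarrow> ('x \<Rightarrow> 'w) \<Rightarrow> ('x \<Rightarrow> 'w))"

definition sheaf_sum ::
  "('x set \<Rightarrow> ('x \<Rightarrow> 'v) set) \<Rightarrow> ('x set \<Rightarrow> ('x \<Rightarrow> 'w) set) \<Rightarrow> 'x set \<Rightarrow> ('x \<Rightarrow> 'v \<times> 'w) set" where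
  "sheaf_sum F G U = {(\<lambda>x. (f x, g x)) | f g. f \<in> F U \<and> g \<in> G U}"


section \<open>Coordinates and differential operators\<close>

text \<open>
  \<open>\<H>\<^sup>n = \<real>\<^sup>4\<^sup>n\<close> with \<open>n = CARD('n)\<close>: the index type \<open>'n bit0 bit0\<close> is the ring of integers modulo \<open>4 n\<close>, so
  for \<open>m < 4 n\<close> the coordinate \<open>x\<^sub>m\<close> is the component at \<open>of_nat m\<close>.
\<close>

type_synonym 'n hspace = "real ^ ('n bit0 bit0)"

lemma bij_betw_coordinate_index:
  "bij_betw of_nat {..<4 * CARD('n)} (UNIV :: 'n::finite bit0 bit0 set)"
proof -
  let ?f = "of_nat :: nat \<Rightarrow> 'n bit0 bit0"
  have "inj_on ?f {..<CARD('n bit0 bit0)}"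
  proof (rule linorder_inj_onI)
    fix i j :: nat
    assume "i < j" "j \<in> {..<CARD('n bit0 bit0)}"
    then have "\<not> CHAR('n bit0 bit0) dvd (j - i)"
      by (auto simp: bit0.CHAR_eq dest!: dvd_imp_le)
    then have "?f (j - i) \<noteq> 0"
      by (simp only: of_nat_eq_0_iff_char_dvd not_False_eq_True)
    with \<open>i < j\<close> show "?f i \<noteq> ?f j"
      by (simp add: of_nat_diff)
  qed auto
  then have i: "inj_on ?f {..<4 * CARD('n)}"
    by simp
  then have "card (?f ` {..<4 * CARD('n)}) = CARD('n bit0 bit0)"
    by (simp add: card_image)
  then have "?f ` {..<4 * CARD('n)} = UNIV"
    by (intro card_subset_eq) simp_all
  with i show ?thesis
    by (simp add: bij_betw_def)
qed

definition coord :: "nat \<Rightarrow> 'n::finite hspace \<Rightarrow> real" where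
  "coord m x = x $ of_nat m"

text \<open>The quaternion \<open>q\<^sub>t\<close>, given by its real and \<open>i\<close>, \<open>j\<close>, \<open>k\<close> parts.\<close>

definition qcoord :: "nat \<Rightarrow> 'n::finite hspace \<Rightarrow> real \<times> real \<times> real \<times> real" where
  "qcoord t x = (coord (4*t) x, coord (4*t+1) x, coord (4*t+2) x, coord (4*t+3) x)"

definition pdiff :: "nat \<Rightarrow> ('n::finite hspace \<Rightarrow> complex) \<Rightarrow> 'n hspace \<Rightarrow> complex" where
  "pdiff m f x = frechet_derivative f (at x) (axis (of_nat m) 1)"

fun C_diff :: "nat \<Rightarrow> 'n::finite hspace set \<Rightarrow> ('n hspace \<Rightarrow> complex) \<Rightarrow> bool" where
  "C_diff 0 U f \<longleftrightarrow> continuous_on U f"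
| "C_diff (Suc r) U f \<longleftrightarrow>
     (\<forall>x\<in>U. f differentiable (at x)) \<and> (\<forall>m<4 * CARD('n). C_diff r U (pdiff m f))"

text \<open>The primed indices \<open>0'\<close> and \<open>1'\<close>.\<close>

datatype pindex = P0 | P1

definition nabla :: "nat \<Rightarrow> pindex \<Rightarrow> ('n::finite hspace \<Rightarrow> complex) \<Rightarrow> 'n hspace \<Rightarrow> complex" where
  "nabla A a f x = (let t = A div 2 in
     if even A then
       (case a of
          P0 \<Rightarrow> - pdiff (4*t+2) f x - \<i> * pdiff (4*t+3) f x
        | P1 \<Rightarrow> - pdiff (4*t) f x - \<i> * pdiff (4*t+1) f x)
     else
       (case a of
          P0 \<Rightarrow> pdiff (4*t) f x - \<i> * pdiff (4*t+1) f x
        | P1 \<Rightarrow> - pdiff (4*t+2) f x + \<i> * pdiff (4*t+3) f x))"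

definition zvar :: "nat \<Rightarrow> pindex \<Rightarrow> 'n::finite hspace \<Rightarrow> complex" where
  "zvar A a x = (let t = A div 2 in
     if even A then
       (case a of
          P0 \<Rightarrow> of_real (coord (4*t+2) x) + \<i> * of_real (coord (4*t+3) x)
        | P1 \<Rightarrow> of_real (coord (4*t) x) + \<i> * of_real (coord (4*t+1) x))
     else
       (case a of
          P0 \<Rightarrow> - of_real (coord (4*t) x) + \<i> * of_real (coord (4*t+1) x)
        | P1 \<Rightarrow> of_real (coord (4*t+2) x) - \<i> * of_real (coord (4*t+3) x)))"

text \<open>
  An element \<open>\<Sum>\<^sub>I c\<^sub>I \<omega>\<^sup>I\<close> of the exterior algebra of \<open>\<complex>\<^sup>2\<^sup>n\<close> is encoded by its coefficients \<open>I \<mapsto> c\<^sub>I\<close>,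
  where \<open>I \<subseteq> {0, \<dots>, 2n-1}\<close> and \<open>\<omega>\<^sup>I\<close> is the wedge product of the \<open>\<omega>\<^sup>A\<close>, \<open>A \<in> I\<close>, in increasing order.
  \<open>omega_wedge A I\<close> is the element \<open>\<omega>\<^sup>A \<and> \<omega>\<^sup>I\<close>: the sign comes from moving \<open>\<omega>\<^sup>A\<close> past the
  smaller indices of \<open>I\<close>.
\<close>

definition omega_wedge :: "nat \<Rightarrow> nat set \<Rightarrow> nat set \<Rightarrow> complex" where
  "omega_wedge A I = (\<lambda>J. if A \<notin> I \<and> J = insert A I then (-1) ^ card {B \<in> I. B < A} else 0)"

definition dop ::
  "pindex \<Rightarrow> ('n::finite hspace \<Rightarrow> nat set \<Rightarrow> complex) \<Rightarrow> 'n hspace \<Rightarrow> nat set \<Rightarrow> complex" where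
  "dop a f x = (\<lambda>J. \<Sum>A<2 * CARD('n). \<Sum>I\<in>Pow {..<2 * CARD('n)}.
     nabla A a (\<lambda>y. f y I) x * omega_wedge A I J)"

definition scalar_form :: "('n::finite hspace \<Rightarrow> complex) \<Rightarrow> 'n hspace \<Rightarrow> nat set \<Rightarrow> complex" where
  "scalar_form f x = (\<lambda>I. if I = {} then f x else 0)"


section \<open>k-regular functions\<close>

text \<open>Elements of \<open>\<odot>\<^sup>k \<complex>\<^sup>2\<close> are families of components indexed by lists of \<open>k\<close> primed indices, extended
  by \<open>0\<close> to lists of other lengths; for \<open>k = 0\<close> the only component is the one at \<open>[]\<close>.\<close>

type_synonym tensor = "pindex list \<Rightarrow> complex"

definition sym_power :: "nat \<Rightarrow> tensor set" where
  "sym_power k = {c. (\<forall>l. length l \<noteq> k \<longrightarrow> c l = 0) \<and> (\<forall>l l'. mset l = mset l' \<longrightarrow> c l = c l')}"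

definition k_regular_on :: "nat \<Rightarrow> 'n::finite hspace set \<Rightarrow> ('n hspace \<Rightarrow> tensor) \<Rightarrow> bool" where
  "k_regular_on k U f \<longleftrightarrow>
     (\<forall>x\<in>U. f x \<in> sym_power k) \<and>
     (if k = 0 then
        C_diff 2 U (\<lambda>x. f x []) \<and>
        (\<forall>x\<in>U. dop P0 (dop P1 (scalar_form (\<lambda>y. f y []))) x = 0)
      else
        (\<forall>l. length l = k \<longrightarrow> C_diff 1 U (\<lambda>x. f x l)) \<and>
        (\<forall>l. length l = k - 1 \<longrightarrow> (\<forall>x\<in>U.
           dop P0 (scalar_form (\<lambda>y. f y (P0 # l))) x +
           dop P1 (scalar_form (\<lambda>y. f y (P1 # l))) x = 0)))"

definition regular_sheaf :: "nat \<Rightarrow> 'n::finite hspace set \<Rightarrow> ('n hspace \<Rightarrow> tensor) set" where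
  "regular_sheaf k U = {f. k_regular_on k U f \<and> (\<forall>x. x \<notin> U \<longrightarrow> f x = 0)}"

definition ideal_sheaf ::
  "'n::finite hspace set \<Rightarrow> nat \<Rightarrow> 'n hspace set \<Rightarrow> ('n hspace \<Rightarrow> tensor) set" where
  "ideal_sheaf X k U = {f \<in> regular_sheaf k U. \<forall>x\<in>X \<inter> U. f x = 0}"

text \<open>\<open>Lop A\<close> is \<open>L\<^sub>A\<^sup>(\<^sup>k\<^sup>)\<close> for every \<open>k \<ge> 1\<close> at once, since the component formula does not mention \<open>k\<close>.\<close>

definition Lop :: "nat \<Rightarrow> ('n::finite hspace \<Rightarrow> tensor) \<Rightarrow> 'n hspace \<Rightarrow> tensor" where
  "Lop A f x = (\<lambda>l. zvar A P0 x * f x (P0 # l) + zvar A P1 x * f x (P1 # l))"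

definition Ltilde ::
  "'n::finite hspace set \<Rightarrow> ('n hspace \<Rightarrow> tensor) \<Rightarrow> 'n hspace \<Rightarrow> tensor \<times> tensor" where
  "Ltilde U h = (\<lambda>x. (- Lop 1 h x, Lop 0 h x))"

definition Lscr ::
  "'n::finite hspace set \<Rightarrow> ('n hspace \<Rightarrow> tensor \<times> tensor) \<Rightarrow> 'n hspace \<Rightarrow> tensor" where
  "Lscr U p = (\<lambda>x. Lop 0 (\<lambda>y. fst (p y)) x + Lop 1 (\<lambda>y. snd (p y)) x)"

end

(* Off X the sequence is a Koszul-type complex of multiplications, and near X everything is explicit because of
   the Euler identity: if D_A raises the degree of a regular function by differentiating with nabla_A, then
   L_0 D_1 - L_1 D_0 is twice the Euler field of the variable q_0. Integrating along the rays t q_0 therefore gives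
   a preimage under (f, g) |-> L_0 f + L_1 g of a regular function vanishing on X, and similarly the potential
   h = 1/2 * integral of t * (D_1 g + D_0 f)(t q_0, q') over 0 < t < 1 of a pair in the kernel. These formulas
   differentiate C^1 functions, so one needs elliptic regularity: components of regular functions are weakly
   harmonic, hence given by integrals against the Newton kernel, hence smooth and even restrictions of
   holomorphic functions on C^(4n). Off X the kernel is treated by solving a linear system; for surjectivity one
   writes F = L_1 g, where the last component of g solves an overdetermined first-order system along complex vector
   fields. In the complexification their leaves are affine subspaces, and the system is solved by the Poincare
   lemma on each leaf. *)
theory Submission
  imports Defs "HOL-Complex_Analysis.Complex_Analysis"
begin

text \<open>Exactness concerns germs, so each construction only has to work on a small neighbourhood
  of a point. Symmetric tensors are replaced by components \<open>\<phi> j\<close>, where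
  \<open>j\<close> counts the indices \<open>P1\<close>; regularity then links consecutive
  components only, and \<open>L_A\<close> multiplies the pair (\<open>\<phi> j\<close>,
  \<open>\<phi> (Suc j)\<close>) by the row (\<open>zvar A P0\<close>, \<open>zvar A P1\<close>).
  Two algebraic facts carry the calculations: the derivatives of \<open>z_B\<close> along the nablas
  are constants, antisymmetric in the primed indices, and every component of a regular function is
  0-regular. The weight t in the potential h comes from homogeneity: \<open>z_A\<close> at (t q_0,
  q') is t times \<open>z_A\<close> at q, which turns the integrand of \<open>L_A h\<close> into the
  derivative of t g or of -t f. Off X, where say \<open>z_1^{0'}\<close> is nonzero,
  \<open>L_1 g = F\<close> determines all components of g from the last one. Regularity of g becomes
  a system for that component alone, whose integrability condition is the 0-regularity of the last
  component of F. Its vector fields are genuinely complex and have no leaves among the real points,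
  which is what forces the passage to holomorphic extensions.\<close>

section \<open>Functions of class \<open>C\<^sup>r\<close> and parametric integrals\<close>

text \<open>An arbitrary value where \<open>f\<close> is not differentiable.\<close>

definition dird :: "'a::euclidean_space \<Rightarrow> ('a \<Rightarrow> 'b::real_normed_vector) \<Rightarrow> 'a \<Rightarrow> 'b" where
  "dird v f x = frechet_derivative f (at x) v"

text \<open>All real directions are allowed, not only the coordinate ones, so that the class is
  invariant under linear maps; \<open>Ck_basisI\<close> gives back the coordinate test.\<close>

fun Ck :: "nat \<Rightarrow> 'a::euclidean_space set \<Rightarrow> ('a \<Rightarrow> 'b::real_normed_vector) \<Rightarrow> bool" where
  "Ck 0 U f \<longleftrightarrow> continuous_on U f"
| "Ck (Suc r) U f \<longleftrightarrow> (\<forall>x\<in>U. f differentiable (at x)) \<and> (\<forall>v. Ck r U (dird v f))"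

lemma dird_eqI: "(f has_derivative D) (at x) \<Longrightarrow> dird v f x = D v"
  unfolding dird_def by (metis frechet_derivative_at)

lemma has_derivative_dird: "f differentiable (at x) \<Longrightarrow> (f has_derivative (\<lambda>v. dird v f x)) (at x)"
  unfolding dird_def by (simp add: frechet_derivative_works[symmetric])

lemma linear_dird: "f differentiable (at x) \<Longrightarrow> linear (\<lambda>v. dird v f x)"
  by (rule has_derivative_linear[OF has_derivative_dird])

lemma dird_cong_open:
  assumes "open U" "x \<in> U" "\<And>y. y \<in> U \<Longrightarrow> f y = g y"
  shows "dird v f x = dird v g x"
proof -
  have "(f has_derivative D) (at x) \<longleftrightarrow> (g has_derivative D) (at x)" for D
    using has_derivative_transform_within_open[OF _ assms(1,2), where f=f and g=g and f'=D]
      has_derivative_transform_within_open[OF _ assms(1,2), where f=g and g=f and f'=D] assms(3) by auto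
  then show ?thesis unfolding dird_def frechet_derivative_def by simp
qed

lemma differentiable_cong_open:
  assumes "open U" "x \<in> U" "\<And>y. y \<in> U \<Longrightarrow> f y = g y" "f differentiable (at x)"
  shows "g differentiable (at x)"
  using assms(4) has_derivative_transform_within_open[OF _ assms(1,2), where f=f and g=g] assms(3)
  unfolding differentiable_def by auto

lemma Ck_cong:
  assumes "open U" "\<And>y. y \<in> U \<Longrightarrow> f y = g y"
  shows "Ck r U f \<longleftrightarrow> Ck r U g"
  using assms(2)
proof (induction r arbitrary: f g)
  case 0 then show ?case by (simp cong: continuous_on_cong)
next
  case (Suc r)
  have "Ck r U (dird v f) \<longleftrightarrow> Ck r U (dird v g)" for v
    using Suc.prems by (intro Suc.IH dird_cong_open[OF assms(1)]) auto
  moreover have "(\<forall>x\<in>U. f differentiable (at x)) \<longleftrightarrow> (\<forall>x\<in>U. g differentiable (at x))"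
    using differentiable_cong_open[OF assms(1), of _ f g] differentiable_cong_open[OF assms(1), of _ g f]
      Suc.prems by auto
  ultimately show ?case by simp
qed

lemma Ck_subset: "Ck r U f \<Longrightarrow> V \<subseteq> U \<Longrightarrow> Ck r V f"
  by (induction r arbitrary: f) (auto intro: continuous_on_subset)

lemma Ck_continuous: "Ck r U f \<Longrightarrow> continuous_on U f"
  by (cases r) (auto intro!: differentiable_imp_continuous_on simp: differentiable_on_def differentiable_at_withinI)

lemma Ck_mono: "Ck r U f \<Longrightarrow> s \<le> r \<Longrightarrow> Ck s U f"
proof (induction s arbitrary: r f)
  case 0 then show ?case using Ck_continuous by auto
next
  case (Suc s) then show ?case by (cases r) auto
qed

lemma Ck_differentiable: "Ck r U f \<Longrightarrow> 0 < r \<Longrightarrow> x \<in> U \<Longrightarrow> f differentiable (at x)"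
  by (cases r) auto

lemma Ck_dird: "Ck r U f \<Longrightarrow> Suc s \<le> r \<Longrightarrow> Ck s U (dird v f)"
  by (cases r) (auto intro: Ck_mono)

lemma Ck_local:
  assumes "\<And>x. x \<in> U \<Longrightarrow> \<exists>V. open V \<and> x \<in> V \<and> Ck r V f"
  shows "Ck r U f"
  using assms
proof (induction r arbitrary: f)
  case 0
  show ?case
  proof (simp, intro continuous_at_imp_continuous_on ballI)
    fix x assume "x \<in> U"
    then obtain V where "open V" "x \<in> V" "continuous_on V f" using 0[of x] by auto
    then show "isCont f x" by (simp add: continuous_on_eq_continuous_at)
  qed
next
  case (Suc r)
  have "Ck r U (dird v f)" for v
  proof (rule Suc.IH)
    fix x assume "x \<in> U"
    then obtain V where "open V" "x \<in> V" "Ck (Suc r) V f" using Suc.prems[of x] by auto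
    then show "\<exists>V. open V \<and> x \<in> V \<and> Ck r V (dird v f)" by auto
  qed
  moreover have "f differentiable (at x)" if "x \<in> U" for x using Suc.prems[OF that] by auto
  ultimately show ?case by auto
qed

lemma dird_const [simp]: "dird v (\<lambda>_. c) x = 0"
  by (rule dird_eqI[where D="\<lambda>_. 0"]) simp

lemma Ck_const [simp]: "Ck r U (\<lambda>_. c)"
proof (induction r arbitrary: c)
  case (Suc r)
  have "dird v (\<lambda>_. c) = (\<lambda>_. 0)" for v :: 'a by (rule ext) simp
  then show ?case using Suc by simp
qed simp

lemma dird_linear: "bounded_linear f \<Longrightarrow> dird v f x = f v"
  by (rule dird_eqI) (rule bounded_linear_imp_has_derivative)

lemma Ck_linear: "bounded_linear f \<Longrightarrow> Ck r U f"
proof (cases r)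
  case (Suc s)
  assume bl: "bounded_linear f"
  have "dird v f = (\<lambda>_. f v)" for v by (rule ext) (simp add: dird_linear bl)
  then show ?thesis using Suc bl bounded_linear_imp_differentiable by auto
qed (simp add: linear_continuous_on)

lemma dird_add:
  assumes "f differentiable (at x)" "g differentiable (at x)"
  shows "dird v (\<lambda>x. f x + g x) x = dird v f x + dird v g x"
  by (rule dird_eqI[where D="\<lambda>v. dird v f x + dird v g x"])
    (intro has_derivative_add has_derivative_dird assms)

lemma Ck_add:
  assumes "open U" "Ck r U f" "Ck r U g" shows "Ck r U (\<lambda>x. f x + g x)"
  using assms(2,3)
proof (induction r arbitrary: f g)
  case 0 then show ?case by (simp add: continuous_on_add)
next
  case (Suc r)
  have "Ck r U (dird v (\<lambda>x. f x + g x))" for v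
    using Suc.IH[of "dird v f" "dird v g"] Suc.prems
    by (subst Ck_cong[OF assms(1), where g="\<lambda>x. dird v f x + dird v g x"]) (auto simp: dird_add)
  then show ?case using Suc.prems by (auto intro: differentiable_add)
qed

lemma has_derivative_bilinear_dird:
  assumes "bounded_bilinear p" "f differentiable (at x)" "g differentiable (at x)"
  shows "((\<lambda>x. p (f x) (g x)) has_derivative (\<lambda>v. p (f x) (dird v g x) + p (dird v f x) (g x))) (at x)"
  using bounded_bilinear.FDERIV[OF assms(1) has_derivative_dird[OF assms(2)] has_derivative_dird[OF assms(3)]] .

text \<open>One Leibniz induction serves products, real and complex scalar multiples and inner
  products.\<close>

lemma Ck_bilinear:
  assumes p: "bounded_bilinear p" and "open U" "Ck r U f" "Ck r U g"
  shows "Ck r U (\<lambda>x. p (f x) (g x))"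
  using assms(3,4)
proof (induction r arbitrary: f g)
  case 0 then show ?case by (simp add: bounded_bilinear.continuous_on[OF p])
next
  case (Suc r)
  have fg: "f differentiable (at x)" "g differentiable (at x)" if "x \<in> U" for x using Suc.prems that by auto
  have "Ck r U (dird v (\<lambda>x. p (f x) (g x)))" for v
    using dird_eqI[OF has_derivative_bilinear_dird[OF p fg]] Suc.prems
    by (subst Ck_cong[OF assms(2), where g="\<lambda>x. p (f x) (dird v g x) + p (dird v f x) (g x)"])
      (auto intro!: Ck_add Suc.IH assms(2) intro: Ck_mono[of "Suc r"])
  moreover have "(\<lambda>x. p (f x) (g x)) differentiable (at x)" if "x \<in> U" for x
    using has_derivative_bilinear_dird[OF p fg[OF that]] by (auto simp: differentiable_def)
  ultimately show ?case by auto
qed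

lemmas Ck_mult = Ck_bilinear[OF bounded_bilinear_mult]
lemmas Ck_scaleR = Ck_bilinear[OF bounded_bilinear_scaleR]

lemma dird_mult:
  fixes f g :: "'a::euclidean_space \<Rightarrow> 'b::real_normed_algebra"
  assumes "f differentiable (at x)" "g differentiable (at x)"
  shows "dird v (\<lambda>x. f x * g x) x = f x * dird v g x + dird v f x * g x"
  by (rule dird_eqI[OF has_derivative_bilinear_dird[OF bounded_bilinear_mult assms]])

lemma dird_sum:
  assumes "\<And>i. i \<in> I \<Longrightarrow> (f i) differentiable (at x)"
  shows "dird v (\<lambda>x. \<Sum>i\<in>I. f i x) x = (\<Sum>i\<in>I. dird v (f i) x)"
  by (rule dird_eqI[where D="\<lambda>v. \<Sum>i\<in>I. dird v (f i) x"])
    (intro has_derivative_sum has_derivative_dird assms)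

lemma Ck_sum:
  assumes "open U" "\<And>i. i \<in> I \<Longrightarrow> Ck r U (f i)" shows "Ck r U (\<lambda>x. \<Sum>i\<in>I. f i x)"
  using assms(2) by (induction I rule: infinite_finite_induct) (auto intro!: Ck_add assms(1))

lemma Ck_diff:
  assumes "open U" "Ck r U f" "Ck r U g" shows "Ck r U (\<lambda>x. f x - g x)"
  using Ck_add[OF assms(1,2) Ck_scaleR[OF assms(1) Ck_const[of r U "- 1"] assms(3)]] by simp

lemma dird_chain:
  assumes "\<phi> differentiable (at x)" "g differentiable (at (\<phi> x))"
  shows "dird v (\<lambda>x. g (\<phi> x)) x = dird (dird v \<phi> x) g (\<phi> x)"
  using dird_eqI[OF diff_chain_at[OF has_derivative_dird[OF assms(1)] has_derivative_dird[OF assms(2)]]]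
  by (simp add: o_def)

lemma dird_basis_expansion:
  assumes "g differentiable (at y)"
  shows "dird w g y = (\<Sum>e\<in>Basis. (w \<bullet> e) *\<^sub>R dird e g y)"
proof -
  interpret linear "\<lambda>v. dird v g y" by (rule linear_dird[OF assms])
  show ?thesis by (subst euclidean_representation[of w, symmetric]) (simp add: sum scale del: euclidean_representation)
qed

text \<open>The direction \<open>dird v \<phi> x\<close> of the outer derivative varies with
  \<open>x\<close>. Expanding it in \<open>Basis\<close> leaves sums of products of functions
  already covered by the induction.\<close>

lemma Ck_compose:
  assumes "open U" "open V" "Ck r U \<phi>" "Ck r V g" "\<phi> ` U \<subseteq> V"
  shows "Ck r U (\<lambda>x. g (\<phi> x))"
  using assms(3,4)
proof (induction r arbitrary: g)
  case 0 then show ?case using assms(5) by (auto intro: continuous_on_compose2)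
next
  case (Suc r)
  have d: "\<phi> differentiable (at x)" "g differentiable (at (\<phi> x))" if "x \<in> U" for x
    using Suc.prems that assms(5) by auto
  have e: "dird v (\<lambda>x. g (\<phi> x)) x = (\<Sum>e\<in>Basis. (dird v \<phi> x \<bullet> e) *\<^sub>R dird e g (\<phi> x))" if "x \<in> U" for v x
    unfolding dird_chain[OF d[OF that]] by (rule dird_basis_expansion[OF d(2)[OF that]])
  have "Ck r U (dird v (\<lambda>x. g (\<phi> x)))" for v
  proof (subst Ck_cong[OF assms(1) e], assumption, intro Ck_sum Ck_scaleR assms(1))
    fix e :: 'b assume "e \<in> Basis"
    show "Ck r U (\<lambda>x. dird v \<phi> x \<bullet> e)" using Suc.prems
      by (intro Ck_bilinear[OF bounded_bilinear_inner assms(1)]) auto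
    show "Ck r U (\<lambda>x. dird e g (\<phi> x))" using Suc.prems by (intro Suc.IH) (auto intro: Ck_mono[of "Suc r"])
  qed
  moreover have "(\<lambda>x. g (\<phi> x)) differentiable (at x)" if "x \<in> U" for x
    using differentiable_chain_at[OF d[OF that]] by (simp add: o_def)
  ultimately show ?case by simp
qed

lemma Ck_basisI:
  assumes "open U" "\<And>x. x \<in> U \<Longrightarrow> f differentiable (at x)" "\<And>e. e \<in> Basis \<Longrightarrow> Ck r U (dird e f)"
  shows "Ck (Suc r) U f"
proof -
  have "Ck r U (dird v f)" for v
    by (subst Ck_cong[OF assms(1) dird_basis_expansion]) (auto intro!: assms Ck_sum Ck_scaleR)
  then show ?thesis using assms by simp
qed

lemma Ck_inverse_complex: "Ck r (- {0::complex}) inverse"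
proof (induction r)
  case 0 show ?case by (auto intro!: continuous_intros)
next
  case (Suc r)
  have d: "(inverse has_derivative (\<lambda>v. - (inverse x * v * inverse x))) (at x)" if "x \<in> - {0::complex}" for x
    using that by (auto intro!: derivative_eq_intros)
  have "Ck r (- {0::complex}) (dird v inverse)" for v
  proof (subst Ck_cong[where g="\<lambda>x. (- v) * (inverse x * inverse x)"])
    show "Ck r (- {0}) (\<lambda>x. - v * (inverse x * inverse x))"
      by (intro Ck_mult Ck_const Suc) auto
  qed (use dird_eqI[OF d] in auto)
  moreover have "inverse differentiable (at x)" if "x \<in> - {0::complex}" for x using d[OF that] by (auto simp: differentiable_def)
  ultimately show ?case by auto
qed

lemma Ck_inverse:
  fixes f :: "'a::euclidean_space \<Rightarrow> complex"
  assumes "open U" "Ck r U f" "\<And>x. x \<in> U \<Longrightarrow> f x \<noteq> 0"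
  shows "Ck r U (\<lambda>x. inverse (f x))"
  by (rule Ck_compose[OF assms(1) _ assms(2) Ck_inverse_complex]) (use assms(3) in auto)

lemma Ck_power:
  fixes f :: "'a::euclidean_space \<Rightarrow> 'b::real_normed_algebra_1"
  assumes "open U" "Ck r U f"
  shows "Ck r U (\<lambda>x. f x ^ m)"
  by (induction m) (auto intro!: Ck_mult assms)

section \<open>Differentiation under an integral over a box\<close>

fun parCk :: "nat \<Rightarrow> 'a::euclidean_space set \<Rightarrow> 'c::topological_space set \<Rightarrow> ('a \<Rightarrow> 'c \<Rightarrow> 'b::real_normed_vector) \<Rightarrow> bool" where
  "parCk 0 U S H \<longleftrightarrow> continuous_on (U \<times> S) (\<lambda>(x,t). H x t)"
| "parCk (Suc r) U S H \<longleftrightarrow> continuous_on (U \<times> S) (\<lambda>(x,t). H x t) \<and>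
     (\<forall>x\<in>U. \<forall>t\<in>S. (\<lambda>x. H x t) differentiable (at x)) \<and> (\<forall>v. parCk r U S (\<lambda>x t. dird v (\<lambda>x. H x t) x))"

lemma parCk_continuous: "parCk r U S H \<Longrightarrow> continuous_on (U \<times> S) (\<lambda>(x,t). H x t)"
  by (cases r) auto

lemma parCk_slice: "parCk r U S H \<Longrightarrow> x \<in> U \<Longrightarrow> continuous_on S (H x)"
proof -
  assume "parCk r U S H" "x \<in> U"
  from parCk_continuous[OF this(1)] have "continuous_on S ((\<lambda>(x,t). H x t) \<circ> (\<lambda>t. (x,t)))"
    using \<open>x \<in> U\<close> by (intro continuous_on_compose continuous_intros) (auto elim: continuous_on_subset)
  then show ?thesis by (simp add: o_def)
qed

text \<open>\<open>leibniz_rule\<close> wants the derivative as a jointly continuous family of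
  bounded linear maps. In finite dimension continuity on each basis vector is enough, and that is
  what \<open>parCk\<close> records.\<close>

lemma parametric_integral_derivative:
  fixes H :: "'a::euclidean_space \<Rightarrow> 'c::euclidean_space \<Rightarrow> complex"
  assumes U: "open U" and H: "parCk (Suc r) U (cbox a b) H" and x: "x \<in> U"
  shows "((\<lambda>x. integral (cbox a b) (H x)) has_derivative
           (\<lambda>v. integral (cbox a b) (\<lambda>t. dird v (\<lambda>x. H x t) x))) (at x)"
proof -
  obtain e where e: "e > 0" "ball x e \<subseteq> U" using U x openE by blast
  define fx where "fx = (\<lambda>x t. Blinfun (\<lambda>v. dird v (\<lambda>x. H x t) x))"
  have d: "(\<lambda>x. H x t) differentiable (at y)" if "y \<in> U" "t \<in> cbox a b" for y t using H that by auto
  have fx: "blinfun_apply (fx y t) = (\<lambda>v. dird v (\<lambda>x. H x t) y)" if "y \<in> U" "t \<in> cbox a b" for y t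
    unfolding fx_def using has_derivative_bounded_linear[OF has_derivative_dird[OF d[OF that]]]
    by (rule bounded_linear_Blinfun_apply)
  have cont: "continuous_on (ball x e \<times> cbox a b) (\<lambda>(y,t). fx y t)"
  proof (rule continuous_on_blinfun_componentwise)
    fix i :: 'a assume "i \<in> Basis"
    have "continuous_on (U \<times> cbox a b) (\<lambda>(y,t). dird i (\<lambda>x. H x t) y)"
      by (rule parCk_continuous) (use H in auto)
    then have "continuous_on (ball x e \<times> cbox a b) (\<lambda>(y,t). dird i (\<lambda>x. H x t) y)"
      by (rule continuous_on_subset) (use e in auto)
    then show "continuous_on (ball x e \<times> cbox a b) (\<lambda>z. blinfun_apply (case z of (y, t) \<Rightarrow> fx y t) i)"
      by (rule continuous_on_eq) (use e fx in auto)
  qed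
  have "((\<lambda>x. integral (cbox a b) (H x)) has_derivative integral (cbox a b) (fx x)) (at x within ball x e)"
  proof (rule leibniz_rule[OF _ _ cont])
    show "((\<lambda>x. H x t) has_derivative blinfun_apply (fx y t)) (at y within ball x e)"
      if "y \<in> ball x e" "t \<in> cbox a b" for y t
    proof -
      have y: "y \<in> U" using e that by auto
      show ?thesis using has_derivative_dird[OF d[OF y that(2)]] fx[OF y that(2)]
        by (simp add: has_derivative_at_withinI)
    qed
    show "H y integrable_on cbox a b" if "y \<in> ball x e" for y
      using parCk_slice[OF H] e that integrable_continuous by blast
  qed (use e in auto)
  then have "((\<lambda>x. integral (cbox a b) (H x)) has_derivative integral (cbox a b) (fx x)) (at x)"
    using e by (simp add: at_within_open[of x "ball x e"])
  moreover have "blinfun_apply (integral (cbox a b) (fx x)) v = integral (cbox a b) (\<lambda>t. dird v (\<lambda>x. H x t) x)" for v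
  proof -
    have "continuous_on (cbox a b) ((\<lambda>(y,t). fx y t) \<circ> (\<lambda>t. (x,t)))"
      using e by (intro continuous_on_compose continuous_intros continuous_on_subset[OF cont]) auto
    then have "fx x integrable_on cbox a b" by (intro integrable_continuous) (simp add: o_def)
    then have "blinfun_apply (integral (cbox a b) (fx x)) v = integral (cbox a b) (\<lambda>t. blinfun_apply (fx x t) v)"
      by (rule blinfun_apply_integral)
    also have "\<dots> = integral (cbox a b) (\<lambda>t. dird v (\<lambda>x. H x t) x)"
      by (intro integral_cong) (use fx x in auto)
    finally show ?thesis .
  qed
  then have "blinfun_apply (integral (cbox a b) (fx x)) = (\<lambda>v. integral (cbox a b) (\<lambda>t. dird v (\<lambda>x. H x t) x))"
    by (rule ext)
  ultimately show ?thesis by simp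
qed

lemma dird_parametric_integral:
  fixes H :: "'a::euclidean_space \<Rightarrow> 'c::euclidean_space \<Rightarrow> complex"
  assumes "open U" "parCk (Suc r) U (cbox a b) H" "x \<in> U"
  shows "dird v (\<lambda>x. integral (cbox a b) (H x)) x = integral (cbox a b) (\<lambda>t. dird v (\<lambda>x. H x t) x)"
  by (rule dird_eqI[OF parametric_integral_derivative[OF assms]])

lemma Ck_parametric_integral:
  fixes H :: "'a::euclidean_space \<Rightarrow> 'c::euclidean_space \<Rightarrow> complex"
  assumes "open U" "parCk r U (cbox a b) H"
  shows "Ck r U (\<lambda>x. integral (cbox a b) (H x))"
  using assms(2)
proof (induction r arbitrary: H)
  case 0 then show ?case
    using integral_continuous_on_param[of U a b H] by simp
next
  case (Suc r)
  have "Ck r U (dird v (\<lambda>x. integral (cbox a b) (H x)))" for v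
    using Suc by (subst Ck_cong[OF assms(1) dird_parametric_integral[OF assms(1) Suc.prems]]) auto
  moreover have "(\<lambda>x. integral (cbox a b) (H x)) differentiable (at x)" if "x \<in> U" for x
    using parametric_integral_derivative[OF assms(1) Suc.prems that] by (auto simp: differentiable_def)
  ultimately show ?case by simp
qed

lemma dird_slice:
  assumes "h differentiable (at (x,t))"
  shows "(\<lambda>x. h (x,t)) differentiable (at x)" "dird v (\<lambda>x. h (x,t)) x = dird (v,0) h (x,t)"
proof -
  have p: "((\<lambda>x. (x,t)) has_derivative (\<lambda>v. (v,0))) (at x)" by (auto intro!: derivative_eq_intros)
  from diff_chain_at[OF this has_derivative_dird[OF assms]]
  have "((\<lambda>x. h (x,t)) has_derivative (\<lambda>v. dird (v,0) h (x,t))) (at x)" by (simp add: o_def)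
  then show "(\<lambda>x. h (x,t)) differentiable (at x)" "dird v (\<lambda>x. h (x,t)) x = dird (v,0) h (x,t)"
    by (auto simp: differentiable_def dird_eqI)
qed

lemma parCk_cong:
  assumes "open U" "\<And>x t. x \<in> U \<Longrightarrow> t \<in> S \<Longrightarrow> H x t = H' x t"
  shows "parCk r U S H \<longleftrightarrow> parCk r U S H'"
  using assms(2)
proof (induction r arbitrary: H H')
  case 0 show ?case unfolding parCk.simps by (rule continuous_on_cong) (use 0 in auto)
next
  case (Suc r)
  have "parCk r U S (\<lambda>x t. dird v (\<lambda>x. H x t) x) \<longleftrightarrow> parCk r U S (\<lambda>x t. dird v (\<lambda>x. H' x t) x)" for v
    using Suc.prems by (intro Suc.IH dird_cong_open[OF assms(1)]) auto
  moreover have "(\<lambda>x. H x t) differentiable (at x) \<longleftrightarrow> (\<lambda>x. H' x t) differentiable (at x)"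
    if "x \<in> U" "t \<in> S" for x t
    using differentiable_cong_open[OF assms(1) that(1), of "\<lambda>x. H x t" "\<lambda>x. H' x t"]
      differentiable_cong_open[OF assms(1) that(1), of "\<lambda>x. H' x t" "\<lambda>x. H x t"] Suc.prems that by metis
  moreover have "continuous_on (U \<times> S) (\<lambda>(x,t). H x t) \<longleftrightarrow> continuous_on (U \<times> S) (\<lambda>(x,t). H' x t)"
    by (rule continuous_on_cong) (use Suc.prems in auto)
  ultimately show ?case by simp
qed

lemma parCk_of_Ck:
  fixes h :: "'a::euclidean_space \<times> 'c::euclidean_space \<Rightarrow> 'b::real_normed_vector"
  assumes "open U" "Ck r W h" "U \<times> S \<subseteq> W"
  shows "parCk r U S (\<lambda>x t. h (x,t))"
  using assms(2)
proof (induction r arbitrary: h)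
  case 0 then show ?case using assms(3) by (auto intro: continuous_on_subset simp: split_beta)
next
  case (Suc r)
  have d: "h differentiable (at (x,t))" if "x \<in> U" "t \<in> S" for x t using that Suc.prems assms(3) by auto
  have "parCk r U S (\<lambda>x t. dird v (\<lambda>x. h (x,t)) x)" for v
    using Suc dird_slice(2)[OF d]
    by (subst parCk_cong[OF assms(1), where H'="\<lambda>x t. dird (v,0) h (x,t)"]) auto
  then show ?case using Ck_continuous[OF Suc.prems] assms(3) dird_slice(1)[OF d]
    by (auto intro: continuous_on_subset simp: split_beta)
qed

section \<open>Holomorphic functions on complex vector spaces\<close>

lemma has_vector_derivative_line:
  assumes "f differentiable (at (y + t *\<^sub>R v))"
  shows "((\<lambda>t. f (y + t *\<^sub>R v)) has_vector_derivative dird v f (y + t *\<^sub>R v)) (at t)"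
proof -
  have "((\<lambda>t. y + t *\<^sub>R v) has_derivative (\<lambda>s. s *\<^sub>R v)) (at t)"
    by (auto intro!: derivative_eq_intros)
  from diff_chain_at[OF this has_derivative_dird[OF assms]]
  show ?thesis unfolding has_vector_derivative_def o_def
    by (simp add: linear_scale[OF linear_dird[OF assms]])
qed

lemma dird_shift:
  assumes "f differentiable (at (x + c))"
  shows "dird u (\<lambda>x. f (x + c)) x = dird u f (x + c)"
proof -
  have "((\<lambda>x. x + c) has_derivative (\<lambda>u. u)) (at x)" by (auto intro!: derivative_eq_intros)
  from diff_chain_at[OF this has_derivative_dird[OF assms]] show ?thesis
    by (simp add: o_def dird_eqI)
qed

text \<open>Symmetry of second derivatives without difference quotients: write
  \<open>f (x + t *\<^sub>R v) - f x\<close> as an integral of \<open>dird v f\<close>,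
  differentiate in \<open>x\<close> along \<open>u\<close> under the integral, then differentiate in
  \<open>t\<close> at 0.\<close>

lemma dird_commute:
  fixes f :: "'a::euclidean_space \<Rightarrow> complex"
  assumes U: "open U" and f: "Ck 2 U f" and y: "y \<in> U"
  shows "dird u (dird v f) y = dird v (dird u f) y"
proof -
  obtain e where e: "e > 0" "ball y e \<subseteq> U" using U y openE by blast
  \<comment> \<open>The summand 1 keeps the quotient meaningful for \<open>v = 0\<close>; segments
    of length \<open>d\<close> from the half ball stay in the full ball.\<close>
  define d where "d = e / 2 / (1 + norm v)"
  have nv: "1 + norm v > 0" by (simp add: add_pos_nonneg)
  have d: "d > 0" "d * norm v < e / 2"
  proof -
    show "d > 0" using e nv by (simp add: d_def)
    have "d * norm v < d * (1 + norm v)" using \<open>d > 0\<close> by (simp add: algebra_simps)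
    also have "\<dots> = e / 2" 
      by (rule iffD1[OF nonzero_eq_divide_eq d_def]) (use nv in simp)
    finally show "d * norm v < e / 2" .
  qed
  have in_U: "x + t *\<^sub>R v \<in> U" if "x \<in> ball y (e/2)" "t \<in> {0..d}" for x t
  proof -
    have "norm (t *\<^sub>R v) \<le> d * norm v" using that by (auto intro: mult_right_mono)
    then have "norm (t *\<^sub>R v) < e / 2" using d by simp
    moreover have "dist y (x + t *\<^sub>R v) \<le> dist y x + norm (t *\<^sub>R v)"
      using dist_triangle[of y "x + t *\<^sub>R v" x] by (simp add: dist_norm)
    ultimately have "dist y (x + t *\<^sub>R v) < e" using that by simp
    then show ?thesis using e by auto
  qed
  have f2: "Ck (Suc (Suc 0)) U f" using f by (simp add: numeral_2_eq_2)
  have d1: "f differentiable (at x)" if "x \<in> U" for x using f2 that by auto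
  have d2: "dird w f differentiable (at x)" if "x \<in> U" for x w using f2 that by auto
  define W where "W = (\<lambda>p. fst p + snd p *\<^sub>R v) -` U"
  have bl: "bounded_linear (\<lambda>p::'a \<times> real. fst p + snd p *\<^sub>R v)"
    by (rule bounded_linear_add[OF bounded_linear_fst
          bounded_linear_compose[OF bounded_linear_scaleR_left bounded_linear_snd]])
  have W: "open W" unfolding W_def
    by (intro open_vimage U linear_continuous_on bl)
  have CkW: "Ck (Suc 0) W (\<lambda>p. dird v f (fst p + snd p *\<^sub>R v))"
    by (rule Ck_compose[OF W U Ck_linear[OF bl]]) (use f2 in \<open>auto simp: W_def\<close>)
  have par: "parCk (Suc 0) (ball y (e/2)) (cbox 0 t) (\<lambda>x s. dird v f (x + s *\<^sub>R v))" if "t \<in> {0..d}" for t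
  proof -
    have "ball y (e/2) \<times> cbox 0 t \<subseteq> W" using that in_U by (auto simp: W_def)
    from parCk_of_Ck[OF open_ball CkW this] show ?thesis by (simp only: fst_conv snd_conv)
  qed
  have ftc: "integral (cbox 0 t) (\<lambda>s. dird v f (x + s *\<^sub>R v)) = f (x + t *\<^sub>R v) - f x"
    if "x \<in> ball y (e/2)" "t \<in> {0..d}" for x t
  proof -
    have "((\<lambda>s. dird v f (x + s *\<^sub>R v)) has_integral (f (x + t *\<^sub>R v) - f (x + 0 *\<^sub>R v))) {0..t}"
      using that in_U[OF that(1)]
      by (intro fundamental_theorem_of_calculus)
        (auto intro!: has_vector_derivative_at_within[OF has_vector_derivative_line] d1)
    then show ?thesis by (simp add: integral_unique)
  qed
  have key: "dird u f (y + t *\<^sub>R v) = dird u f y + integral {0..t} (\<lambda>s. dird u (dird v f) (y + s *\<^sub>R v))"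
    if t: "t \<in> {0..d}" for t
  proof -
    have yb: "y \<in> ball y (e/2)" using e by simp
    have "dird u (\<lambda>x. f (x + t *\<^sub>R v)) y
        = dird u (\<lambda>x. f x + integral (cbox 0 t) (\<lambda>s. dird v f (x + s *\<^sub>R v))) y"
      using ftc t by (intro dird_cong_open[of "ball y (e/2)"] yb) auto
    also have "\<dots> = dird u f y + dird u (\<lambda>x. integral (cbox 0 t) (\<lambda>s. dird v f (x + s *\<^sub>R v))) y"
      using parametric_integral_derivative[OF _ par[OF t] yb]
      by (intro dird_add d1 y) (auto simp: differentiable_def)
    also have "dird u (\<lambda>x. integral (cbox 0 t) (\<lambda>s. dird v f (x + s *\<^sub>R v))) y
        = integral (cbox 0 t) (\<lambda>s. dird u (\<lambda>x. dird v f (x + s *\<^sub>R v)) y)"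
      by (rule dird_parametric_integral[OF _ par[OF t] yb]) simp
    also have "\<dots> = integral (cbox 0 t) (\<lambda>s. dird u (dird v f) (y + s *\<^sub>R v))"
      using in_U[OF yb] t by (intro integral_cong dird_shift d2) auto
    finally show ?thesis using dird_shift[OF d1[OF in_U[OF yb t]]] by simp
  qed
  have c: "continuous_on {0..d} (\<lambda>s. dird u (dird v f) (y + s *\<^sub>R v))"
    by (rule continuous_on_compose2[of U "dird u (dird v f)"])
      (use f2 in_U[of y] e in \<open>auto intro!: continuous_intros\<close>)
  have "((\<lambda>t. integral {0..t} (\<lambda>s. dird u (dird v f) (y + s *\<^sub>R v))) has_vector_derivative
      dird u (dird v f) (y + 0 *\<^sub>R v)) (at 0 within {0..d})"
    using d by (intro integral_has_vector_derivative c) auto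
  then have "((\<lambda>t. dird u f y + integral {0..t} (\<lambda>s. dird u (dird v f) (y + s *\<^sub>R v))) has_vector_derivative
      dird u (dird v f) y) (at 0 within {0..d})"
    by (auto intro!: derivative_eq_intros)
  then have "((\<lambda>t. dird u f (y + t *\<^sub>R v)) has_vector_derivative dird u (dird v f) y) (at 0 within {0..d})"
    by (rule has_vector_derivative_transform[rotated 2]) (use key d in auto)
  moreover have "((\<lambda>t. dird u f (y + t *\<^sub>R v)) has_vector_derivative dird v (dird u f) y) (at 0 within {0..d})"
    using has_vector_derivative_line[of "dird u f" y 0 v] d2[OF y] by (simp add: has_vector_derivative_at_within)
  ultimately show ?thesis
    using d by (intro vector_derivative_unique_within_closed_interval[of 0 d 0]) auto
qed

text \<open>Holomorphy phrased as complex linearity of the real derivative, so that the real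
  calculus above applies unchanged.\<close>

definition chol :: "(complex ^ 'm) set \<Rightarrow> (complex ^ 'm::finite \<Rightarrow> complex) \<Rightarrow> bool" where
  "chol W F \<longleftrightarrow> (\<forall>z\<in>W. F differentiable (at z) \<and> (\<forall>v. dird (\<i> *s v) F z = \<i> * dird v F z))"

lemma vec_complex_decomp: "c *s v = Re c *\<^sub>R v + Im c *\<^sub>R (\<i> *s v)" for v :: "complex ^ 'm::finite"
  by (simp add: vec_eq_iff complex_eq_iff)

lemma chol_scale: "chol W F \<Longrightarrow> z \<in> W \<Longrightarrow> dird (c *s v) F z = c * dird v F z"
proof -
  assume a: "chol W F" "z \<in> W"
  then have l: "linear (\<lambda>v. dird v F z)" using linear_dird unfolding chol_def by blast
  then have "dird (c *s v) F z = Re c *\<^sub>R dird v F z + Im c *\<^sub>R dird (\<i> *s v) F z"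
    by (subst vec_complex_decomp) (simp only: linear_add[OF l] linear_scale[OF l])
  also have "dird (\<i> *s v) F z = \<i> * dird v F z" using a unfolding chol_def by blast
  finally show ?thesis by (simp add: complex_eq_iff)
qed

lemma chol_add_dir: "chol W F \<Longrightarrow> z \<in> W \<Longrightarrow> dird (v + w) F z = dird v F z + dird w F z"
  using linear_dird linear_add unfolding chol_def by blast

lemma chol_sum_dir: "chol W F \<Longrightarrow> z \<in> W \<Longrightarrow> dird (\<Sum>i\<in>I. v i) F z = (\<Sum>i\<in>I. dird (v i) F z)"
  using linear_sum[OF linear_dird, of F z v I] unfolding chol_def by blast

lemma chol_const: "chol W (\<lambda>_. c)"
  by (simp add: chol_def)

lemma chol_nth: "chol W (\<lambda>z. z $ i)" and dird_nth: "dird v (\<lambda>z. z $ i) z = v $ i" for i :: "'m::finite" and v :: "complex ^ 'm"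
proof -
  have b: "bounded_linear (\<lambda>z::complex^'m. z $ i)" by (rule bounded_linear_vec_nth)
  show "chol W (\<lambda>z. z $ i)" unfolding chol_def using bounded_linear_imp_differentiable[OF b] by (auto simp: dird_linear[OF b])
  show "dird v (\<lambda>z. z $ i) z = v $ i" by (simp add: dird_linear[OF b])
qed

lemma chol_add: "chol W F \<Longrightarrow> chol W G \<Longrightarrow> chol W (\<lambda>z. F z + G z)"
  by (auto simp: chol_def dird_add differentiable_add algebra_simps)

lemma chol_mult: "chol W F \<Longrightarrow> chol W G \<Longrightarrow> chol W (\<lambda>z. F z * G z)"
  by (auto simp: chol_def dird_mult differentiable_mult algebra_simps)

lemma chol_sum: "(\<And>i. i \<in> I \<Longrightarrow> chol W (F i)) \<Longrightarrow> chol W (\<lambda>z. \<Sum>i\<in>I. F i z)"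
  by (induction I rule: infinite_finite_induct) (auto intro: chol_const chol_add)

lemma chol_power: "chol W F \<Longrightarrow> chol W (\<lambda>z. F z ^ m)"
  by (induction m) (auto intro: chol_const chol_mult)

lemma chol_inverse:
  assumes "chol W F" "\<And>z. z \<in> W \<Longrightarrow> F z \<noteq> 0" shows "chol W (\<lambda>z. inverse (F z))"
  unfolding chol_def
proof (intro ballI)
  fix z assume z: "z \<in> W"
  have F: "F differentiable (at z)" using assms z unfolding chol_def by blast
  have d: "((\<lambda>z. inverse (F z)) has_derivative (\<lambda>v. - (inverse (F z) * dird v F z * inverse (F z)))) (at z)"
    by (rule Deriv.has_derivative_inverse[OF assms(2)[OF z] has_derivative_dird[OF F]])
  then show "(\<lambda>z. inverse (F z)) differentiable at z \<and>
         (\<forall>v. dird (\<i> *s v) (\<lambda>z. inverse (F z)) z = \<i> * dird v (\<lambda>z. inverse (F z)) z)"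
    using assms z by (auto simp: differentiable_def dird_eqI[OF d] chol_def)
qed

text \<open>Symmetry of second derivatives lets the direction \<open>\<i> *s w\<close> act on
  \<open>F\<close> first, where the factor \<open>\<i>\<close> comes out.\<close>

lemma chol_dird:
  assumes "open W" "Ck 2 W F" "chol W F" shows "chol W (dird v F)"
  unfolding chol_def
proof (intro ballI conjI allI)
  fix z w assume z: "z \<in> W"
  have F2: "Ck (Suc (Suc 0)) W F" using assms(2) by (simp add: numeral_2_eq_2)
  show "dird v F differentiable at z" using F2 z by auto
  have "dird (\<i> *s w) (dird v F) z = dird v (dird (\<i> *s w) F) z" by (rule dird_commute[OF assms(1,2) z])
  also have "\<dots> = dird v (\<lambda>z. \<i> * dird w F z) z"
    using assms(3) by (intro dird_cong_open[OF assms(1) z]) (auto simp: chol_def)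
  also have "\<dots> = \<i> * dird v (dird w F) z"
    using F2 z by (subst dird_mult) auto
  finally show "dird (\<i> *s w) (dird v F) z = \<i> * dird w (dird v F) z"
    using dird_commute[OF assms(1,2) z] by simp
qed

lemma chol_subset: "chol W F \<Longrightarrow> V \<subseteq> W \<Longrightarrow> chol V F"
  by (auto simp: chol_def)

section \<open>Real points and derivatives along complex vectors\<close>

definition cvec :: "real ^ 'm::finite \<Rightarrow> complex ^ 'm" where
  "cvec x = (\<chi> i. of_real (x $ i))"

lemma cvec_nth [simp]: "cvec x $ i = of_real (x $ i)" by (simp add: cvec_def)

lemma norm_cvec [simp]: "norm (cvec x) = norm x"
  by (simp add: norm_vec_def)

lemma linear_cvec: "linear cvec"
  by (rule linearI) (simp_all add: vec_eq_iff complex_eq_iff)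

lemma bounded_linear_cvec: "bounded_linear cvec"
  by (simp add: linear_cvec linear_conv_bounded_linear[symmetric])

lemma cvec_diff: "cvec (x - y) = cvec x - cvec y" by (simp add: linear_diff linear_cvec)

lemma dist_cvec [simp]: "dist (cvec x) (cvec y) = dist x y"
  by (simp add: dist_norm flip: cvec_diff)

definition Revec :: "complex ^ 'm::finite \<Rightarrow> real ^ 'm" where "Revec v = (\<chi> i. Re (v $ i))"
definition Imvec :: "complex ^ 'm::finite \<Rightarrow> real ^ 'm" where "Imvec v = (\<chi> i. Im (v $ i))"

lemma Revec_Imvec: "cvec (Revec v) + \<i> *s cvec (Imvec v) = v"
  by (simp add: vec_eq_iff complex_eq_iff Revec_def Imvec_def)

lemma Revec_Imvec_simps:
  "Revec (v + w) = Revec v + Revec w" "Imvec (v + w) = Imvec v + Imvec w"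
  "Revec (c *s v) = Re c *\<^sub>R Revec v - Im c *\<^sub>R Imvec v"
  "Imvec (c *s v) = Re c *\<^sub>R Imvec v + Im c *\<^sub>R Revec v"
  by (simp_all add: vec_eq_iff Revec_def Imvec_def)

text \<open>Complex-linear extension of the directional derivative in its direction; the nablas
  become derivatives along constant complex vectors.\<close>

definition cdird :: "complex ^ 'm::finite \<Rightarrow> (real ^ 'm \<Rightarrow> complex) \<Rightarrow> real ^ 'm \<Rightarrow> complex" where
  "cdird v f x = dird (Revec v) f x + \<i> * dird (Imvec v) f x"

lemma cdird_add_dir:
  "f differentiable (at x) \<Longrightarrow> cdird (v + w) f x = cdird v f x + cdird w f x"
  by (simp add: cdird_def Revec_Imvec_simps linear_add[OF linear_dird] algebra_simps)

lemma cdird_scale_dir: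
  "f differentiable (at x) \<Longrightarrow> cdird (c *s v) f x = c * cdird v f x"
  by (simp add: cdird_def Revec_Imvec_simps linear_add[OF linear_dird] linear_diff[OF linear_dird]
      linear_scale[OF linear_dird] complex_eq_iff) (simp add: algebra_simps)

lemma cdird_const [simp]: "cdird v (\<lambda>_. c) x = 0"
  by (simp add: cdird_def)

lemma cdird_cong_open:
  "open U \<Longrightarrow> x \<in> U \<Longrightarrow> (\<And>y. y \<in> U \<Longrightarrow> f y = g y) \<Longrightarrow> cdird v f x = cdird v g x"
  unfolding cdird_def using dird_cong_open[of U x f g] by simp

lemma cdird_add:
  "f differentiable (at x) \<Longrightarrow> g differentiable (at x) \<Longrightarrow> cdird v (\<lambda>x. f x + g x) x = cdird v f x + cdird v g x"
  by (simp add: cdird_def dird_add algebra_simps)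

lemma cdird_mult:
  "f differentiable (at x) \<Longrightarrow> g differentiable (at x) \<Longrightarrow> cdird v (\<lambda>x. f x * g x) x = f x * cdird v g x + cdird v f x * g x"
  by (simp add: cdird_def dird_mult algebra_simps)

lemma cdird_cmult:
  "f differentiable (at x) \<Longrightarrow> cdird v (\<lambda>x. c * f x) x = c * cdird v f x"
  by (simp add: cdird_mult)

lemma cdird_diff:
  assumes "f differentiable (at x)" "g differentiable (at x)"
  shows "cdird v (\<lambda>x. f x - g x) x = cdird v f x - cdird v g x"
proof -
  have "(\<lambda>x. - 1 * g x) differentiable (at x)" using assms(2) by simp
  from cdird_add[OF assms(1) this, of v] show ?thesis
    unfolding cdird_cmult[OF assms(2)] by simp
qed

lemma cdird_sum:
  "(\<And>i. i \<in> I \<Longrightarrow> f i differentiable (at x)) \<Longrightarrow> cdird v (\<lambda>x. \<Sum>i\<in>I. f i x) x = (\<Sum>i\<in>I. cdird v (f i) x)"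
  by (simp add: cdird_def dird_sum sum.distrib sum_distrib_left)

lemma cdird_commute:
  assumes "open U" "Ck 2 U f" "x \<in> U"
  shows "cdird v (cdird w f) x = cdird w (cdird v f) x"
proof -
  have f2: "Ck (Suc (Suc 0)) U f" using assms(2) by (simp add: numeral_2_eq_2)
  have "cdird v (cdird w f) x = dird (Revec v) (dird (Revec w) f) x + \<i> * dird (Revec v) (dird (Imvec w) f) x
      + \<i> * (dird (Imvec v) (dird (Revec w) f) x + \<i> * dird (Imvec v) (dird (Imvec w) f) x)" for v w
    using f2 assms(3) unfolding cdird_def[abs_def] by (simp add: dird_add dird_mult differentiable_mult)
  from this[of v w] this[of w v] show ?thesis
    by (simp only: dird_commute[OF assms, of "Revec v"] dird_commute[OF assms, of "Imvec v"] algebra_simps)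
qed

lemma Ck_cdird: "open U \<Longrightarrow> Ck (Suc r) U f \<Longrightarrow> Ck r U (cdird v f)"
  unfolding cdird_def by (intro Ck_add Ck_mult) auto

lemma cdird_parametric_integral:
  fixes H :: "real ^ 'm::finite \<Rightarrow> 'c::euclidean_space \<Rightarrow> complex"
  assumes "open U" and par: "parCk (Suc 0) U (cbox a b) H" and "x \<in> U"
  shows "cdird v (\<lambda>x. integral (cbox a b) (H x)) x = integral (cbox a b) (\<lambda>t. cdird v (\<lambda>x. H x t) x)"
proof -
  have i: "(\<lambda>t. dird w (\<lambda>x. H x t) x) integrable_on cbox a b" for w
    using par by (intro integrable_continuous parCk_slice[of 0 U] assms(3)) simp
  show ?thesis
    unfolding cdird_def dird_parametric_integral[OF assms(1,2,3)] integral_mult_right[symmetric]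
    by (intro integral_add[symmetric] i integrable_on_mult_right)
qed

lemma cdird_chain:
  fixes \<gamma> :: "real ^ 'm::finite \<Rightarrow> complex ^ 'm"
  assumes "\<gamma> differentiable (at x)" "chol W F" "\<gamma> x \<in> W"
  shows "cdird v (\<lambda>x. F (\<gamma> x)) x = dird (\<chi> l. cdird v (\<lambda>x. \<gamma> x $ l) x) F (\<gamma> x)"
proof -
  have F: "F differentiable (at (\<gamma> x))" using assms unfolding chol_def by blast
  have n: "dird w (\<lambda>x. \<gamma> x $ l) x = dird w \<gamma> x $ l" for w l
    using dird_eqI[OF bounded_linear.has_derivative[OF bounded_linear_vec_nth has_derivative_dird[OF assms(1)]]] .
  have "(\<chi> l. cdird v (\<lambda>x. \<gamma> x $ l) x) = dird (Revec v) \<gamma> x + \<i> *s dird (Imvec v) \<gamma> x"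
    by (simp add: vec_eq_iff cdird_def n)
  then show ?thesis
    using chol_add_dir[OF assms(2,3)] chol_scale[OF assms(2,3)]
    by (simp add: cdird_def dird_chain[OF assms(1) F])
qed

lemma cdird_of_real_nth: "cdird v (\<lambda>x. of_real (x $ i)) x = v $ i" for v :: "complex ^ 'm::finite"
proof -
  have b: "bounded_linear (\<lambda>x::real^'m. complex_of_real (x $ i))"
    by (rule bounded_linear_compose[OF bounded_linear_of_real bounded_linear_vec_nth])
  show ?thesis by (simp add: cdird_def dird_linear[OF b] Revec_def Imvec_def complex_eq_iff)
qed

text \<open>For holomorphic \<open>F\<close> a complex direction is an honest direction in the
  complexified space. This moves differential identities between real points and their complex
  neighbourhood.\<close>

lemma cdird_restrict:
  assumes "chol W F" "cvec x \<in> W"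
  shows "cdird v (\<lambda>x. F (cvec x)) x = dird v F (cvec x)"
  using cdird_chain[OF bounded_linear_imp_differentiable[OF bounded_linear_cvec] assms]
  by (simp add: cdird_of_real_nth)

text \<open>With \<open>z = x + \<i> y\<close> the complex line \<open>t \<mapsto> x + t y\<close>
  meets the real points at real \<open>t\<close> and passes through \<open>z\<close> at
  \<open>t = \<i>\<close>. Its part in the ball is convex, hence connected, so the one-variable
  identity theorem applies.\<close>

lemma chol_zero_of_real_zero:
  fixes E :: "complex ^ 'm::finite \<Rightarrow> complex"
  assumes E: "chol (ball (cvec p) d) E" and zero: "\<And>x. x \<in> ball p d \<Longrightarrow> E (cvec x) = 0"
    and z: "z \<in> ball (cvec p) d"
  shows "E z = 0"
proof -
  define x y where "x = Revec z" and "y = Imvec z"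
  define l where "l = (\<lambda>t. cvec x + t *s cvec y)"
  define T where "T = l -` ball (cvec p) d"
  have lin: "linear (\<lambda>t. t *s cvec y)" by (rule linearI) (simp_all add: vec_eq_iff algebra_simps)
  have l': "(l has_derivative (\<lambda>t. t *s cvec y)) (at t)" for t
    unfolding l_def using linear_conv_bounded_linear lin
    by (auto intro!: derivative_eq_intros bounded_linear_imp_has_derivative)
  have oT: "open T" unfolding T_def
    by (intro continuous_open_vimage open_ball)
      (use l' in \<open>auto intro: has_derivative_continuous simp: continuous_at_imp_continuous_on\<close>)
  have cT: "convex T"
  proof (rule convexI)
    fix s t a b assume st: "s \<in> T" "t \<in> T" "0 \<le> a" "0 \<le> b" "a + b = (1::real)"
    have "l (a *\<^sub>R s + b *\<^sub>R t) = (a + b) *\<^sub>R cvec x + a *\<^sub>R (s *s cvec y) + b *\<^sub>R (t *s cvec y)"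
      unfolding l_def st(5) by (simp add: linear_add[OF lin] linear_scale[OF lin])
    also have "\<dots> = a *\<^sub>R l s + b *\<^sub>R l t" by (simp add: l_def algebra_simps)
    finally show "a *\<^sub>R s + b *\<^sub>R t \<in> T"
      using st convexD[OF convex_ball, of "l s" "cvec p" d "l t" a b] by (simp add: T_def del: mem_ball)
  qed
  have iT: "\<i> \<in> T" using z Revec_Imvec[of z] by (simp add: T_def l_def x_def y_def)
  have l_real: "l (of_real r) = cvec (x + r *\<^sub>R y)" for r by (simp add: l_def vec_eq_iff)
  have ReT: "of_real r \<in> T \<longleftrightarrow> x + r *\<^sub>R y \<in> ball p d" for r
    unfolding T_def using l_real by simp
  \<comment> \<open>Taking real parts does not increase the distance to a real centre, so
    \<open>x\<close> itself lies in the ball and 0 is an interior point of \<open>T\<close>.\<close>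
  have "norm (x - p) \<le> norm (z - cvec p)"
    unfolding x_def norm_vec_def
  proof (rule L2_set_mono)
    show "norm ((Revec z - p) $ i) \<le> norm ((z - cvec p) $ i)" for i
      using abs_Re_le_cmod[of "(z - cvec p) $ i"] by (simp add: Revec_def)
  qed simp
  then have xT: "0 \<in> T"
    using z ReT[of 0] by (simp add: dist_norm norm_minus_commute)
  have hol: "(\<lambda>t. E (l t)) holomorphic_on T"
  proof (subst holomorphic_on_open[OF oT], intro ballI)
    fix t assume "t \<in> T"
    then have lt: "l t \<in> ball (cvec p) d" by (simp add: T_def)
    then have Ed: "E differentiable (at (l t))" using E unfolding chol_def by blast
    have "((\<lambda>t. E (l t)) has_derivative (\<lambda>h. dird (h *s cvec y) E (l t))) (at t)"
      using diff_chain_at[OF l' has_derivative_dird[OF Ed]] by (simp add: o_def)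
    moreover have "dird (h *s cvec y) E (l t) = dird (cvec y) E (l t) * h" for h
      using chol_scale[OF E lt] by simp
    ultimately show "\<exists>f'. ((\<lambda>t. E (l t)) has_field_derivative f') (at t)"
      unfolding has_field_derivative_def by auto
  qed
  obtain e where e: "e > 0" "ball 0 e \<subseteq> T" using oT xT openE by blast
  define S where "S = complex_of_real ` {0<..<e}"
  have "(\<lambda>t. E (l t)) \<i> = 0"
  proof (rule analytic_continuation[OF hol oT convex_connected[OF cT], of S 0])
    show "S \<subseteq> T" using e by (auto simp: S_def dest!: subsetD)
    show "0 islimpt S"
      unfolding islimpt_approachable
    proof (intro allI impI)
      fix r :: real assume "0 < r"
      then show "\<exists>x'\<in>S. x' \<noteq> 0 \<and> dist x' 0 < r"
        using e by (intro bexI[of _ "of_real (min (r/2) (e/2))"]) (auto simp: S_def)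
    qed
    fix t assume "t \<in> S"
    then obtain r where r: "t = of_real r" "0 < r" "r < e" by (auto simp: S_def)
    then have "x + r *\<^sub>R y \<in> ball p d" using e ReT by (auto dest!: subsetD)
    then have "E (cvec (x + r *\<^sub>R y)) = 0" by (rule zero)
    then show "E (l t) = 0" by (simp only: r l_real)
  qed (use xT iT in auto)
  moreover have "l \<i> = z" using Revec_Imvec[of z] by (simp add: l_def x_def y_def)
  ultimately show ?thesis by simp
qed

section \<open>Regular functions in components\<close>

definition idx :: "nat \<Rightarrow> 'n::finite bit0 bit0" where "idx m = of_nat m"

lemma idx_eq_iff:
  assumes "m < 4 * CARD('n::finite)" "m' < 4 * CARD('n)"
  shows "(idx m :: 'n bit0 bit0) = idx m' \<longleftrightarrow> m = m'"
  using bij_betw_imp_inj_on[OF bij_betw_coordinate_index[where 'n='n]] assms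
  by (auto simp: idx_def inj_on_def)

lemma idx_surj: obtains m where "m < 4 * CARD('n::finite)" "(i :: 'n bit0 bit0) = idx m"
  using bij_betw_imp_surj_on[OF bij_betw_coordinate_index[where 'n='n]]
  by (metis (no_types, lifting) UNIV_I idx_def imageE lessThan_iff)

definition qidx :: "nat \<Rightarrow> nat \<Rightarrow> 'n::finite bit0 bit0" where "qidx t r = idx (4 * t + r)"

lemma qidx_eq_iff:
  assumes "t < CARD('n::finite)" "s < CARD('n)" "r < 4" "r' < 4"
  shows "(qidx t r :: 'n bit0 bit0) = qidx s r' \<longleftrightarrow> t = s \<and> r = r'"
proof -
  have "4 * t + r = 4 * s + r' \<longleftrightarrow> t = s \<and> r = r'" using assms(3,4) by presburger
  then show ?thesis unfolding qidx_def using assms by (subst idx_eq_iff) auto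
qed

lemma pdiff_eq_dird: "pdiff m f = dird (axis (idx m) 1) f"
  by (simp add: fun_eq_iff pdiff_def dird_def idx_def)

lemma pdiff_quad:
  "pdiff (4 * t) f = dird (axis (qidx t 0) 1) f" "pdiff (4 * t + r) f = dird (axis (qidx t r) 1) f"
  by (simp_all add: pdiff_eq_dird qidx_def)

lemma coord_quad: "coord (4 * t) x = x $ qidx t 0" "coord (4 * t + r) x = x $ qidx t r"
  by (simp_all add: coord_def idx_def qidx_def)

lemma C_diff_iff_Ck:
  fixes U :: "'n::finite hspace set"
  assumes "open U"
  shows "C_diff r U f \<longleftrightarrow> Ck r U f"
proof (induction r arbitrary: f)
  case (Suc r)
  show ?case
  proof
    assume f: "C_diff (Suc r) U f"
    show "Ck (Suc r) U f"
    proof (rule Ck_basisI[OF assms])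
      fix e :: "'n hspace" assume "e \<in> Basis"
      then obtain i where "e = axis i 1" by (auto simp: Basis_vec_def)
      moreover obtain m where "m < 4 * CARD('n)" "i = idx m" using idx_surj .
      ultimately show "Ck r U (dird e f)" using f Suc.IH by (auto simp: pdiff_eq_dird)
    qed (use f in auto)
  qed (auto simp: pdiff_eq_dird Suc.IH)
qed simp

text \<open>The operator \<open>\<nabla>\<^sub>A\<^sup>a\<close> is differentiation along the complex vector \<open>nvec A a\<close>.\<close>

definition nvec :: "nat \<Rightarrow> pindex \<Rightarrow> complex ^ ('n::finite bit0 bit0)" where
  "nvec A a = (let t = A div 2 in
     if even A then
       (case a of
          P0 \<Rightarrow> axis (qidx t 2) (- 1) + axis (qidx t 3) (- \<i>)
        | P1 \<Rightarrow> axis (qidx t 0) (- 1) + axis (qidx t 1) (- \<i>))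
     else
       (case a of
          P0 \<Rightarrow> axis (qidx t 0) 1 + axis (qidx t 1) (- \<i>)
        | P1 \<Rightarrow> axis (qidx t 2) (- 1) + axis (qidx t 3) \<i>))"

lemma cdird_axis:
  assumes "f differentiable (at x)"
  shows "cdird (axis i c) f x = c * dird (axis i 1) f x"
proof -
  have "Revec (axis i c) = Re c *\<^sub>R axis i 1" "Imvec (axis i c) = Im c *\<^sub>R axis i 1"
    by (auto simp: vec_eq_iff axis_def Revec_def Imvec_def)
  then show ?thesis
    by (simp add: cdird_def linear_scale[OF linear_dird[OF assms]] complex_eq_iff)
qed

lemma nabla_eq_cdird:
  assumes "f differentiable (at x)"
  shows "nabla A a f x = cdird (nvec A a) f x"
  unfolding nabla_def nvec_def Let_def pdiff_quad
  by (auto simp: cdird_add_dir cdird_axis assms split: pindex.split)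

text \<open>Extends \<open>zvar\<close> complex-linearly off the real points. Applied to
  \<open>nvec\<close>, it also gives the constant derivatives of the coordinates \<open>zvar\<close>
  (\<open>cdird_zvar\<close>).\<close>

definition zlin :: "nat \<Rightarrow> pindex \<Rightarrow> complex ^ ('n::finite bit0 bit0) \<Rightarrow> complex" where
  "zlin A a z = (let t = A div 2 in
     if even A then
       (case a of
          P0 \<Rightarrow> z $ qidx t 2 + \<i> * z $ qidx t 3
        | P1 \<Rightarrow> z $ qidx t 0 + \<i> * z $ qidx t 1)
     else
       (case a of
          P0 \<Rightarrow> - z $ qidx t 0 + \<i> * z $ qidx t 1
        | P1 \<Rightarrow> z $ qidx t 2 - \<i> * z $ qidx t 3))"

lemma zvar_eq: "zvar A a x = zlin A a (cvec x)"
  unfolding zvar_def zlin_def Let_def coord_quad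
  by (auto split: pindex.split)

lemma zlin_add: "zlin A a (v + w) = zlin A a v + zlin A a w"
  and zlin_scale: "zlin A a (c *s v) = c * zlin A a v"
  by (auto simp: zlin_def Let_def algebra_simps split: pindex.split)

lemma zlin_scaleR: "zlin A a (r *\<^sub>R v) = r *\<^sub>R zlin A a v"
proof -
  have "r *\<^sub>R v = complex_of_real r *s v" by (simp add: vec_eq_iff complex_eq_iff)
  then show ?thesis by (simp only: zlin_scale scaleR_conv_of_real)
qed

lemma bounded_linear_zlin: "bounded_linear (zlin A a)"
proof -
  have "linear (zlin A a)" by (rule linearI) (simp_all add: zlin_add zlin_scaleR)
  then show ?thesis by (simp add: linear_conv_bounded_linear)
qed

lemma chol_zlin: "chol W (zlin A a)"
  unfolding chol_def dird_linear[OF bounded_linear_zlin]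
  using bounded_linear_imp_differentiable[OF bounded_linear_zlin] by (auto simp: zlin_scale)

lemma bounded_linear_zvar: "bounded_linear (zvar A a)"
  using bounded_linear_compose[OF bounded_linear_zlin bounded_linear_cvec] by (simp add: zvar_eq[abs_def])

lemma Ck_zvar: "Ck r U (zvar A a)"
  by (rule Ck_linear[OF bounded_linear_zvar])

lemma zvar_differentiable: "zvar A a differentiable (at x)"
  by (rule bounded_linear_imp_differentiable[OF bounded_linear_zvar])

lemma cdird_zvar: "cdird v (zvar A a) x = zlin A a v"
  using cdird_restrict[OF chol_zlin, of x UNIV v A a]
  by (simp add: zvar_eq[abs_def] dird_linear[OF bounded_linear_zlin])

text \<open>The indices \<open>2 t\<close> and \<open>2 t + 1\<close> belong to the same quaternion;
  the derivative of \<open>z_B\<close> along the nablas of index \<open>A\<close> can be nonzero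
  only when \<open>B\<close> is the partner of \<open>A\<close>.\<close>

definition partner :: "nat \<Rightarrow> nat" where "partner A = (if even A then Suc A else A - 1)"

lemma partner_less: "A < 2 * n \<Longrightarrow> partner A < 2 * n"
  by (auto simp: partner_def elim!: evenE)

lemma partner_eq_iff: "partner A = partner B \<longleftrightarrow> A = B"
  unfolding partner_def by (auto elim!: oddE evenE split: if_splits) presburger+

text \<open>The values are the derivatives of \<open>z_B\<close> along the nablas. Their
  antisymmetry under exchange of the primed indices is the reason why multiplication by
  \<open>z_B\<close> respects regularity.\<close>

lemma
  assumes "A < 2 * CARD('n::finite)" "B < 2 * CARD('n)"
  shows zlin_nvec_same: "zlin B a (nvec A a :: complex ^ ('n bit0 bit0)) = 0"
    and zlin_nvec_10: "zlin B P0 (nvec A P1 :: complex ^ ('n bit0 bit0)) =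
      (if B = partner A then (if even A then 2 else - 2) else 0)"
    and zlin_nvec_01: "zlin B P1 (nvec A P0 :: complex ^ ('n bit0 bit0)) =
      (if B = partner A then (if even A then - 2 else 2) else 0)"
proof -
  define t s where "t = A div 2" and "s = B div 2"
  then have A: "A = 2 * t \<or> A = Suc (2 * t)" and B: "B = 2 * s \<or> B = Suc (2 * s)" by presburger+
  have ts: "t < CARD('n)" "s < CARD('n)" using assms A B by auto
  note i = qidx_eq_iff[OF ts(1) ts(2)] qidx_eq_iff[OF ts(2) ts(1)]
  have p: "2 * s = 2 * t \<longleftrightarrow> s = t" "Suc (2 * s) = Suc (2 * t) \<longleftrightarrow> s = t" "2 * s \<noteq> Suc (2 * t)" "Suc (2 * s) \<noteq> 2 * t"
    by presburger+
  show "zlin B a (nvec A a :: complex ^ ('n bit0 bit0)) = 0"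
    using A B by (cases a; elim disjE; simp add: zlin_def nvec_def Let_def axis_def i)
  show "zlin B P0 (nvec A P1 :: complex ^ ('n bit0 bit0)) =
      (if B = partner A then (if even A then 2 else - 2) else 0)"
    using A B by (elim disjE; simp add: zlin_def nvec_def Let_def axis_def i partner_def p)
  show "zlin B P1 (nvec A P0 :: complex ^ ('n bit0 bit0)) =
      (if B = partner A then (if even A then - 2 else 2) else 0)"
    using A B by (elim disjE; simp add: zlin_def nvec_def Let_def axis_def i partner_def p)
qed

text \<open>A symmetric tensor is determined by the values \<open>\<phi> j\<close> of its components with exactly \<open>j\<close> indices \<open>1'\<close>.\<close>

definition tens :: "nat \<Rightarrow> (nat \<Rightarrow> complex) \<Rightarrow> tensor" where
  "tens k \<phi> l = (if length l = k then \<phi> (count_list l P1) else 0)"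

text \<open>With only two index values the multiset of a list is fixed by its length and its number
  of \<open>P1\<close>; the sorted list serves as representative.\<close>

lemma sym_power_iff: "c \<in> sym_power k \<longleftrightarrow> (\<exists>\<phi>. c = tens k \<phi>)"
proof
  assume c: "c \<in> sym_power k"
  have "c = tens k (\<lambda>j. c (replicate j P1 @ replicate (k - j) P0))"
  proof (rule ext)
    fix l show "c l = tens k (\<lambda>j. c (replicate j P1 @ replicate (k - j) P0)) l"
    proof (cases "length l = k")
      case True
      define j where "j = count_list l P1"
      have s: "count_list l P1 + count_list l P0 = length l"
        by (induction l) (auto, metis pindex.exhaust)
      have "count (mset l) x = count (mset (replicate j P1 @ replicate (k - j) P0)) x" for x
        using s True by (cases x) (auto simp: j_def count_mset)
      then have "mset l = mset (replicate j P1 @ replicate (k - j) P0)" by (rule multiset_eqI)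
      then show ?thesis using c True by (simp add: tens_def sym_power_def j_def)
    qed (use c in \<open>simp add: tens_def sym_power_def\<close>)
  qed
  then show "\<exists>\<phi>. c = tens k \<phi>" by blast
next
  assume "\<exists>\<phi>. c = tens k \<phi>"
  then obtain \<phi> where c: "c = tens k \<phi>" ..
  have "c l = c l'" if "mset l = mset l'" for l l'
    using arg_cong[OF that, of "\<lambda>M. count M P1"] mset_eq_length[OF that] by (simp add: c tens_def count_mset)
  moreover have "c l = 0" if "length l \<noteq> k" for l using that by (simp add: c tens_def)
  ultimately show "c \<in> sym_power k" unfolding sym_power_def by blast
qed

lemma nabla_zero [simp]: "nabla A a (\<lambda>_. 0) x = 0"
  by (subst nabla_eq_cdird) auto

lemma dop_scalar_form:
  fixes f :: "'n::finite hspace \<Rightarrow> complex"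
  shows "dop a (scalar_form f) x J = (\<Sum>A<2 * CARD('n). if J = {A} then nabla A a f x else 0)"
proof -
  have "(\<Sum>I\<in>Pow {..<2 * CARD('n)}. nabla A a (\<lambda>y. scalar_form f y I) x * omega_wedge A I J)
      = (if J = {A} then nabla A a f x else 0)" for A
  proof -
    have "(\<Sum>I\<in>Pow {..<2 * CARD('n)}. nabla A a (\<lambda>y. scalar_form f y I) x * omega_wedge A I J)
      = (\<Sum>I\<in>{{}}. nabla A a (\<lambda>y. scalar_form f y I) x * omega_wedge A I J)"
      by (rule sum.mono_neutral_right) (auto simp: scalar_form_def)
    then show ?thesis by (simp add: scalar_form_def omega_wedge_def)
  qed
  then show ?thesis by (simp add: dop_def)
qed

lemma dop_scalar_form_singleton:
  fixes f :: "'n::finite hspace \<Rightarrow> complex"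
  shows "A < 2 * CARD('n) \<Longrightarrow> dop a (scalar_form f) x {A} = nabla A a f x"
  by (simp add: dop_scalar_form)

lemma dop_scalar_form_pair_eq_0_iff:
  fixes f g :: "'n::finite hspace \<Rightarrow> complex"
  shows "dop P0 (scalar_form f) x + dop P1 (scalar_form g) x = 0 \<longleftrightarrow>
    (\<forall>A<2 * CARD('n). nabla A P0 f x + nabla A P1 g x = 0)" (is "?L \<longleftrightarrow> ?R")
proof
  assume ?L
  then have "dop P0 (scalar_form f) x J + dop P1 (scalar_form g) x J = 0" for J by (metis plus_fun_apply zero_fun_apply)
  then show ?R using dop_scalar_form_singleton by metis
next
  assume ?R
  then show ?L by (auto simp: fun_eq_iff dop_scalar_form sum.distrib[symmetric] intro!: sum.neutral)
qed

lemma dop_dop_scalar_form: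
  fixes f :: "'n::finite hspace \<Rightarrow> complex"
  shows "dop a (dop b (scalar_form f)) x J = (\<Sum>A<2 * CARD('n). \<Sum>B<2 * CARD('n).
    if A \<noteq> B \<and> J = {A, B} then (if B < A then - 1 else 1) * nabla A a (nabla B b f) x else 0)"
proof -
  have "(\<Sum>I\<in>Pow {..<2 * CARD('n)}. nabla A a (\<lambda>y. dop b (scalar_form f) y I) x * omega_wedge A I J)
     = (\<Sum>B<2 * CARD('n). if A \<noteq> B \<and> J = {A, B} then (if B < A then - 1 else 1) * nabla A a (nabla B b f) x else 0)" for A
  proof -
    have "(\<Sum>I\<in>Pow {..<2 * CARD('n)}. nabla A a (\<lambda>y. dop b (scalar_form f) y I) x * omega_wedge A I J)
       = (\<Sum>I\<in>(\<lambda>B. {B}) ` {..<2 * CARD('n)}. nabla A a (\<lambda>y. dop b (scalar_form f) y I) x * omega_wedge A I J)"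
    proof (rule sum.mono_neutral_right)
      show "\<forall>I\<in>Pow {..<2 * CARD('n)} - (\<lambda>B. {B}) ` {..<2 * CARD('n)}.
        nabla A a (\<lambda>y. dop b (scalar_form f) y I) x * omega_wedge A I J = 0"
      proof
        fix I assume I: "I \<in> Pow {..<2 * CARD('n)} - (\<lambda>B. {B}) ` {..<2 * CARD('n)}"
        have "(\<lambda>y. dop b (scalar_form f) y I) = (\<lambda>y. 0)"
          using I by (intro ext, subst dop_scalar_form, intro sum.neutral) auto
        then show "nabla A a (\<lambda>y. dop b (scalar_form f) y I) x * omega_wedge A I J = 0" by simp
      qed
    qed auto
    also have "\<dots> = (\<Sum>B<2 * CARD('n). nabla A a (\<lambda>y. dop b (scalar_form f) y {B}) x * omega_wedge A {B} J)"
      by (subst sum.reindex) (auto simp: inj_on_def)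
    also have "\<dots> = (\<Sum>B<2 * CARD('n). if A \<noteq> B \<and> J = {A, B} then (if B < A then - 1 else 1) * nabla A a (nabla B b f) x else 0)"
    proof (rule sum.cong[OF refl])
      fix B assume B: "B \<in> {..<2 * CARD('n)}"
      have "(\<lambda>y. dop b (scalar_form f) y {B}) = nabla B b f"
        using B by (intro ext dop_scalar_form_singleton) simp
      moreover have "{C \<in> {B}. C < A} = (if B < A then {B} else {})" by auto
      ultimately show "nabla A a (\<lambda>y. dop b (scalar_form f) y {B}) x * omega_wedge A {B} J =
        (if A \<noteq> B \<and> J = {A, B} then (if B < A then - 1 else 1) * nabla A a (nabla B b f) x else 0)"
        by (simp add: omega_wedge_def)
    qed
    finally show ?thesis .
  qed
  then show ?thesis by (simp add: dop_def)
qed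

text \<open>For \<open>A < B\<close> the coefficient at \<open>{A, B}\<close> is the difference of
  the two sides. Conversely, if these agree, exchanging the summation indices turns each coefficient
  into its negative.\<close>

lemma dop_dop_scalar_form_eq_0_iff:
  fixes f :: "'n::finite hspace \<Rightarrow> complex"
  shows "dop a (dop b (scalar_form f)) x = 0 \<longleftrightarrow>
    (\<forall>A<2 * CARD('n). \<forall>B<2 * CARD('n). nabla A a (nabla B b f) x = nabla B a (nabla A b f) x)"
    (is "?L \<longleftrightarrow> ?R")
proof
  assume L: ?L
  have *: "nabla A a (nabla B b f) x = nabla B a (nabla A b f) x"
    if AB: "A < B" "A < 2 * CARD('n)" "B < 2 * CARD('n)" for A B
  proof -
    let ?g = "\<lambda>(C,D). if C \<noteq> D \<and> {A,B} = {C,D} then (if D < C then - 1 else 1) * nabla C a (nabla D b f) x else 0"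
    have "0 = (\<Sum>p\<in>{..<2 * CARD('n)} \<times> {..<2 * CARD('n)}. ?g p)"
      using L by (simp add: fun_eq_iff dop_dop_scalar_form sum.cartesian_product)
    also have "\<dots> = (\<Sum>p\<in>{(A,B),(B,A)}. ?g p)"
      by (rule sum.mono_neutral_right) (use AB in \<open>auto simp: doubleton_eq_iff split: if_splits\<close>)
    also have "\<dots> = nabla A a (nabla B b f) x - nabla B a (nabla A b f) x"
      using AB by auto
    finally show ?thesis by simp
  qed
  show ?R
  proof (intro allI impI)
    fix A B assume "A < 2 * CARD('n)" "B < 2 * CARD('n)"
    then show "nabla A a (nabla B b f) x = nabla B a (nabla A b f) x"
      using *[of A B] *[of B A] by (cases A B rule: linorder_cases) auto
  qed
next
  assume R: ?R
  show ?L
  proof (rule ext)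
    fix J
    let ?g = "\<lambda>A B. if A \<noteq> B \<and> J = {A, B} then (if B < A then - 1 else 1) * nabla A a (nabla B b f) x else 0"
    let ?N = "{..<2 * CARD('n)}"
    have "(\<Sum>A\<in>?N. \<Sum>B\<in>?N. ?g A B) = (\<Sum>A\<in>?N. \<Sum>B\<in>?N. - ?g B A)"
      by (intro sum.cong refl) (use R in \<open>auto simp: insert_commute\<close>)
    also have "\<dots> = - (\<Sum>B\<in>?N. \<Sum>A\<in>?N. ?g B A)" by (subst sum.swap) (simp only: sum_negf)
    finally show "dop a (dop b (scalar_form f)) x J = 0 J" by (simp add: dop_dop_scalar_form)
  qed
qed

text \<open>For \<open>k = 0\<close> the condition lists the coefficients of the two-form.
  Components beyond \<open>k\<close> are left free, so families of every degree share one
  type.\<close>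

definition regs :: "nat \<Rightarrow> 'n::finite hspace set \<Rightarrow> (nat \<Rightarrow> 'n hspace \<Rightarrow> complex) \<Rightarrow> bool" where
  "regs k U \<phi> \<longleftrightarrow> (if k = 0
     then Ck 2 U (\<phi> 0) \<and> (\<forall>A<2 * CARD('n). \<forall>B<2 * CARD('n). \<forall>x\<in>U.
       cdird (nvec A P0) (cdird (nvec B P1) (\<phi> 0)) x = cdird (nvec B P0) (cdird (nvec A P1) (\<phi> 0)) x)
     else (\<forall>j\<le>k. Ck 1 U (\<phi> j)) \<and> (\<forall>A<2 * CARD('n). \<forall>j<k. \<forall>x\<in>U.
       cdird (nvec A P0) (\<phi> j) x + cdird (nvec A P1) (\<phi> (Suc j)) x = 0))"

lemma nabla_nabla_eq:
  fixes U :: "'n::finite hspace set"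
  assumes "open U" "x \<in> U" "Ck 2 U f"
  shows "nabla A a (nabla B b f) x = cdird (nvec A a) (cdird (nvec B b) f) x"
proof -
  have f2: "Ck (Suc (Suc 0)) U f" using assms(3) by (simp add: numeral_2_eq_2)
  have eq: "nabla B b f y = cdird (nvec B b) f y" if "y \<in> U" for y
    using f2 that by (intro nabla_eq_cdird) auto
  have d: "cdird (nvec B b) f differentiable (at x)"
    using Ck_cdird[OF assms(1) f2] assms(2) by auto
  then have "nabla B b f differentiable (at x)"
    using eq by (intro differentiable_cong_open[OF assms(1,2) _ d]) auto
  then show ?thesis using eq cdird_cong_open[OF assms(1,2), of "nabla B b f"] by (simp add: nabla_eq_cdird)
qed

text \<open>If \<open>l\<close> contains \<open>j\<close> indices \<open>P1\<close>, then
  \<open>P0 # l\<close> addresses component \<open>j\<close> and \<open>P1 # l\<close> component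
  \<open>Suc j\<close>; the equations for all lists therefore collapse to one equation for each
  \<open>j\<close>.\<close>

lemma k_regular_on_tens:
  fixes U :: "'n::finite hspace set"
  assumes U: "open U" and f: "\<And>x. x \<in> U \<Longrightarrow> f x = tens k (\<lambda>j. \<phi> j x)"
  shows "k_regular_on k U f \<longleftrightarrow> regs k U \<phi>"
proof (cases "k = 0")
  case True
  have e: "f x [] = \<phi> 0 x" if "x \<in> U" for x using f[OF that] True by (simp add: tens_def)
  have c: "C_diff 2 U (\<lambda>x. f x []) \<longleftrightarrow> Ck 2 U (\<phi> 0)"
    unfolding C_diff_iff_Ck[OF U] by (rule Ck_cong[OF U e])
  have s: "f x \<in> sym_power k" if "x \<in> U" for x using f[OF that] sym_power_iff by blast
  have "dop P0 (dop P1 (scalar_form (\<lambda>y. f y []))) x = 0 \<longleftrightarrow>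
     (\<forall>A<2 * CARD('n). \<forall>B<2 * CARD('n).
       cdird (nvec A P0) (cdird (nvec B P1) (\<phi> 0)) x = cdird (nvec B P0) (cdird (nvec A P1) (\<phi> 0)) x)"
    if x: "x \<in> U" and k2: "Ck 2 U (\<phi> 0)" for x
  proof -
    have k2': "Ck 2 U (\<lambda>x. f x [])" using k2 Ck_cong[OF U, of "\<lambda>x. f x []" "\<phi> 0" 2] e by blast
    have "cdird (nvec A P0) (cdird (nvec B P1) (\<lambda>x. f x [])) x = cdird (nvec A P0) (cdird (nvec B P1) (\<phi> 0)) x" for A B
      by (intro cdird_cong_open[OF U x] cdird_cong_open[OF U] e)
    then show ?thesis unfolding dop_dop_scalar_form_eq_0_iff nabla_nabla_eq[OF U x k2'] by simp
  qed
  then show ?thesis using True s c unfolding k_regular_on_def regs_def by auto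
next
  case False
  have s: "f x \<in> sym_power k" if "x \<in> U" for x using f[OF that] sym_power_iff by blast
  have cl: "Ck 1 U (\<lambda>x. f x l) \<longleftrightarrow> Ck 1 U (\<phi> (count_list l P1))" if "length l = k" for l
    by (rule Ck_cong[OF U]) (use f that in \<open>simp add: tens_def\<close>)
  have c: "(\<forall>l. length l = k \<longrightarrow> C_diff 1 U (\<lambda>x. f x l)) \<longleftrightarrow> (\<forall>j\<le>k. Ck 1 U (\<phi> j))" (is "?L \<longleftrightarrow> ?R")
  proof
    assume L: ?L
    show ?R
    proof (intro allI impI)
      fix j assume "j \<le> k"
      then have "length (replicate j P1 @ replicate (k - j) P0) = k" by simp
      moreover have "count_list (replicate m P1) P1 = m" "count_list (replicate m P0) P1 = 0" for m
        by (induction m) auto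
      ultimately show "Ck 1 U (\<phi> j)" using L cl C_diff_iff_Ck[OF U] by (metis add.right_neutral count_list_append)
    qed
  next
    assume ?R then show ?L using cl C_diff_iff_Ck[OF U] count_le_length by metis
  qed
  have e: "(dop P0 (scalar_form (\<lambda>y. f y (P0 # l))) x + dop P1 (scalar_form (\<lambda>y. f y (P1 # l))) x = 0)
     \<longleftrightarrow> (\<forall>A<2 * CARD('n). cdird (nvec A P0) (\<phi> (count_list l P1)) x + cdird (nvec A P1) (\<phi> (Suc (count_list l P1))) x = 0)"
    if x: "x \<in> U" and l: "length l = k - 1" and d: "\<forall>j\<le>k. Ck 1 U (\<phi> j)" for x l
  proof -
    \<comment> \<open>Strict, because \<open>l\<close> has only \<open>k - 1\<close> entries:
      component \<open>Suc (count_list l P1)\<close> still has index at most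
      \<open>k\<close>.\<close>
    have le: "count_list l P1 < k" using l False count_le_length[of l P1] by linarith
    have n: "nabla A a (\<lambda>y. f y l') x = cdird (nvec A a) (\<phi> (count_list l' P1)) x"
      if "length l' = k" for A a l'
    proof -
      have eq: "f y l' = \<phi> (count_list l' P1) y" if "y \<in> U" for y using f[OF that] \<open>length l' = k\<close> by (simp add: tens_def)
      have "\<phi> (count_list l' P1) differentiable (at x)"
        using d x that count_le_length[of l' P1] by (auto intro: Ck_differentiable)
      then have "(\<lambda>y. f y l') differentiable (at x)"
        by (rule differentiable_cong_open[OF U x, rotated]) (use eq in auto)
      then show ?thesis using cdird_cong_open[OF U x eq] by (simp add: nabla_eq_cdird)
    qed
    show ?thesis unfolding dop_scalar_form_pair_eq_0_iff using l False by (simp add: n)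
  qed
  show ?thesis
  proof
    assume L: "k_regular_on k U f"
    then have d: "\<forall>j\<le>k. Ck 1 U (\<phi> j)" using c False unfolding k_regular_on_def by auto
    moreover have "cdird (nvec A P0) (\<phi> j) x + cdird (nvec A P1) (\<phi> (Suc j)) x = 0"
      if "A < 2 * CARD('n)" "j < k" "x \<in> U" for A j x
    proof -
      define l where "l = replicate j P1 @ replicate (k - 1 - j) P0"
      have "count_list (replicate m P1) P1 = m" "count_list (replicate m P0) P1 = 0" for m
        by (induction m) auto
      then have l: "length l = k - 1" "count_list l P1 = j" using that by (simp_all add: l_def)
      show ?thesis using e[OF that(3) l(1) d] L l that False unfolding k_regular_on_def by auto
    qed
    ultimately show "regs k U \<phi>" using False unfolding regs_def by auto
  next
    assume R: "regs k U \<phi>"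
    then have d: "\<forall>j\<le>k. Ck 1 U (\<phi> j)" using False unfolding regs_def by auto
    have "count_list l P1 < k" if "length l = k - 1" for l using that False count_le_length[of l P1] by linarith
    then show "k_regular_on k U f" using e[OF _ _ d] c d s R False unfolding k_regular_on_def regs_def by auto
  qed
qed

lemma k_regular_on_iff:
  fixes U :: "'n::finite hspace set"
  assumes "open U"
  shows "k_regular_on k U f \<longleftrightarrow> (\<exists>\<phi>. (\<forall>x\<in>U. f x = tens k (\<lambda>j. \<phi> j x)) \<and> regs k U \<phi>)"
proof
  assume f: "k_regular_on k U f"
  then have "\<forall>x\<in>U. \<exists>\<phi>. f x = tens k \<phi>" unfolding k_regular_on_def sym_power_iff by blast
  then obtain \<phi> where "\<forall>x\<in>U. f x = tens k (\<phi> x)" by metis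
  define \<psi> where "\<psi> = (\<lambda>j x. \<phi> x j)"
  have "f x = tens k (\<lambda>j. \<psi> j x)" if "x \<in> U" for x using \<open>\<forall>x\<in>U. f x = tens k (\<phi> x)\<close> that by (simp add: \<psi>_def)
  then show "\<exists>\<phi>. (\<forall>x\<in>U. f x = tens k (\<lambda>j. \<phi> j x)) \<and> regs k U \<phi>"
    using k_regular_on_tens[OF assms, of f k \<psi>] f by blast
qed (use k_regular_on_tens[OF assms] in blast)

section \<open>Elliptic regularity\<close>

lemma Ck_lineI:
  fixes g :: "real \<Rightarrow> real"
  assumes g: "\<And>t. (g has_real_derivative g1 t) (at t)" and g1: "Ck r UNIV g1"
  shows "Ck (Suc r) UNIV g"
proof (rule Ck_basisI)
  fix e :: real assume "e \<in> Basis"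
  then have "dird e g = g1" using dird_eqI[OF g[unfolded has_field_derivative_def], of 1] by (simp add: fun_eq_iff)
  then show "Ck r UNIV (dird e g)" using g1 by simp
qed (use g in \<open>auto simp: has_field_derivative_def differentiable_def\<close>)

lemma has_real_derivative_piecewise:
  fixes p q :: "real \<Rightarrow> real"
  assumes p: "\<And>t. t \<le> e \<Longrightarrow> (p has_real_derivative p' t) (at t)"
    and q: "\<And>t. t \<ge> e \<Longrightarrow> (q has_real_derivative q' t) (at t)"
    and pq: "p e = q e" "p' e = q' e"
  shows "((\<lambda>t. if t < e then p t else q t) has_real_derivative (if t < e then p' t else q' t)) (at t)"
proof -
  have "((\<lambda>t. if t \<in> {..<e} then p t else q t) has_vector_derivative (if t \<in> {..<e} then p' t else q' t)) (at t within UNIV)"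
  proof (rule has_vector_derivative_If_within_closures)
    assume "t \<in> {..<e} \<union> closure {..<e} \<inter> closure {e..}"
    then have "t \<le> e" by auto
    from p[OF this] show "(p has_vector_derivative p' t) (at t within {..<e} \<union> closure {..<e} \<inter> closure {e..})"
      unfolding has_real_derivative_iff_has_vector_derivative[symmetric]
      by (rule has_field_derivative_at_within)
  next
    assume "t \<in> {e..} \<union> closure {..<e} \<inter> closure {e..}"
    then have "t \<ge> e" by auto
    from q[OF this] show "(q has_vector_derivative q' t) (at t within {e..} \<union> closure {..<e} \<inter> closure {e..})"
      unfolding has_real_derivative_iff_has_vector_derivative[symmetric]
      by (rule has_field_derivative_at_within)
  next
    assume "t \<in> closure {..<e}" "t \<in> closure {e..}"
    then have "t = e" by auto
    then show "p t = q t" "p' t = q' t" using pq by auto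
  qed auto
  then show ?thesis by (simp add: has_real_derivative_iff_has_vector_derivative)
qed

text \<open>The Laplacian sees two derivatives of a test function only, so the cube of the positive
  part, which is twice continuously differentiable, replaces the usual exponential.\<close>

definition pos_cube :: "real \<Rightarrow> real" where "pos_cube t = (if t < 0 then 0 else t ^ 3)"

lemma Ck_pos_cube: "Ck 2 UNIV pos_cube"
proof -
  have 1: "(pos_cube has_real_derivative (if t < 0 then 0 else 3 * t ^ 2)) (at t)" for t
    unfolding pos_cube_def[abs_def] by (rule has_real_derivative_piecewise) (auto intro!: derivative_eq_intros)
  have 2: "((\<lambda>t::real. if t < 0 then 0 else 3 * t ^ 2) has_real_derivative (if t < 0 then 0 else 6 * t)) (at t)" for t
    by (rule has_real_derivative_piecewise) (auto intro!: derivative_eq_intros)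
  have "(\<lambda>t::real. if t < 0 then 0 else 6 * t) = (\<lambda>t. 6 * max 0 t)" by (auto simp: fun_eq_iff)
  then have "Ck 0 UNIV (\<lambda>t::real. if t < 0 then 0 else 6 * t)" by (simp add: continuous_intros)
  from Ck_lineI[OF 1 Ck_lineI[OF 2 this]] show ?thesis by (simp add: numeral_2_eq_2)
qed

definition cutoff :: "real \<Rightarrow> real" where "cutoff t = pos_cube (1 - pos_cube (t - 1))"

lemma cutoff_eq_1: "t \<le> 1 \<Longrightarrow> cutoff t = 1"
  and cutoff_eq_0: "t \<ge> 2 \<Longrightarrow> cutoff t = 0"
proof -
  show "t \<le> 1 \<Longrightarrow> cutoff t = 1" by (auto simp: cutoff_def pos_cube_def)
  assume t: "t \<ge> 2"
  then have "(t - 1) ^ 3 \<ge> 1 ^ 3" by (intro power_mono) auto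
  then have "1 - pos_cube (t - 1) \<le> 0" using t by (simp add: pos_cube_def)
  moreover have "pos_cube x = 0" if "x \<le> 0" for x using that by (auto simp: pos_cube_def)
  ultimately show "cutoff t = 0" unfolding cutoff_def by blast
qed

lemma Ck_cutoff: "Ck 2 UNIV cutoff"
proof -
  have "Ck 2 UNIV (\<lambda>t. pos_cube (t - 1))"
    by (rule Ck_compose[OF _ _ Ck_diff[OF _ Ck_linear[OF bounded_linear_ident] Ck_const] Ck_pos_cube]) auto
  from Ck_compose[OF _ _ Ck_diff[OF open_UNIV Ck_const this, of 1] Ck_pos_cube]
  show ?thesis by (simp only: cutoff_def[abs_def] open_UNIV subset_UNIV)
qed

text \<open>Below \<open>e\<close> the power \<open>t\<^sup>-\<^sup>M\<close> is continued by its second Taylor polynomial at \<open>e\<close>.  In the squared distance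
  this is a \<open>C\<^sup>2\<close> regularization of the Newton kernel of dimension \<open>2 M + 2\<close> whose Laplacian has a sign and
  vanishes outside a ball.\<close>

definition radial_kernel :: "nat \<Rightarrow> real \<Rightarrow> real \<Rightarrow> real" where
  "radial_kernel M e t = (if t < e then inverse e ^ M * (1 - real M * (t / e - 1) + real M * (real M + 1) / 2 * (t / e - 1)\<^sup>2)
     else inverse t ^ M)"

definition radial_kernel1 :: "nat \<Rightarrow> real \<Rightarrow> real \<Rightarrow> real" where
  "radial_kernel1 M e t = (if t < e then inverse e ^ (M + 1) * (real M * (real M + 1) * (t / e - 1) - real M)
     else - real M * inverse t ^ (M + 1))"

definition radial_kernel2 :: "nat \<Rightarrow> real \<Rightarrow> real \<Rightarrow> real" where
  "radial_kernel2 M e t = (if t < e then inverse e ^ (M + 2) * (real M * (real M + 1)) else real M * (real M + 1) * inverse t ^ (M + 2))"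

lemma inverse_power_derivative:
  "t \<noteq> 0 \<Longrightarrow> ((\<lambda>t. inverse t ^ M) has_real_derivative - real M * inverse t ^ (M + 1)) (at t)"
  using DERIV_power[OF DERIV_inverse, of t M UNIV]
  by (cases M) (simp_all add: power2_eq_square algebra_simps)

lemma radial_kernel_derivative:
  assumes "e > 0"
  shows "(radial_kernel M e has_real_derivative radial_kernel1 M e t) (at t)"
    and "(radial_kernel1 M e has_real_derivative radial_kernel2 M e t) (at t)"
    and "continuous_on UNIV (radial_kernel2 M e)"
proof -
  show "(radial_kernel M e has_real_derivative radial_kernel1 M e t) (at t)"
    unfolding radial_kernel_def[abs_def] radial_kernel1_def
  proof (rule has_real_derivative_piecewise)
    show "((\<lambda>t. inverse t ^ M) has_real_derivative - real M * inverse t ^ (M + 1)) (at t)" if "e \<le> t" for t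
      using inverse_power_derivative[of t] that assms by simp
    show "((\<lambda>t. inverse e ^ M * (1 - real M * (t / e - 1) + real M * (real M + 1) / 2 * (t / e - 1)\<^sup>2)) has_real_derivative
      inverse e ^ (M + 1) * (real M * (real M + 1) * (t / e - 1) - real M)) (at t)" for t
    proof -
      have "((\<lambda>t. c * (1 - m * (t * i - 1) + m * (m + 1) / 2 * (t * i - 1)\<^sup>2)) has_real_derivative
        (c * i) * (m * (m + 1) * (t * i - 1) - m)) (at t)" for c i m :: real
        by (rule derivative_eq_intros refl)+ (simp add: field_simps power2_eq_square)
      from this[where c="inverse e ^ M" and m="real M" and i="inverse e"] show ?thesis
        unfolding divide_inverse power_add power_one_right .
    qed
  qed (use assms in auto)
  show "(radial_kernel1 M e has_real_derivative radial_kernel2 M e t) (at t)"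
    unfolding radial_kernel1_def[abs_def] radial_kernel2_def
  proof (rule has_real_derivative_piecewise)
    show "((\<lambda>t. - real M * inverse t ^ (M + 1)) has_real_derivative real M * (real M + 1) * inverse t ^ (M + 2)) (at t)" if "e \<le> t" for t
      using DERIV_cmult[OF inverse_power_derivative[of t "M + 1"], of "- real M"] that assms by (simp add: algebra_simps)
    show "((\<lambda>t. inverse e ^ (M + 1) * (real M * (real M + 1) * (t / e - 1) - real M)) has_real_derivative
      inverse e ^ (M + 2) * (real M * (real M + 1))) (at t)" for t
      using assms by (auto intro!: derivative_eq_intros simp: field_simps)
  qed (use assms in auto)
  \<comment> \<open>Below \<open>e\<close> the second derivative is frozen at its value at
    \<open>e\<close>, which makes its continuity visible.\<close>
  have "radial_kernel2 M e = (\<lambda>t. real M * (real M + 1) * inverse (max e t) ^ (M + 2))"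
    by (auto simp: radial_kernel2_def fun_eq_iff max_def)
  moreover have "max e t \<noteq> 0" for t using assms by linarith
  ultimately show "continuous_on UNIV (radial_kernel2 M e)"
    by (simp only:) (intro continuous_intros, auto)
qed

lemma Ck_radial_kernel: "e > 0 \<Longrightarrow> Ck 2 UNIV (radial_kernel M e)"
  using Ck_lineI[OF radial_kernel_derivative(1) Ck_lineI[OF radial_kernel_derivative(2)], of e 0 M]
    radial_kernel_derivative(3)[of e M] by (simp add: numeral_2_eq_2)

text \<open>The left side is the Laplacian of the kernel in dimension \<open>d\<close>, with
  \<open>t\<close> the squared distance (\<open>laplacian_radial\<close>). Beyond \<open>e\<close>
  the powers cancel because \<open>d = 2 M + 2\<close>; below \<open>e\<close>, with
  \<open>\<tau> = t / e\<close>, the bracket \<open>4 (M + 1) (\<tau> - 1) - 4 + 4 \<tau>\<close>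
  equals \<open>4 (M + 2) (\<tau> - 1)\<close>, whence the constant.\<close>

lemma radial_kernel_laplace:
  assumes "e > 0" "d = 2 * real M + 2"
  shows "2 * d * radial_kernel1 M e t + 4 * t * radial_kernel2 M e t =
    - (4 * real M * (real M + 1) * (real M + 2) * inverse e ^ (M + 1) * max 0 (1 - t / e))"
proof (cases "t < e")
  case True
  then have m: "max 0 (1 - t / e) = 1 - t / e" using assms by (simp add: field_simps)
  define X \<tau> where X_def: "X = inverse e ^ (M + 1)" and \<tau>_def: "\<tau> = t / e"
  have k: "radial_kernel1 M e t = X * (real M * (real M + 1) * (\<tau> - 1) - real M)"
    "radial_kernel2 M e t = X / e * (real M * (real M + 1))"
    using True by (simp_all add: radial_kernel1_def radial_kernel2_def X_def \<tau>_def divide_inverse mult_ac)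
  have "4 * t * (X / e * (real M * (real M + 1))) = 4 * \<tau> * X * (real M * (real M + 1))"
    using assms by (simp add: \<tau>_def)
  then show ?thesis unfolding k m assms(2)
    unfolding X_def[symmetric] \<tau>_def[symmetric] by (simp only:) (simp add: algebra_simps)
next
  case False
  then have "t > 0" "max 0 (1 - t / e) = 0" using assms by (simp_all add: field_simps max_def)
  then show ?thesis using False assms by (simp add: radial_kernel1_def radial_kernel2_def field_simps)
qed

text \<open>The integral of \<open>\<psi> (s + h *\<^sub>R v)\<close> does not change for small
  \<open>h\<close>, since the support stays inside the box; differentiate in \<open>h\<close> at
  0.\<close>

lemma integral_dird_compact_support:
  fixes \<psi> :: "'a::euclidean_space \<Rightarrow> complex"
  assumes \<psi>: "Ck 1 UNIV \<psi>" and K: "compact K" "K \<subseteq> box a b" and supp: "\<And>x. x \<notin> K \<Longrightarrow> \<psi> x = 0"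
  shows "integral (cbox a b) (dird v \<psi>) = 0"
proof -
  obtain e where e: "e > 0" "(\<Union>x\<in>K. cball x e) \<subseteq> box a b"
    using compact_subset_open_imp_cball_epsilon_subset[OF K(1) open_box K(2)] by blast
  define d where "d = e / (1 + norm v)"
  have nv: "1 + norm v > 0" by (simp add: add_pos_nonneg)
  have d: "d > 0" using e nv by (simp add: d_def)
  have small: "norm (h *\<^sub>R v) \<le> e" if "h \<in> ball 0 d" for h :: real
  proof -
    have "norm (h *\<^sub>R v) \<le> d * (1 + norm v)" using that d by (auto intro!: mult_mono)
    also have "\<dots> = e" by (rule iffD1[OF nonzero_eq_divide_eq d_def]) (use nv in simp)
    finally show ?thesis .
  qed
  have c: "continuous_on S \<psi>" for S using Ck_continuous[OF \<psi>] continuous_on_subset by blast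
  \<comment> \<open>Integrals over different boxes containing \<open>K\<close> are compared through
    the integral over the whole space.\<close>
  have int_UNIV: "(\<psi> has_integral integral (cbox a' b') \<psi>) UNIV" if "K \<subseteq> cbox a' b'" for a' b'
    by (rule has_integral_on_superset[OF integrable_integral[OF integrable_continuous[OF c]]]) (use supp that in auto)
  have const: "integral (cbox a b) (\<lambda>s. \<psi> (s + h *\<^sub>R v)) = integral (cbox a b) \<psi>" if h: "h \<in> ball 0 d" for h
  proof -
    have "x \<in> cbox (a + h *\<^sub>R v) (b + h *\<^sub>R v)" if "x \<in> K" for x
    proof -
      have "x - h *\<^sub>R v \<in> cball x e" using small[OF h] by (simp add: dist_norm)
      then have "x - h *\<^sub>R v \<in> cbox a b" using e that box_subset_cbox by blast
      then show ?thesis by (simp add: mem_box algebra_simps)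
    qed
    then have "(\<psi> has_integral integral (cbox (a + h *\<^sub>R v) (b + h *\<^sub>R v)) \<psi>) UNIV" by (intro int_UNIV) auto
    moreover have "(\<psi> has_integral integral (cbox a b) \<psi>) UNIV" using K(2) box_subset_cbox by (intro int_UNIV) blast
    ultimately have "integral (cbox (a + h *\<^sub>R v) (b + h *\<^sub>R v)) \<psi> = integral (cbox a b) \<psi>"
      by (rule has_integral_unique)
    moreover have "(\<lambda>s. \<psi> (s + h *\<^sub>R v)) = \<psi> \<circ> (+) (h *\<^sub>R v)" by (simp add: fun_eq_iff add.commute)
    ultimately show ?thesis by (simp only: integral_shift_cbox_plus)
  qed
  have "bounded_linear (\<lambda>p::real \<times> 'a. snd p + fst p *\<^sub>R v)"
    by (rule bounded_linear_add[OF bounded_linear_snd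
          bounded_linear_compose[OF bounded_linear_scaleR_left bounded_linear_fst]])
  then have "Ck 1 UNIV (\<lambda>p::real \<times> 'a. \<psi> (snd p + fst p *\<^sub>R v))"
    by (intro Ck_compose[OF _ _ Ck_linear \<psi>]) auto
  from parCk_of_Ck[OF _ this, of "ball 0 d" "cbox a b"]
  have par: "parCk (Suc 0) (ball 0 d) (cbox a b) (\<lambda>h s. \<psi> (s + h *\<^sub>R v))" by simp
  have "0 = dird 1 (\<lambda>h::real. integral (cbox a b) \<psi>) 0" by simp
  also have "\<dots> = dird 1 (\<lambda>h. integral (cbox a b) (\<lambda>s. \<psi> (s + h *\<^sub>R v))) 0"
    by (rule dird_cong_open[of "ball 0 d"]) (use const d in auto)
  also have "\<dots> = integral (cbox a b) (\<lambda>s. dird 1 (\<lambda>h. \<psi> (s + h *\<^sub>R v)) 0)"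
    using d by (intro dird_parametric_integral[OF _ par]) auto
  also have "\<dots> = integral (cbox a b) (dird v \<psi>)"
  proof (rule integral_cong)
    fix s
    have "\<psi> differentiable (at (s + 0 *\<^sub>R v))" using \<psi> by (auto intro: Ck_differentiable)
    from has_vector_derivative_line[OF this] show "dird 1 (\<lambda>h. \<psi> (s + h *\<^sub>R v)) 0 = dird v \<psi> s"
      unfolding has_vector_derivative_def by (simp add: dird_eqI)
  qed
  finally show ?thesis by simp
qed

text \<open>The kernel may be singular only where its factor \<open>c\<close> vanishes on the open
  set \<open>T\<close>. Joint continuity is checked on two relatively open pieces: over
  \<open>T\<close> the product is 0, elsewhere the argument stays in \<open>V\<close>. The
  \<open>x\<close>-derivatives have the same form with \<open>k\<close> replaced by
  \<open>dird v k\<close>.\<close>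

lemma parCk_kernel:
  fixes k :: "'a::euclidean_space \<Rightarrow> complex" and c :: "'c::euclidean_space \<Rightarrow> complex"
  assumes W: "open W" and T: "open T" "\<And>s. s \<in> T \<Longrightarrow> c s = 0" and c: "continuous_on S c"
    and l: "continuous_on UNIV l" and V: "open V" "\<And>z s. z \<in> W \<Longrightarrow> s \<in> S \<Longrightarrow> s \<notin> T \<Longrightarrow> z - l s \<in> V"
    and k: "Ck r V k"
  shows "parCk r W S (\<lambda>z s. c s * k (z - l s))"
proof -
  have cont: "continuous_on (W \<times> S) (\<lambda>(z,s). c s * k (z - l s))" if "continuous_on V k" for k
  proof -
    define O1 where "O1 = W \<times> S \<inter> UNIV \<times> T"
    define O2 where "O2 = W \<times> S \<inter> (\<lambda>p. fst p - l (snd p)) -` V"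
    have op: "open ((\<lambda>p. fst p - l (snd p)) -` V)"
      by (intro open_vimage V continuous_intros continuous_on_compose2[OF l]) auto
    have eq: "O1 \<union> O2 = W \<times> S" using V(2) by (auto simp: O1_def O2_def)
    have "openin (top_of_set (O1 \<union> O2)) O1"
      unfolding eq unfolding O1_def by (rule openin_open_Int[OF open_Times[OF open_UNIV T(1)]])
    moreover have "openin (top_of_set (O1 \<union> O2)) O2"
      unfolding eq unfolding O2_def by (rule openin_open_Int[OF op])
    moreover have "continuous_on O1 (\<lambda>(z,s). c s * k (z - l s))"
      by (rule continuous_on_eq[OF continuous_on_const[of _ 0]]) (use T in \<open>auto simp: O1_def\<close>)
    moreover have "continuous_on O2 (\<lambda>p. c (snd p) * k (fst p - l (snd p)))"
      by (intro continuous_intros continuous_on_compose2[OF c] continuous_on_compose2[OF that]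
          continuous_on_compose2[OF l]) (auto simp: O2_def)
    then have "continuous_on O2 (\<lambda>(z,s). c s * k (z - l s))" by (simp add: split_beta)
    ultimately show ?thesis using continuous_on_Un_local_open[of O1 O2] eq by simp
  qed
  show ?thesis using k
  proof (induction r arbitrary: k)
    case 0 then show ?case using cont by simp
  next
    case (Suc r)
    have d: "((\<lambda>z. c s * k (z - l s)) has_derivative (\<lambda>v. c s * dird v k (z - l s))) (at z)"
      if "z \<in> W" "s \<in> S" for z s
    proof (cases "s \<in> T")
      case True then show ?thesis using T by simp
    next
      case False
      then have "k differentiable (at (z - l s))" using V(2)[OF that] Suc.prems by auto
      moreover have "((\<lambda>z. z - l s) has_derivative (\<lambda>v. v)) (at z)" by (auto intro!: derivative_eq_intros)
      ultimately have "((\<lambda>z. k (z - l s)) has_derivative (\<lambda>v. dird v k (z - l s))) (at z)"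
        using diff_chain_at[OF _ has_derivative_dird, of "\<lambda>z. z - l s" "\<lambda>v. v" z k] by (simp add: o_def)
      then show ?thesis by (rule has_derivative_mult_right)
    qed
    have "parCk r W S (\<lambda>z s. dird v (\<lambda>z. c s * k (z - l s)) z)" for v
      using Suc.IH[of "dird v k"] Suc.prems
      by (subst parCk_cong[OF W, where H'="\<lambda>z s. c s * dird v k (z - l s)"]) (auto simp: dird_eqI[OF d])
    moreover have "(\<lambda>z. c s * k (z - l s)) differentiable (at z)" if "z \<in> W" "s \<in> S" for z s
      using d[OF that] by (auto simp: differentiable_def)
    ultimately show ?case using cont[OF Ck_continuous[OF Suc.prems]] by simp
  qed
qed

lemma chol_kernel_integral:
  fixes k :: "complex ^ 'm::finite \<Rightarrow> complex" and c :: "'c::euclidean_space \<Rightarrow> complex"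
  assumes W: "open W" and T: "open T" "\<And>s. s \<in> T \<Longrightarrow> c s = 0" and c: "continuous_on (cbox a b) c"
    and l: "continuous_on UNIV l" and V: "open V" "\<And>z s. z \<in> W \<Longrightarrow> s \<in> cbox a b \<Longrightarrow> s \<notin> T \<Longrightarrow> z - l s \<in> V"
    and k: "Ck 1 V k" "chol V k"
  shows "chol W (\<lambda>z. integral (cbox a b) (\<lambda>s. c s * k (z - l s)))"
  unfolding chol_def
proof (intro ballI conjI allI)
  have par: "parCk (Suc 0) W (cbox a b) (\<lambda>z s. c s * k (z - l s))"
    using parCk_kernel[OF W T c l V k(1)] by simp
  fix z v assume z: "z \<in> W"
  show "(\<lambda>z. integral (cbox a b) (\<lambda>s. c s * k (z - l s))) differentiable at z"
    using parametric_integral_derivative[OF W par z] by (auto simp: differentiable_def)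
  have e: "dird (\<i> *s v) (\<lambda>z. c s * k (z - l s)) z = \<i> * dird v (\<lambda>z. c s * k (z - l s)) z"
    if "s \<in> cbox a b" for s
  proof (cases "s \<in> T")
    case True then show ?thesis using T by simp
  next
    case False
    then have s: "z - l s \<in> V" using V(2) z that by blast
    then have kd: "k differentiable (at (z - l s))" using k by (auto intro: Ck_differentiable)
    moreover have "((\<lambda>z. z - l s) has_derivative (\<lambda>v. v)) (at z)" by (auto intro!: derivative_eq_intros)
    ultimately have "((\<lambda>z. k (z - l s)) has_derivative (\<lambda>v. dird v k (z - l s))) (at z)"
      using diff_chain_at[OF _ has_derivative_dird, of "\<lambda>z. z - l s" "\<lambda>v. v" z k] by (simp add: o_def)
    then have "dird v (\<lambda>z. c s * k (z - l s)) z = c s * dird v k (z - l s)" for v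
      by (intro dird_eqI has_derivative_mult_right)
    then show ?thesis using chol_scale[OF k(2) s] by simp
  qed
  show "dird (\<i> *s v) (\<lambda>z. integral (cbox a b) (\<lambda>s. c s * k (z - l s))) z =
      \<i> * dird v (\<lambda>z. integral (cbox a b) (\<lambda>s. c s * k (z - l s))) z"
    unfolding dird_parametric_integral[OF W par z] integral_mult_right[symmetric]
    by (rule integral_cong) (rule e)
qed

section \<open>Weakly harmonic functions and a Green formula\<close>

definition laplacian :: "(real ^ 'm::finite \<Rightarrow> complex) \<Rightarrow> real ^ 'm \<Rightarrow> complex" where
  "laplacian f x = (\<Sum>i\<in>UNIV. dird (axis i 1) (dird (axis i 1) f) x)"

lemma laplacian_cong_open:
  assumes "open U" "x \<in> U" "\<And>y. y \<in> U \<Longrightarrow> f y = g y"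
  shows "laplacian f x = laplacian g x"
  unfolding laplacian_def
  by (intro sum.cong refl dird_cong_open[OF assms(1,2)] dird_cong_open[OF assms(1)] assms(3))

lemma laplacian_mult:
  assumes "Ck 2 UNIV f" "Ck 2 UNIV g"
  shows "laplacian (\<lambda>x. f x * g x) x = f x * laplacian g x
    + (\<Sum>i\<in>UNIV. 2 * dird (axis i 1) f x * dird (axis i 1) g x) + laplacian f x * g x"
proof -
  have f: "f differentiable (at x)" "dird v f differentiable (at x)" for v x using assms(1) by (auto simp: numeral_2_eq_2)
  have g: "g differentiable (at x)" "dird v g differentiable (at x)" for v x using assms(2) by (auto simp: numeral_2_eq_2)
  have "dird v (\<lambda>x. f x * g x) = (\<lambda>x. f x * dird v g x + dird v f x * g x)" for v
    by (simp add: fun_eq_iff dird_mult f g)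
  then have "dird v (dird v (\<lambda>x. f x * g x)) x =
      f x * dird v (dird v g) x + 2 * dird v f x * dird v g x + dird v (dird v f) x * g x" for v
    by (simp add: dird_add dird_mult f g differentiable_mult)
  then show ?thesis by (simp add: laplacian_def sum.distrib sum_distrib_left sum_distrib_right)
qed

lemma dird_radial:
  fixes x s v :: "'a::euclidean_space" and g g' :: "real \<Rightarrow> real"
  assumes "(g has_real_derivative g' ((s - x) \<bullet> (s - x))) (at ((s - x) \<bullet> (s - x)))"
  shows "dird v (\<lambda>s. complex_of_real (g ((s - x) \<bullet> (s - x)))) s = of_real (2 * ((s - x) \<bullet> v) * g' ((s - x) \<bullet> (s - x)))"
proof -
  have "((\<lambda>s. (s - x) \<bullet> (s - x)) has_derivative (\<lambda>v. 2 * ((s - x) \<bullet> v))) (at s)"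
    by (auto intro!: derivative_eq_intros simp: inner_commute)
  from has_derivative_compose[OF this assms[unfolded has_field_derivative_def]]
  have "((\<lambda>s. complex_of_real (g ((s - x) \<bullet> (s - x)))) has_derivative
     (\<lambda>v. of_real (g' ((s - x) \<bullet> (s - x)) * (2 * ((s - x) \<bullet> v))))) (at s)"
    by (rule has_derivative_of_real)
  then show ?thesis by (simp add: dird_eqI mult_ac)
qed

lemma bounded_linear_complex_of_real: "bounded_linear complex_of_real"
  by (rule bounded_linear_of_real)

lemma Ck_sqdist: "Ck r UNIV (\<lambda>s. (s - x) \<bullet> (s - x))"
  by (intro Ck_bilinear[OF bounded_bilinear_inner] Ck_diff Ck_linear[OF bounded_linear_ident] Ck_const open_UNIV)

lemma Ck_radial:
  assumes "Ck 2 UNIV g"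
  shows "Ck 2 UNIV (\<lambda>s. complex_of_real (g ((s - x) \<bullet> (s - x))))"
proof -
  have "Ck 2 UNIV (\<lambda>s. g ((s - x) \<bullet> (s - x)))" by (rule Ck_compose[OF _ _ Ck_sqdist assms]) auto
  from Ck_compose[OF _ _ this Ck_linear[OF bounded_linear_complex_of_real, of 2 UNIV]] show ?thesis by simp
qed

lemma laplacian_radial:
  fixes x s :: "real ^ 'm::finite" and g g1 g2 :: "real \<Rightarrow> real"
  assumes g: "\<And>t. (g has_real_derivative g1 t) (at t)" and g1: "\<And>t. (g1 has_real_derivative g2 t) (at t)"
  shows "laplacian (\<lambda>s. complex_of_real (g ((s - x) \<bullet> (s - x)))) s =
    of_real (2 * real CARD('m) * g1 ((s - x) \<bullet> (s - x)) + 4 * ((s - x) \<bullet> (s - x)) * g2 ((s - x) \<bullet> (s - x)))"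
proof -
  let ?r = "\<lambda>s. (s - x) \<bullet> (s - x)"
  have d1: "dird (axis i 1) (\<lambda>s. complex_of_real (g (?r s))) = (\<lambda>s. of_real (2 * (s - x) $ i) * of_real (g1 (?r s)))" for i
    by (simp add: fun_eq_iff dird_radial[where g'=g1, OF g] inner_axis)
  have dg: "(\<lambda>s. complex_of_real (g1 (?r s))) differentiable (at s)" for s
  proof -
    have "((\<lambda>s. (s - x) \<bullet> (s - x)) has_derivative (\<lambda>v. 2 * ((s - x) \<bullet> v))) (at s)"
      by (auto intro!: derivative_eq_intros simp: inner_commute)
    from has_derivative_of_real[OF has_derivative_compose[OF this g1[unfolded has_field_derivative_def]]]
    show ?thesis unfolding differentiable_def by blast
  qed
  have "((\<lambda>s. complex_of_real (2 * (s - x) $ i)) has_derivative (\<lambda>v. of_real (2 * v $ i))) (at s)" for i s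
    by (auto intro!: derivative_eq_intros bounded_linear.has_derivative[OF bounded_linear_vec_nth])
  note l = dird_eqI[OF this] this
  have "dird (axis i 1) (dird (axis i 1) (\<lambda>s. complex_of_real (g (?r s)))) s =
     of_real (2 * g1 (?r s) + 4 * ((s - x) $ i * (s - x) $ i) * g2 (?r s))" for i
  proof -
    define R y where "R = ?r s" and "y = (s - x) $ i"
    have y: "(s - x) \<bullet> axis i 1 = y" by (simp add: y_def inner_axis)
    have "(\<lambda>s. complex_of_real (2 * (s - x) $ i)) differentiable (at s)"
      unfolding differentiable_def using l(2) by blast
    then have "dird (axis i 1) (\<lambda>s. complex_of_real (2 * (s - x) $ i) * complex_of_real (g1 (?r s))) s
      = of_real (2 * y) * dird (axis i 1) (\<lambda>s. complex_of_real (g1 (?r s))) s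
        + dird (axis i 1) (\<lambda>s. complex_of_real (2 * (s - x) $ i)) s * complex_of_real (g1 R)"
      unfolding R_def y_def by (rule dird_mult[OF _ dg])
    also have "\<dots> = of_real (2 * g1 R + 4 * (y * y) * g2 R)"
      unfolding l(1) dird_radial[where g'=g2, OF g1] y R_def[symmetric] by (simp add: algebra_simps)
    finally show ?thesis unfolding d1 R_def y_def .
  qed
  then have "laplacian (\<lambda>s. complex_of_real (g (?r s))) s =
    of_real (\<Sum>i\<in>UNIV. 2 * g1 (?r s) + 4 * ((s - x) $ i * (s - x) $ i) * g2 (?r s))"
    by (simp only: laplacian_def of_real_sum)
  also have "(\<Sum>i\<in>UNIV. 2 * g1 (?r s) + 4 * ((s - x) $ i * (s - x) $ i) * g2 (?r s)) =
     2 * real CARD('m) * g1 (?r s) + 4 * (?r s) * g2 (?r s)"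
    unfolding inner_vec_def inner_real_def by (simp only: sum.distrib sum_distrib_left sum_distrib_right sum_constant)
  finally show ?thesis .
qed

text \<open>The test functions are all those of class \<open>Ck 2\<close>, not only the smooth ones,
  because the cutoff times the regularized kernel is no smoother.\<close>

definition weakly_harmonic :: "real ^ 'm::finite \<Rightarrow> real ^ 'm \<Rightarrow> (real ^ 'm \<Rightarrow> complex) \<Rightarrow> bool" where
  "weakly_harmonic a b f \<longleftrightarrow> (\<forall>\<phi> K. Ck 2 UNIV \<phi> \<and> compact K \<and> K \<subseteq> box a b \<and> (\<forall>x. x \<notin> K \<longrightarrow> \<phi> x = 0) \<longrightarrow>
     integral (cbox a b) (\<lambda>s. f s * laplacian \<phi> s) = 0)"

lemma dird_support:
  assumes "closed K" "\<And>x. x \<notin> K \<Longrightarrow> \<phi> x = 0" "x \<notin> K"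
  shows "dird v \<phi> x = 0"
  using dird_cong_open[of "- K" x \<phi> "\<lambda>_. 0" v] assms by auto

lemma weakly_harmonic_1:
  fixes a b :: "real ^ 'm::finite"
  shows "weakly_harmonic a b (\<lambda>_. 1)"
  unfolding weakly_harmonic_def
proof (intro allI impI, elim conjE)
  fix \<phi> :: "real ^ 'm \<Rightarrow> complex" and K
  assume *: "Ck 2 UNIV \<phi>" "compact K" "K \<subseteq> box a b" "\<forall>x. x \<notin> K \<longrightarrow> \<phi> x = 0"
  have c: "Ck 1 UNIV (dird v \<phi>)" for v by (rule Ck_dird[OF *(1)]) simp
  have "continuous_on (cbox a b) (dird v (dird v \<phi>))" for v
    using Ck_continuous[OF Ck_dird[OF c, of 0]] continuous_on_subset by fastforce
  then have "integral (cbox a b) (laplacian \<phi>) = (\<Sum>i\<in>UNIV. integral (cbox a b) (dird (axis i 1) (dird (axis i 1) \<phi>)))"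
    unfolding laplacian_def by (intro integral_sum integrable_continuous) auto
  also have "\<dots> = 0"
    using * by (intro sum.neutral ballI integral_dird_compact_support[OF c *(2,3)] dird_support[OF compact_imp_closed]) auto
  finally show "integral (cbox a b) (\<lambda>s. 1 * laplacian \<phi> s) = 0" by simp
qed

lemma norm_Revec_le: "norm (Revec z) \<le> norm z" and norm_Imvec_le: "norm (Imvec z) \<le> norm z"
  unfolding norm_vec_def
  by (auto intro!: L2_set_mono simp: Revec_def Imvec_def abs_Re_le_cmod abs_Im_le_cmod)

lemma Re_sum_squares: "Re (\<Sum>i\<in>UNIV. w $ i * w $ i) = (norm (Revec w))\<^sup>2 - (norm (Imvec w))\<^sup>2"
  by (simp add: power2_norm_eq_inner inner_vec_def Revec_def Imvec_def sum_subtractf)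

text \<open>On real points this is the distance to the power \<open>2 - d\<close> in dimension
  \<open>d = 2 M + 2\<close>. Even dimension makes the exponent of the sum of squares an integer, so
  the complex extension is rational and no branch has to be chosen.\<close>

definition newton :: "nat \<Rightarrow> complex ^ 'm::finite \<Rightarrow> complex" where
  "newton M z = inverse (\<Sum>i\<in>UNIV. z $ i * z $ i) ^ M"

abbreviation "nonnull \<equiv> {z :: complex ^ 'm::finite. (\<Sum>i\<in>UNIV. z $ i * z $ i) \<noteq> 0}"

lemma open_nonnull: "open nonnull"
  by (intro open_Collect_neq continuous_intros)

lemma Ck_newton: "Ck r nonnull (newton M)" and chol_newton: "chol nonnull (newton M)"
proof -
  show "Ck r nonnull (newton M)" unfolding newton_def[abs_def]
    by (intro Ck_power Ck_inverse Ck_sum Ck_mult open_nonnull Ck_linear[OF bounded_linear_vec_nth]) auto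
  show "chol nonnull (newton M)" unfolding newton_def[abs_def]
    by (intro chol_power chol_inverse chol_sum chol_mult chol_nth) auto
qed

definition bump :: "real ^ 'm::finite \<Rightarrow> real \<Rightarrow> real ^ 'm \<Rightarrow> complex" where
  "bump p r s = of_real (cutoff (((s - p) \<bullet> (s - p)) / r\<^sup>2))"

lemma Ck_bump: "Ck 2 UNIV (bump p r)"
proof -
  have "Ck 2 UNIV (\<lambda>t. cutoff (t / r\<^sup>2))"
    by (rule Ck_compose[OF _ _ Ck_linear[OF bounded_linear_divide] Ck_cutoff]) auto
  from Ck_radial[OF this] show ?thesis by (simp add: bump_def[abs_def])
qed

lemma bump_eq_1:
  assumes "r > 0" "s \<in> ball p r" shows "bump p r s = 1"
proof -
  have "(norm (s - p))\<^sup>2 \<le> r\<^sup>2" using assms by (intro power_mono) (auto simp: dist_norm norm_minus_commute)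
  then have "((s - p) \<bullet> (s - p)) / r\<^sup>2 \<le> 1" using assms by (simp add: power2_norm_eq_inner)
  then show ?thesis unfolding bump_def by (simp add: cutoff_eq_1)
qed

lemma bump_eq_0:
  assumes "r > 0" "s \<notin> cball p (2 * r)" shows "bump p r s = 0"
proof -
  have "(2 * r)\<^sup>2 \<le> (norm (s - p))\<^sup>2" using assms by (intro power_mono) (auto simp: dist_norm norm_minus_commute)
  then have "((s - p) \<bullet> (s - p)) / r\<^sup>2 \<ge> 4" using assms by (simp add: power2_norm_eq_inner field_simps)
  then have "((s - p) \<bullet> (s - p)) / r\<^sup>2 \<ge> 2" by linarith
  then show ?thesis unfolding bump_def by (simp add: cutoff_eq_0)
qed

lemma bump_derivatives_eq_0:
  assumes "r > 0" "s \<in> ball p r"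
  shows "dird v (bump p r) s = 0" "laplacian (bump p r) s = 0"
proof -
  show "dird v (bump p r) s = 0"
    using dird_cong_open[OF open_ball assms(2) bump_eq_1[OF assms(1)]] by simp
  have "laplacian (bump p r) s = laplacian (\<lambda>_. 1) s"
    by (rule laplacian_cong_open[OF open_ball assms(2) bump_eq_1[OF assms(1)]])
  also have "\<dots> = 0"
  proof -
    have "dird v (\<lambda>_::real ^ 'a. 1::complex) = (\<lambda>_. 0)" for v by (rule ext) simp
    then show ?thesis by (simp add: laplacian_def)
  qed
  finally show "laplacian (bump p r) s = 0" .
qed

lemma continuous_on_laplacian: "Ck 2 UNIV f \<Longrightarrow> continuous_on S (laplacian f)"
  unfolding laplacian_def[abs_def] numeral_2_eq_2
  by (intro continuous_on_sum) (auto intro: continuous_on_subset[of UNIV])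

lemma continuous_on_dird: "Ck 2 UNIV f \<Longrightarrow> continuous_on S (dird v f)"
  by (rule continuous_on_subset[OF Ck_continuous[OF Ck_dird[of 2 _ _ 1]]]) auto

text \<open>Only the shell on which the bump is not locally constant contributes, so \<open>green\<close> is holomorphic near its
  centre.  On real points it is a constant multiple of a weakly harmonic \<open>g\<close>; comparing with \<open>g = 1\<close> avoids
  computing the constant.\<close>

definition green :: "nat \<Rightarrow> real ^ 'm \<Rightarrow> real \<Rightarrow> real ^ 'm \<Rightarrow> real ^ 'm \<Rightarrow> (real ^ 'm::finite \<Rightarrow> complex) \<Rightarrow> complex ^ 'm \<Rightarrow> complex" where
  "green M p r a b g z = integral (cbox a b) (\<lambda>s. (g s * laplacian (bump p r) s) * newton M (z - cvec s))
    + (\<Sum>i\<in>UNIV. integral (cbox a b) (\<lambda>s. (g s * (- 2 * dird (axis i 1) (bump p r) s)) * dird (axis i 1) (newton M) (z - cvec s)))"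

text \<open>Explains the radius \<open>r / 4\<close>: the real part of \<open>z - cvec s\<close> is
  longer than \<open>r / 2\<close> and the imaginary part shorter than \<open>r / 4\<close>, so the
  sum of squares has positive real part.\<close>

lemma nonnull_near:
  assumes z: "z \<in> ball (cvec p) (r / 4)" and s: "s \<notin> ball p r"
  shows "z - cvec s \<in> nonnull"
proof -
  have a: "norm (Revec (z - cvec p)) < r / 4" "norm (Imvec (z - cvec p)) < r / 4"
    using norm_Revec_le[of "z - cvec p"] norm_Imvec_le[of "z - cvec p"] z
    by (auto simp: dist_norm norm_minus_commute)
  have e: "Revec (z - cvec s) = Revec (z - cvec p) - (s - p)" "Imvec (z - cvec s) = Imvec (z - cvec p)"
    by (simp_all add: vec_eq_iff Revec_def Imvec_def)
  have "norm (s - p) \<ge> r" using s by (simp add: dist_norm norm_minus_commute)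
  then have "norm (Revec (z - cvec s)) > r / 2"
    using norm_triangle_ineq2[of "s - p" "Revec (z - cvec p)"] a
      norm_ge_zero[of "Revec (z - cvec p)"]
    unfolding e norm_minus_commute[of "Revec (z - cvec p)" "s - p"] by linarith
  then have "norm (Imvec (z - cvec s)) < norm (Revec (z - cvec s))"
    using a norm_ge_zero[of "Revec (z - cvec p)"] unfolding e(2) by linarith
  then have "(norm (Imvec (z - cvec s)))\<^sup>2 < (norm (Revec (z - cvec s)))\<^sup>2" by (intro power_strict_mono) auto
  then have "Re (\<Sum>i\<in>UNIV. (z - cvec s) $ i * (z - cvec s) $ i) > 0" unfolding Re_sum_squares by simp
  then have "(\<Sum>i\<in>UNIV. (z - cvec s) $ i * (z - cvec s) $ i) \<noteq> 0" by (metis less_irrefl zero_complex.sel(1))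
  then show ?thesis by (rule CollectI)
qed

text \<open>The derivatives of the bump vanish on \<open>ball p r\<close>, which plays the part of
  \<open>T\<close> in \<open>parCk_kernel\<close>; outside it \<open>nonnull_near\<close> keeps the
  argument off the null cone.\<close>

lemma green_regular:
  fixes a b p :: "real ^ 'm::finite"
  assumes g: "continuous_on (cbox a b) g" and r: "r > 0"
  shows "Ck q (ball (cvec p) (r / 4)) (green M p r a b g)"
    and "chol (ball (cvec p) (r / 4)) (green M p r a b g)"
proof -
  note V = open_nonnull nonnull_near
  have c: "continuous_on UNIV (cvec :: real ^ 'm \<Rightarrow> complex ^ 'm)"
    by (rule linear_continuous_on[OF bounded_linear_cvec])
  have 0: "g s * laplacian (bump p r) s = 0" "g s * (- 2 * dird v (bump p r) s) = 0" if "s \<in> ball p r" for s v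
    using bump_derivatives_eq_0[OF r that] by simp_all
  have g1: "continuous_on (cbox a b) (\<lambda>s. g s * laplacian (bump p r) s)"
    "continuous_on (cbox a b) (\<lambda>s. g s * (- 2 * dird v (bump p r) s))" for v
    by (intro continuous_intros g continuous_on_laplacian continuous_on_dird Ck_bump)+
  have k: "Ck q nonnull (newton M :: complex ^ 'm \<Rightarrow> complex)" "Ck q nonnull (dird v (newton M) :: complex ^ 'm \<Rightarrow> complex)"
    "chol nonnull (newton M :: complex ^ 'm \<Rightarrow> complex)" "chol nonnull (dird v (newton M) :: complex ^ 'm \<Rightarrow> complex)" for q v
    by (auto intro: Ck_newton chol_newton Ck_dird chol_dird open_nonnull)
  show "Ck q (ball (cvec p) (r / 4)) (green M p r a b g)"
    unfolding green_def[abs_def]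
    by (intro Ck_add Ck_sum open_ball Ck_parametric_integral)
      (rule parCk_kernel[OF open_ball open_ball 0(1) g1(1) c V k(1)] parCk_kernel[OF open_ball open_ball 0(2) g1(2) c V k(2)]; assumption)+
  show "chol (ball (cvec p) (r / 4)) (green M p r a b g)"
    unfolding green_def[abs_def]
    by (intro chol_add chol_sum)
      (rule chol_kernel_integral[OF open_ball open_ball 0(1) g1(1) c V k(1,3)] chol_kernel_integral[OF open_ball open_ball 0(2) g1(2) c V k(2,4)]; assumption)+
qed

lemma green_integrable:
  fixes a b p x v :: "real ^ 'm::finite" and w :: "complex ^ 'm"
  assumes g: "continuous_on (cbox a b) g" and r: "r > 0" and x: "x \<in> ball p (r / 4)"
  shows "(\<lambda>s. (g s * laplacian (bump p r) s) * newton M (cvec x - cvec s)) integrable_on cbox a b"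
    and "(\<lambda>s. (g s * (- 2 * dird v (bump p r) s)) * dird w (newton M) (cvec x - cvec s)) integrable_on cbox a b"
proof -
  have c: "continuous_on UNIV (cvec :: real ^ 'm \<Rightarrow> complex ^ 'm)"
    by (rule linear_continuous_on[OF bounded_linear_cvec])
  have 0: "g s * laplacian (bump p r) s = 0" "g s * (- 2 * dird v (bump p r) s) = 0" if "s \<in> ball p r" for s v
    using bump_derivatives_eq_0[OF r that] by simp_all
  have g1: "continuous_on (cbox a b) (\<lambda>s. g s * laplacian (bump p r) s)"
    "continuous_on (cbox a b) (\<lambda>s. g s * (- 2 * dird v (bump p r) s))" for v
    by (intro continuous_intros g continuous_on_laplacian continuous_on_dird Ck_bump)+
  have k: "Ck 0 nonnull (newton M :: complex ^ 'm \<Rightarrow> complex)" "Ck 0 nonnull (dird w (newton M) :: complex ^ 'm \<Rightarrow> complex)"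
    by (auto intro!: Ck_continuous Ck_newton Ck_dird[of "Suc 0"] simp del: Ck.simps(2)) 
  have x': "cvec x \<in> ball (cvec p) (r / 4)" using x by simp
  show "(\<lambda>s. (g s * laplacian (bump p r) s) * newton M (cvec x - cvec s)) integrable_on cbox a b"
    by (rule integrable_continuous[OF parCk_slice[OF parCk_kernel[OF open_ball open_ball 0(1) g1(1) c open_nonnull nonnull_near k(1)] x']])
  show "(\<lambda>s. (g s * (- 2 * dird v (bump p r) s)) * dird w (newton M) (cvec x - cvec s)) integrable_on cbox a b"
    by (rule integrable_continuous[OF parCk_slice[OF parCk_kernel[OF open_ball open_ball 0(2) g1(2) c open_nonnull nonnull_near k(2)] x']])
qed

lemma newton_cvec: "newton M (cvec x - cvec s) = of_real (inverse ((s - x) \<bullet> (s - x)) ^ M)"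
proof -
  have "(\<Sum>i\<in>UNIV. (cvec x - cvec s) $ i * (cvec x - cvec s) $ i) = of_real ((s - x) \<bullet> (s - x))"
    unfolding inner_vec_def of_real_sum by (intro sum.cong refl) (simp add: algebra_simps)
  then show ?thesis by (simp add: newton_def)
qed

text \<open>Test weak harmonicity against the bump times the regularized kernel centred at
  \<open>x\<close>. Where the bump is 1 the Laplacian produces the weight; where it varies, the
  kernel is the exact Newton kernel and only the cross terms survive. The right side does not depend
  on \<open>e\<close>, which lets the weight be concentrated at \<open>x\<close>.\<close>

lemma green_identity:
  fixes a b p x :: "real ^ 'm::finite"
  assumes d: "CARD('m) = 2 * M + 2" and r: "r > 0" and box: "cball p (2 * r) \<subseteq> box a b"
    and g: "continuous_on (cbox a b) g" and wh: "weakly_harmonic a b g"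
    and x: "x \<in> ball p (r / 4)" and e: "0 < e" "e < (r / 2)\<^sup>2"
  shows "of_real (4 * real M * (real M + 1) * (real M + 2) * inverse e ^ (M + 1)) *
      integral (cbox a b) (\<lambda>s. g s * of_real (max 0 (1 - ((s - x) \<bullet> (s - x)) / e)))
    = green M p r a b g (cvec x)"
proof -
  define C where "C = complex_of_real (4 * real M * (real M + 1) * (real M + 2) * inverse e ^ (M + 1))"
  define w where "w = (\<lambda>s. complex_of_real (max 0 (1 - ((s - x) \<bullet> (s - x)) / e)))"
  define \<eta> where "\<eta> = (\<lambda>s. complex_of_real (radial_kernel M e ((s - x) \<bullet> (s - x))))"
  have k\<eta>: "Ck 2 UNIV \<eta>" unfolding \<eta>_def by (rule Ck_radial[OF Ck_radial_kernel[OF e(1)]])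
  have d': "real CARD('m) = 2 * real M + 2" using d by simp
  have lap\<eta>: "laplacian \<eta> s = - C * w s" for s
    unfolding \<eta>_def laplacian_radial[OF radial_kernel_derivative(1,2)[OF e(1)]]
      radial_kernel_laplace[OF e(1) d'] C_def w_def by simp
  define A where "A = (\<lambda>s. (g s * laplacian (bump p r) s) * newton M (cvec x - cvec s))"
  define B where "B = (\<lambda>i s. (g s * (- 2 * dird (axis i 1) (bump p r) s)) * dird (axis i 1) (newton M) (cvec x - cvec s))"
  have pw: "g s * laplacian (\<lambda>s. bump p r s * \<eta> s) s = - C * (g s * w s) + (A s + (\<Sum>i\<in>UNIV. B i s))" for s
  proof (cases "s \<in> ball p r")
    case True
    have "laplacian (\<lambda>s. bump p r s * \<eta> s) s = laplacian \<eta> s"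
      by (rule laplacian_cong_open[OF open_ball True]) (simp add: bump_eq_1[OF r])
    then show ?thesis using bump_derivatives_eq_0[OF r True] by (simp add: A_def B_def lap\<eta>)
  next
    \<comment> \<open>Outside \<open>ball p r\<close> the distance to \<open>x\<close> is at least
      \<open>r / 2\<close>, so \<open>e < (r / 2)\<^sup>2\<close> puts \<open>s\<close> beyond the
      regularized zone: the weight is 0 and \<open>\<eta>\<close> is harmonic there.\<close>
    case False
    have "norm (s - p) \<ge> r" "norm (x - p) < r / 4" using False x by (auto simp: dist_norm norm_minus_commute)
    then have "norm (s - x) \<ge> r / 2" using norm_triangle_ineq2[of "s - p" "x - p"] r by simp
    then have "(r / 2)\<^sup>2 \<le> (norm (s - x))\<^sup>2" using r by (intro power_mono) auto
    then have far: "e < (s - x) \<bullet> (s - x)" using e by (simp add: power2_norm_eq_inner)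
    then have w: "w s = 0" using e by (simp add: w_def field_simps)
    define S where "S = {s. e < (s - x) \<bullet> (s - x)}"
    have S: "open S" unfolding S_def by (intro open_Collect_less continuous_intros)
    have \<eta>: "\<eta> s = newton M (cvec x - cvec s)" if "s \<in> S" for s
      using that by (simp add: \<eta>_def S_def newton_cvec radial_kernel_def)
    \<comment> \<open>The kernel depends on \<open>x - s\<close>; differentiating in
      \<open>s\<close> changes the sign, which accounts for the factor \<open>- 2\<close> in
      \<open>green\<close>.\<close>
    have "dird v \<eta> s = - dird (cvec v) (newton M) (cvec x - cvec s)" for v
    proof -
      have n: "newton M differentiable (at (cvec x - cvec s))"
      proof (rule Ck_differentiable[OF Ck_newton[of "Suc 0"]])
        have "(\<Sum>i\<in>UNIV. (cvec x - cvec s) $ i * (cvec x - cvec s) $ i) = of_real ((s - x) \<bullet> (s - x))"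
          unfolding inner_vec_def of_real_sum by (intro sum.cong refl) (simp add: algebra_simps)
        moreover have "(s - x) \<bullet> (s - x) \<noteq> 0" using far e by linarith
        ultimately show "cvec x - cvec s \<in> nonnull" by (simp only: mem_Collect_eq of_real_eq_0_iff simp_thms)
      qed simp
      have "((\<lambda>s. cvec x - cvec s) has_derivative (\<lambda>v. - cvec v)) (at s)"
        by (auto intro!: derivative_eq_intros bounded_linear.has_derivative[OF bounded_linear_cvec])
      from diff_chain_at[OF this has_derivative_dird[OF n]]
      have "dird v (\<lambda>s. newton M (cvec x - cvec s)) s = dird (- cvec v) (newton M) (cvec x - cvec s)"
        by (simp add: o_def dird_eqI)
      also have "\<dots> = - dird (cvec v) (newton M) (cvec x - cvec s)"
        by (rule linear_neg[OF linear_dird[OF n]])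
      finally show ?thesis using dird_cong_open[OF S _ \<eta>, where x=s and v=v] far by (simp add: S_def)
    qed
    moreover have "cvec (axis i 1) = axis i 1" for i :: 'm by (simp add: vec_eq_iff axis_def)
    ultimately have "laplacian (\<lambda>s. bump p r s * \<eta> s) s = laplacian (bump p r) s * newton M (cvec x - cvec s)
      + (\<Sum>i\<in>UNIV. - 2 * dird (axis i 1) (bump p r) s * dird (axis i 1) (newton M) (cvec x - cvec s))"
      using \<eta>[of s] far by (simp add: laplacian_mult[OF Ck_bump k\<eta>] lap\<eta> w S_def)
    then show ?thesis by (simp add: A_def B_def w sum_distrib_left algebra_simps)
  qed
  have c2: "Ck 2 UNIV (\<lambda>s. bump p r s * \<eta> s)" by (intro Ck_mult open_UNIV Ck_bump k\<eta>)
  have "0 = integral (cbox a b) (\<lambda>s. g s * laplacian (\<lambda>s. bump p r s * \<eta> s) s)"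
    using wh[unfolded weakly_harmonic_def, rule_format, of "\<lambda>s. bump p r s * \<eta> s" "cball p (2 * r)"] c2 box bump_eq_0[OF r]
    by auto
  also have "\<dots> = integral (cbox a b) (\<lambda>s. - C * (g s * w s) + (A s + (\<Sum>i\<in>UNIV. B i s)))"
    by (simp only: pw)
  also have "\<dots> = - C * integral (cbox a b) (\<lambda>s. g s * w s) + (integral (cbox a b) A + (\<Sum>i\<in>UNIV. integral (cbox a b) (B i)))"
  proof -
    have "(\<lambda>s. g s * w s) integrable_on cbox a b"
      unfolding w_def using e by (intro integrable_continuous continuous_intros g) auto
    moreover have "A integrable_on cbox a b" "B i integrable_on cbox a b" for i
      unfolding A_def B_def by (rule green_integrable[OF g r x])+
    ultimately show ?thesis
      by (intro integral_unique has_integral_add has_integral_mult_right has_integral_sum integrable_integral) auto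
  qed
  also have "integral (cbox a b) A + (\<Sum>i\<in>UNIV. integral (cbox a b) (B i)) = green M p r a b g (cvec x)"
    by (simp add: green_def A_def B_def)
  finally show ?thesis by (simp add: C_def w_def)
qed

text \<open>Both \<open>green\<close> of \<open>f\<close> and \<open>green\<close> of 1 are, at a
  real point, the same multiple of an integral against a nonnegative weight supported near it.
  Continuity of \<open>f\<close> then gives \<open>green f = f * green 1\<close> there, so the
  quotient of the two holomorphic functions extends \<open>f\<close>. The condition
  \<open>M \<ge> 1\<close> makes the multiple positive.\<close>

theorem weakly_harmonic_complexification:
  fixes a b p :: "real ^ 'm::finite"
  assumes d: "CARD('m) = 2 * M + 2" and M: "M \<ge> 1" and p: "p \<in> box a b"
    and f: "continuous_on (cbox a b) f" and wh: "weakly_harmonic a b f"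
  shows "\<exists>\<delta>>0. \<exists>F. chol (ball (cvec p) \<delta>) F \<and> (\<forall>q. Ck q (ball (cvec p) \<delta>) F) \<and>
    ball p \<delta> \<subseteq> box a b \<and> (\<forall>x\<in>ball p \<delta>. F (cvec x) = f x)"
proof -
  obtain R where R: "R > 0" "cball p R \<subseteq> box a b" using open_contains_cball open_box p by blast
  define r where "r = R / 2"
  have r: "r > 0" "cball p (2 * r) \<subseteq> box a b" using R by (simp_all add: r_def)
  let ?W = "ball (cvec p) (r / 4)"
  let ?G = "green M p r a b"
  define w where "w = (\<lambda>e x s :: real ^ 'm. max 0 (1 - ((s - x) \<bullet> (s - x)) / e))"
  define c where "c = (\<lambda>e. 4 * real M * (real M + 1) * (real M + 2) * inverse e ^ (M + 1))"
  have c: "c e > 0" if "e > 0" for e using that M by (simp add: c_def)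
  note [continuous_intros] = continuous_on_max
  have cw: "continuous_on (cbox a b) (w e x)" if "e > 0" for e x
    unfolding w_def using that by (intro continuous_intros) auto
  have id: "of_real (c e) * integral (cbox a b) (\<lambda>s. g s * of_real (w e x s)) = ?G g (cvec x)"
    if "continuous_on (cbox a b) g" "weakly_harmonic a b g" "x \<in> ball p (r / 4)" "0 < e" "e < (r / 2)\<^sup>2" for g x e
    unfolding c_def w_def by (rule green_identity[OF d r that])
  have one: "continuous_on (cbox a b) (\<lambda>_. 1 :: complex)" by simp
  have G1: "?G (\<lambda>_. 1) (cvec x) = of_real (c e * integral (cbox a b) (w e x))" "integral (cbox a b) (w e x) > 0"
    if "x \<in> ball p (r / 4)" "0 < e" "e < (r / 2)\<^sup>2" for x e
  proof -
    have "integral (cbox a b) (\<lambda>s. complex_of_real (w e x s)) = of_real (integral (cbox a b) (w e x))"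
      using integral_linear[OF integrable_continuous[OF cw[OF that(2)]] bounded_linear_complex_of_real]
      by (simp add: o_def)
    then show "?G (\<lambda>_. 1) (cvec x) = of_real (c e * integral (cbox a b) (w e x))"
      using id[OF one weakly_harmonic_1 that] by simp
    have xb: "x \<in> box a b" using that(1) r by (auto dest!: subsetD)
    have "integral (cbox a b) (w e x) \<ge> 0"
      by (rule integral_nonneg[OF integrable_continuous[OF cw[OF that(2)]]]) (simp add: w_def)
    moreover have "integral (cbox a b) (w e x) \<noteq> 0"
    proof
      assume "integral (cbox a b) (w e x) = 0"
      then have "(w e x has_integral 0) (cbox a b)"
        using integrable_integral[OF integrable_continuous[OF cw[OF that(2)]]] by metis
      then have "w e x x = 0"
        using xb box_subset_cbox by (intro has_integral_0_cbox_imp_0[OF cw[OF that(2)]]) (auto simp: w_def)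
      then show False by (simp add: w_def)
    qed
    ultimately show "integral (cbox a b) (w e x) > 0" by linarith
  qed
  have eq: "?G f (cvec x) = f x * ?G (\<lambda>_. 1) (cvec x)" if x: "x \<in> ball p (r / 4)" for x
  proof -
    let ?D = "norm (?G f (cvec x) - f x * ?G (\<lambda>_. 1) (cvec x))"
    have xb: "x \<in> box a b" using x r by (auto dest!: subsetD)
    have le: "?D \<le> \<epsilon> * norm (?G (\<lambda>_. 1) (cvec x))" if \<epsilon>: "\<epsilon> > 0" for \<epsilon>
    proof -
      have "isCont f x"
        using continuous_on_interior[OF f] xb by simp
      then obtain \<rho> where \<rho>: "\<rho> > 0" "\<And>s. dist s x < \<rho> \<Longrightarrow> dist (f s) (f x) < \<epsilon>"
        using \<epsilon> unfolding continuous_at_eps_delta by blast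
      \<comment> \<open>The weight lives where the distance to \<open>x\<close> is below the square
        root of \<open>e\<close>: less than \<open>\<rho>\<close>, where \<open>f\<close> varies by
        less than \<open>\<epsilon>\<close>, and less than \<open>r / 2\<close>, as
        \<open>green_identity\<close> asks.\<close>
      define e where "e = (min (r / 4) (\<rho> / 2))\<^sup>2"
      have e: "0 < e" "e < (r / 2)\<^sup>2" "e < \<rho>\<^sup>2"
        unfolding e_def using r \<rho> by (auto intro!: power_strict_mono simp: zero_less_power2 min_def)
      have int: "(\<lambda>s. g s * of_real (w e x s)) integrable_on cbox a b" if "continuous_on (cbox a b) g" for g :: "real ^ 'm \<Rightarrow> complex"
        by (intro integrable_continuous continuous_intros that cw e)
      have "?G f (cvec x) - f x * ?G (\<lambda>_. 1) (cvec x) =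
          of_real (c e) * integral (cbox a b) (\<lambda>s. (f s - f x) * of_real (w e x s))"
      proof -
        have i: "integral (cbox a b) (\<lambda>s. (f s - f x) * of_real (w e x s))
          = integral (cbox a b) (\<lambda>s. f s * of_real (w e x s)) - f x * integral (cbox a b) (\<lambda>s. of_real (w e x s))"
          unfolding left_diff_distrib integral_mult_right[symmetric]
          by (intro integral_diff int f continuous_on_const)
        show ?thesis
          unfolding i id[OF f wh x e(1,2), symmetric] id[OF one weakly_harmonic_1 x e(1,2), symmetric] mult_1_left
          by (simp only: right_diff_distrib mult_ac)
      qed
      moreover have "norm (integral (cbox a b) (\<lambda>s. (f s - f x) * of_real (w e x s))) \<le> integral (cbox a b) (\<lambda>s. \<epsilon> * w e x s)"
      proof (rule integral_norm_bound_integral)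
        show "(\<lambda>s. (f s - f x) * of_real (w e x s)) integrable_on cbox a b"
          by (intro int continuous_intros f)
        show "(\<lambda>s. \<epsilon> * w e x s) integrable_on cbox a b"
          by (intro integrable_continuous continuous_intros cw e)
        fix s assume "s \<in> cbox a b"
        show "norm ((f s - f x) * of_real (w e x s)) \<le> \<epsilon> * w e x s"
        proof (cases "dist s x < \<rho>")
          case True
          then have "norm (f s - f x) \<le> \<epsilon>" using \<rho>(2)[OF True] by (simp add: dist_norm)
          moreover have "w e x s \<ge> 0" by (simp add: w_def)
          ultimately show ?thesis by (simp add: norm_mult mult_right_mono)
        next
          case False
          then have "\<rho>\<^sup>2 \<le> (norm (s - x))\<^sup>2" using \<rho> by (intro power_mono) (auto simp: dist_norm)
          then have "e < (s - x) \<bullet> (s - x)" using e by (simp add: power2_norm_eq_inner)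
          then have "w e x s = 0" using e by (simp add: w_def field_simps)
          then show ?thesis by simp
        qed
      qed
      ultimately have "?D \<le> c e * (\<epsilon> * integral (cbox a b) (w e x))"
        using c[OF e(1)] by (simp add: norm_mult mult_left_mono)
      also have "\<dots> = \<epsilon> * norm (?G (\<lambda>_. 1) (cvec x))"
        using G1[OF x e(1,2)] c[OF e(1)] by (simp add: norm_mult)
      finally show ?thesis .
    qed
    have "?D = 0"
    proof (rule ccontr)
      assume n: "?D \<noteq> 0"
      \<comment> \<open>Any number above the norm serves: \<open>\<epsilon> = ?D / N\<close> in
        \<open>le\<close> would give \<open>?D < ?D\<close>.\<close>
      define N where "N = norm (?G (\<lambda>_. 1) (cvec x)) + 1"
      have N: "N > 0" "norm (?G (\<lambda>_. 1) (cvec x)) < N" by (auto simp: N_def add_nonneg_pos)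
      have Dp: "?D / N > 0" using n N by (intro divide_pos_pos) auto
      have "?D \<le> ?D / N * norm (?G (\<lambda>_. 1) (cvec x))" by (rule le[OF Dp])
      also have "\<dots> < ?D / N * N" by (rule mult_strict_left_mono[OF N(2) Dp])
      also have "\<dots> = ?D" using N by simp
      finally show False by simp
    qed
    then show ?thesis by simp
  qed
  have "?G (\<lambda>_. 1) (cvec p) \<noteq> 0"
  proof -
    have "0 < (r / 4)\<^sup>2" "(r / 4)\<^sup>2 < (r / 2)\<^sup>2" using r by (auto intro!: power_strict_mono)
    then show ?thesis using G1[of p "(r / 4)\<^sup>2"] c[of "(r / 4)\<^sup>2"] r
      by (metis centre_in_ball divide_pos_pos less_irrefl mult_pos_pos of_real_eq_0_iff zero_less_numeral)
  qed
  moreover have "continuous_on ?W (?G (\<lambda>_. 1))" using green_regular(1)[OF one r(1), of 0] by simp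
  moreover have "cvec p \<in> ?W" using r by simp
  ultimately obtain \<delta>0 where \<delta>0: "\<delta>0 > 0" "\<And>z. z \<in> ?W \<Longrightarrow> dist z (cvec p) < \<delta>0 \<Longrightarrow> ?G (\<lambda>_. 1) z \<noteq> 0"
    unfolding continuous_on_iff
    by (metis (no_types, lifting) dist_commute dist_0_norm diff_zero dist_norm less_irrefl zero_less_norm_iff)
  define \<delta> where "\<delta> = min \<delta>0 (r / 4)"
  have \<delta>: "\<delta> > 0" "ball (cvec p) \<delta> \<subseteq> ?W" "ball p \<delta> \<subseteq> ball p (r / 4)" using \<delta>0 r by (auto simp: \<delta>_def)
  have nz: "?G (\<lambda>_. 1) z \<noteq> 0" if "z \<in> ball (cvec p) \<delta>" for z
    using that \<delta> by (intro \<delta>0(2)) (auto simp: \<delta>_def dist_commute)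
  let ?F = "\<lambda>z. ?G f z * inverse (?G (\<lambda>_. 1) z)"
  show ?thesis
  proof (intro exI[of _ \<delta>] exI[of _ ?F] conjI allI ballI)
    show "chol (ball (cvec p) \<delta>) ?F"
      by (intro chol_mult chol_inverse nz chol_subset[OF green_regular(2) \<delta>(2)] f one r)
    show "Ck q (ball (cvec p) \<delta>) ?F" for q
      by (intro Ck_mult Ck_inverse nz open_ball Ck_subset[OF green_regular(1) \<delta>(2)] f one r)
    have "ball p (r / 4) \<subseteq> cball p (2 * r)" using r by auto
    then show "ball p \<delta> \<subseteq> box a b" using \<delta>(3) r(2) by blast
    fix x assume x: "x \<in> ball p \<delta>"
    then have "cvec x \<in> ball (cvec p) \<delta>" by simp
    then show "?F (cvec x) = f x" using eq[of x] nz[of "cvec x"] x \<delta>(3) by (auto simp: field_simps)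
  qed (use \<delta> in auto)
qed

section \<open>Regularity of k-regular functions\<close>

abbreviation nab :: "nat \<Rightarrow> pindex \<Rightarrow> ('n::finite hspace \<Rightarrow> complex) \<Rightarrow> 'n hspace \<Rightarrow> complex" where
  "nab A a \<equiv> cdird (nvec A a)"

text \<open>The product rule and the vanishing integral of a compactly supported derivative, first
  along real directions and then combined for the real and imaginary parts of
  \<open>v\<close>.\<close>

lemma integration_by_parts:
  fixes f \<phi> :: "real ^ 'm::finite \<Rightarrow> complex"
  assumes U: "open U" "cbox a b \<subseteq> U" and f: "Ck 1 U f" and \<phi>: "Ck 1 UNIV \<phi>"
    and K: "compact K" "K \<subseteq> box a b" "\<And>x. x \<notin> K \<Longrightarrow> \<phi> x = 0"
  shows "integral (cbox a b) (\<lambda>x. f x * cdird v \<phi> x) = - integral (cbox a b) (\<lambda>x. cdird v f x * \<phi> x)"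
proof -
  have KU: "K \<subseteq> U" using K U box_subset_cbox by blast
  \<comment> \<open>\<open>f\<close> is controlled on \<open>U\<close> only; off \<open>K\<close>
    the product is identically 0, and the two open sets cover the space.\<close>
  have "Ck 1 UNIV (\<lambda>x. f x * \<phi> x)"
  proof (rule Ck_local)
    fix x
    show "\<exists>V. open V \<and> x \<in> V \<and> Ck 1 V (\<lambda>x. f x * \<phi> x)"
    proof (cases "x \<in> U")
      case True
      then show ?thesis using U Ck_mult[OF U(1) f Ck_subset[OF \<phi>]] by blast
    next
      case False
      have o: "open (- K)" using compact_imp_closed[OF K(1)] by auto
      have "Ck 1 (- K) (\<lambda>x. f x * \<phi> x)"
        using Ck_cong[OF o, of "\<lambda>x. f x * \<phi> x" "\<lambda>_. 0" 1] K(3) Ck_const by (metis ComplD mult_zero_right)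
      then show ?thesis using o False KU by blast
    qed
  qed
  note int0 = integral_dird_compact_support[OF this K(1,2)]
  have fd: "f differentiable (at x)" if "x \<in> cbox a b" for x using f U that by (auto intro: Ck_differentiable)
  have \<phi>d: "\<phi> differentiable (at x)" for x using \<phi> by (auto intro: Ck_differentiable)
  have c: "continuous_on (cbox a b) f" "continuous_on (cbox a b) \<phi>"
    by (rule continuous_on_subset[OF Ck_continuous[OF f] U(2)] continuous_on_subset[OF Ck_continuous[OF \<phi>] subset_UNIV])+
  have cd: "continuous_on (cbox a b) (dird v f)" "continuous_on (cbox a b) (dird v \<phi>)" for v
    by (rule continuous_on_subset[OF Ck_continuous[OF Ck_dird[OF f, of 0]] U(2)]
        continuous_on_subset[OF Ck_continuous[OF Ck_dird[OF \<phi>, of 0]] subset_UNIV]; simp)+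
  note c = c cd
  have *: "integral (cbox a b) (\<lambda>x. f x * dird v \<phi> x) = - integral (cbox a b) (\<lambda>x. dird v f x * \<phi> x)" for v
  proof -
    have "0 = integral (cbox a b) (dird v (\<lambda>x. f x * \<phi> x))" using int0 K(3) by simp
    also have "\<dots> = integral (cbox a b) (\<lambda>x. f x * dird v \<phi> x + dird v f x * \<phi> x)"
      by (intro integral_cong dird_mult fd \<phi>d)
    also have "\<dots> = integral (cbox a b) (\<lambda>x. f x * dird v \<phi> x) + integral (cbox a b) (\<lambda>x. dird v f x * \<phi> x)"
      by (intro integral_add integrable_continuous continuous_intros c)
    finally show ?thesis by (simp add: eq_neg_iff_add_eq_0)
  qed
  have "integral (cbox a b) (\<lambda>x. f x * cdird v \<phi> x)
    = integral (cbox a b) (\<lambda>x. f x * dird (Revec v) \<phi> x) + \<i> * integral (cbox a b) (\<lambda>x. f x * dird (Imvec v) \<phi> x)"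
    unfolding cdird_def distrib_left mult.left_commute[of _ \<i>] integral_mult_right[symmetric]
    by (intro integral_add integrable_continuous continuous_intros c)
  moreover have "integral (cbox a b) (\<lambda>x. cdird v f x * \<phi> x)
    = integral (cbox a b) (\<lambda>x. dird (Revec v) f x * \<phi> x) + \<i> * integral (cbox a b) (\<lambda>x. dird (Imvec v) f x * \<phi> x)"
    unfolding cdird_def distrib_right mult.assoc integral_mult_right[symmetric]
    by (intro integral_add integrable_continuous continuous_intros c)
  ultimately show ?thesis by (simp add: *)
qed

text \<open>In each quaternion the first product is the sum of the squares of the \<open>j\<close>
  and \<open>k\<close> derivatives and the second is minus that of the real and \<open>i\<close>
  derivatives; the mixed terms cancel by symmetry.\<close>

lemma laplacian_eq_nab:
  fixes \<phi> :: "'n::finite hspace \<Rightarrow> complex"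
  assumes \<phi>: "Ck 2 UNIV \<phi>"
  shows "laplacian \<phi> x = (\<Sum>t<CARD('n). nab (Suc (2*t)) P1 (nab (2*t) P0 \<phi>) x - nab (Suc (2*t)) P0 (nab (2*t) P1 \<phi>) x)"
proof -
  have d: "\<phi> differentiable (at x)" "dird v \<phi> differentiable (at x)" for v x using \<phi> by (auto simp: numeral_2_eq_2)
  let ?D = "\<lambda>t r. dird (axis (qidx t r :: 'n bit0 bit0) 1)"
  have n: "nab (2*t) P0 \<phi> = (\<lambda>x. - 1 * ?D t 2 \<phi> x + - \<i> * ?D t 3 \<phi> x)"
    "nab (2*t) P1 \<phi> = (\<lambda>x. - 1 * ?D t 0 \<phi> x + - \<i> * ?D t 1 \<phi> x)" for t
    by (simp_all add: fun_eq_iff nvec_def Let_def cdird_add_dir cdird_axis d)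
  have m: "(\<lambda>x. c * ?D t r \<phi> x + c' * ?D t s \<phi> x) differentiable (at x)" for c c' t r s x
    by (intro differentiable_add differentiable_mult d) auto
  have e: "nab (Suc (2*t)) P1 (nab (2*t) P0 \<phi>) x - nab (Suc (2*t)) P0 (nab (2*t) P1 \<phi>) x = (\<Sum>r<4. ?D t r (?D t r \<phi>) x)" for t
  proof -
    have s: "?D t q (\<lambda>x. c * ?D t r \<phi> x + c' * ?D t s \<phi> x) x = c * ?D t q (?D t r \<phi>) x + c' * ?D t q (?D t s \<phi>) x" for c c' q r s
      by (subst dird_add) (auto intro!: differentiable_mult d simp: dird_mult d)
    have o: "nab (Suc (2*t)) P1 f x = - 1 * ?D t 2 f x + \<i> * ?D t 3 f x"
      "nab (Suc (2*t)) P0 f x = 1 * ?D t 0 f x + - \<i> * ?D t 1 f x" if "f differentiable (at x)" for f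
      using that by (simp_all add: nvec_def Let_def cdird_add_dir cdird_axis)
    have "nab (Suc (2*t)) P1 (nab (2*t) P0 \<phi>) x = ?D t 2 (?D t 2 \<phi>) x + ?D t 3 (?D t 3 \<phi>) x"
      unfolding n o[OF m] s using dird_commute[OF open_UNIV \<phi>, of x "axis (qidx t 2) 1" "axis (qidx t 3) 1"]
      by (simp add: algebra_simps)
    moreover have "nab (Suc (2*t)) P0 (nab (2*t) P1 \<phi>) x = - ?D t 0 (?D t 0 \<phi>) x - ?D t 1 (?D t 1 \<phi>) x"
      unfolding n o[OF m] s using dird_commute[OF open_UNIV \<phi>, of x "axis (qidx t 0) 1" "axis (qidx t 1) 1"]
      by (simp add: algebra_simps)
    ultimately show ?thesis by (simp add: numeral_eq_Suc)
  qed
  have inj: "inj_on (\<lambda>(t,r). qidx t r :: 'n bit0 bit0) ({..<CARD('n)} \<times> {..<4})"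
    by (auto simp: inj_on_def qidx_eq_iff)
  have surj: "(\<lambda>(t,r). qidx t r :: 'n bit0 bit0) ` ({..<CARD('n)} \<times> {..<4}) = UNIV"
  proof -
    have "(i :: 'n bit0 bit0) \<in> (\<lambda>(t,r). qidx t r) ` ({..<CARD('n)} \<times> {..<4})" for i
    proof -
      obtain m where m: "m < 4 * CARD('n)" "i = idx m" using idx_surj .
      then have "i = qidx (m div 4) (m mod 4)" by (simp add: qidx_def)
      moreover have "m div 4 < CARD('n)" "m mod 4 < 4" using m by auto
      ultimately show ?thesis by force
    qed
    then show ?thesis by blast
  qed
  have "laplacian \<phi> x = (\<Sum>(t,r)\<in>{..<CARD('n)} \<times> {..<4}. ?D t r (?D t r \<phi>) x)"
    unfolding laplacian_def surj[symmetric] by (subst sum.reindex[OF inj]) (simp add: split_beta)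
  then show ?thesis unfolding e by (simp add: sum.cartesian_product)
qed

lemma Ck_nab: "open U \<Longrightarrow> Ck r U f \<Longrightarrow> Suc s \<le> r \<Longrightarrow> Ck s U (nab A a f)"
  by (rule Ck_cdird[OF _ Ck_mono])

lemma nab_support:
  assumes "compact K" "\<And>x. x \<notin> K \<Longrightarrow> \<phi> x = 0" "x \<notin> K"
  shows "nab A a \<phi> x = 0"
  using dird_support[OF compact_imp_closed[OF assms(1)] assms(2,3)] by (simp add: cdird_def)

text \<open>By the factorization of the Laplacian, weak harmonicity follows from the weak form of
  one second-order relation for each quaternion.\<close>

lemma weakly_harmonic_nabI:
  fixes a b :: "'n::finite hspace"
  assumes f: "continuous_on (cbox a b) f"
    and eq: "\<And>t \<phi> K. t < CARD('n) \<Longrightarrow> Ck 2 UNIV \<phi> \<Longrightarrow> compact K \<Longrightarrow> K \<subseteq> box a b \<Longrightarrow> (\<And>x. x \<notin> K \<Longrightarrow> \<phi> x = 0) \<Longrightarrow>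
      integral (cbox a b) (\<lambda>x. f x * nab (Suc (2*t)) P1 (nab (2*t) P0 \<phi>) x) =
      integral (cbox a b) (\<lambda>x. f x * nab (Suc (2*t)) P0 (nab (2*t) P1 \<phi>) x)"
  shows "weakly_harmonic a b f"
  unfolding weakly_harmonic_def
proof (intro allI impI, elim conjE)
  fix \<phi> :: "'n hspace \<Rightarrow> complex" and K
  assume *: "Ck 2 UNIV \<phi>" "compact K" "K \<subseteq> box a b" "\<forall>x. x \<notin> K \<longrightarrow> \<phi> x = 0"
  have c: "continuous_on (cbox a b) (nab A a' (nab B b' \<phi>))" for A a' B b'
    by (rule continuous_on_subset[OF Ck_continuous[OF Ck_nab[OF open_UNIV Ck_nab[OF open_UNIV *(1), of 1]]]]) auto
  have i: "(\<lambda>x. f x * nab A a' (nab B b' \<phi>) x) integrable_on cbox a b" for A a' B b'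
    by (intro integrable_continuous continuous_intros f c)
  have "integral (cbox a b) (\<lambda>s. f s * laplacian \<phi> s) =
    (\<Sum>t<CARD('n). integral (cbox a b) (\<lambda>x. f x * nab (Suc (2*t)) P1 (nab (2*t) P0 \<phi>) x) -
      integral (cbox a b) (\<lambda>x. f x * nab (Suc (2*t)) P0 (nab (2*t) P1 \<phi>) x))"
    unfolding laplacian_eq_nab[OF *(1)] sum_distrib_left right_diff_distrib
    by (intro integral_unique has_integral_sum has_integral_diff integrable_integral i finite_lessThan)
  also have "\<dots> = 0" using eq[OF _ *(1-3)] *(4) by (intro sum.neutral) auto
  finally show "integral (cbox a b) (\<lambda>s. f s * laplacian \<phi> s) = 0" .
qed

lemma regs_pairD:
  fixes \<phi> :: "nat \<Rightarrow> 'n::finite hspace \<Rightarrow> complex"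
  shows "regs k U \<phi> \<Longrightarrow> j < k \<Longrightarrow> A < 2 * CARD('n) \<Longrightarrow> x \<in> U \<Longrightarrow> nab A P0 (\<phi> j) x + nab A P1 (\<phi> (Suc j)) x = 0"
  by (auto simp: regs_def)

lemma regs_Ck1: "regs k U \<phi> \<Longrightarrow> j \<le> k \<Longrightarrow> Ck 1 U (\<phi> j)"
  unfolding regs_def by (auto split: if_splits intro: Ck_mono[of 2] simp del: Ck.simps(2) One_nat_def)

text \<open>For \<open>k = 0\<close> both derivatives are moved onto the function. For positive
  \<open>k\<close> only one can be moved: the first-order equation trades \<open>\<phi> j\<close>
  for its neighbour, and both sides become the integral of that neighbour against nablas with equal
  primed indices, which commute.\<close>

lemma regs_weakly_harmonic:
  fixes U :: "'n::finite hspace set"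
  assumes U: "open U" "cbox a b \<subseteq> U" and reg: "regs k U \<phi>" and j: "j \<le> k"
  shows "weakly_harmonic a b (\<phi> j)"
proof (rule weakly_harmonic_nabI)
  show "continuous_on (cbox a b) (\<phi> j)"
    using continuous_on_subset[OF Ck_continuous[OF regs_Ck1[OF reg j]] U(2)] .
  fix t and \<psi> :: "'n hspace \<Rightarrow> complex" and K assume t: "t < CARD('n)" and \<psi>: "Ck 2 UNIV \<psi>" and K: "compact K" "K \<subseteq> box a b" "\<And>x. x \<notin> K \<Longrightarrow> \<psi> x = 0"
  define A B where "A = 2 * t" and "B = Suc (2 * t)"
  have AB: "A < 2 * CARD('n)" "B < 2 * CARD('n)" using t by (auto simp: A_def B_def)
  have \<psi>1: "Ck 1 UNIV (nab C c \<psi>)" for C c by (rule Ck_nab[OF open_UNIV \<psi>]) simp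
  have sup: "nab C c \<psi> x = 0" if "x \<notin> K" for C c x by (rule nab_support[OF K(1) _ that]) (rule K(3))
  note comm = cdird_commute[OF open_UNIV \<psi>]
  have parts: "integral (cbox a b) (\<lambda>x. f x * nab C c (nab D d \<psi>) x) = - integral (cbox a b) (\<lambda>x. nab C c f x * nab D d \<psi> x)"
    if "Ck 1 U f" for f C c D d
    by (rule integration_by_parts[OF U that \<psi>1 K(1,2) sup])
  show "integral (cbox a b) (\<lambda>x. \<phi> j x * nab (Suc (2*t)) P1 (nab (2*t) P0 \<psi>) x) =
      integral (cbox a b) (\<lambda>x. \<phi> j x * nab (Suc (2*t)) P0 (nab (2*t) P1 \<psi>) x)"
    unfolding B_def[symmetric] unfolding A_def[symmetric]
  proof (cases "k = 0")
    case True
    then have f2: "Ck 2 U (\<phi> j)" and z: "\<And>x. x \<in> U \<Longrightarrow> nab A P0 (nab B P1 (\<phi> j)) x = nab B P0 (nab A P1 (\<phi> j)) x"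
      using reg j AB unfolding regs_def by auto
    have f1: "Ck 1 U (\<phi> j)" "Ck 1 U (nab C c (\<phi> j))" for C c
      by (rule Ck_mono[OF f2] Ck_nab[OF U(1) f2]; simp)+
    have twice: "integral (cbox a b) (\<lambda>x. \<phi> j x * nab C c (nab D d \<psi>) x) = integral (cbox a b) (\<lambda>x. nab D d (nab C c (\<phi> j)) x * \<psi> x)" for C c D d
      using parts[OF f1(1)] integration_by_parts[OF U f1(2) Ck_mono[OF \<psi>] K] by simp
    show "integral (cbox a b) (\<lambda>x. \<phi> j x * nab B P1 (nab A P0 \<psi>) x) = integral (cbox a b) (\<lambda>x. \<phi> j x * nab B P0 (nab A P1 \<psi>) x)"
      unfolding twice by (rule integral_cong) (use U z cdird_commute[OF U(1) f2] in \<open>auto simp: subset_iff\<close>)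
  next
    case False
    show "integral (cbox a b) (\<lambda>x. \<phi> j x * nab B P1 (nab A P0 \<psi>) x) = integral (cbox a b) (\<lambda>x. \<phi> j x * nab B P0 (nab A P1 \<psi>) x)"
    proof (cases "j < k")
      case True
      have c: "Ck 1 U (\<phi> j)" "Ck 1 U (\<phi> (Suc j))" using regs_Ck1[OF reg] True by auto
      have tr: "integral (cbox a b) (\<lambda>x. \<phi> j x * nab C P0 (nab D d \<psi>) x) = - integral (cbox a b) (\<lambda>x. \<phi> (Suc j) x * nab C P1 (nab D d \<psi>) x)"
        if C: "C < 2 * CARD('n)" for C D d
      proof -
        have "nab C P0 (\<phi> j) x = - nab C P1 (\<phi> (Suc j)) x" if "x \<in> cbox a b" for x
          using regs_pairD[OF reg True C] U that by (auto simp: eq_neg_iff_add_eq_0)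
        then have "integral (cbox a b) (\<lambda>x. nab C P0 (\<phi> j) x * nab D d \<psi> x) = integral (cbox a b) (\<lambda>x. - (nab C P1 (\<phi> (Suc j)) x * nab D d \<psi> x))"
          by (intro integral_cong) simp
        then show ?thesis by (simp add: parts[OF c(1)] parts[OF c(2)])
      qed
      show ?thesis unfolding comm[of _ "nvec B P1" "nvec A P0", simplified] using tr[OF AB(1), of B P1] tr[OF AB(2), of A P1]
        by (simp add: comm[of _ "nvec B P1" "nvec A P1", simplified])
    next
      \<comment> \<open>The last component has no successor, so its predecessor is used and the
        primed indices exchange roles.\<close>
      case F: False
      then obtain i where i: "j = Suc i" "i < k" using j False by (cases j) auto
      have c: "Ck 1 U (\<phi> i)" "Ck 1 U (\<phi> j)" using regs_Ck1[OF reg] i j by auto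
      have tr: "integral (cbox a b) (\<lambda>x. \<phi> j x * nab C P1 (nab D d \<psi>) x) = - integral (cbox a b) (\<lambda>x. \<phi> i x * nab C P0 (nab D d \<psi>) x)"
        if C: "C < 2 * CARD('n)" for C D d
      proof -
        have "nab C P1 (\<phi> j) x = - nab C P0 (\<phi> i) x" if "x \<in> cbox a b" for x
          using regs_pairD[OF reg i(2) C, of x] U that i by (auto simp: eq_neg_iff_add_eq_0 add.commute)
        then have "integral (cbox a b) (\<lambda>x. nab C P1 (\<phi> j) x * nab D d \<psi> x) = integral (cbox a b) (\<lambda>x. - (nab C P0 (\<phi> i) x * nab D d \<psi> x))"
          by (intro integral_cong) simp
        then show ?thesis by (simp add: parts[OF c(1)] parts[OF c(2)])
      qed
      show ?thesis unfolding comm[of _ "nvec B P0" "nvec A P1", simplified] using tr[OF AB(1), of B P0] tr[OF AB(2), of A P0]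
        by (simp add: comm[of _ "nvec B P0" "nvec A P0", simplified])
    qed
  qed
qed

lemma regs_complexification:
  fixes U :: "'n::finite hspace set"
  assumes U: "open U" and reg: "regs k U \<phi>" and j: "j \<le> k" and p: "p \<in> U"
  shows "\<exists>\<delta>>0. \<exists>F. chol (ball (cvec p) \<delta>) F \<and> (\<forall>q. Ck q (ball (cvec p) \<delta>) F) \<and>
    ball p \<delta> \<subseteq> U \<and> (\<forall>x\<in>ball p \<delta>. F (cvec x) = \<phi> j x)"
proof -
  obtain a b where ab: "cbox a b \<subseteq> U" "p \<in> box a b" using open_contains_cbox[OF U p] by metis
  \<comment> \<open>\<open>M = 2 n - 1\<close> makes \<open>2 M + 2\<close> the real dimension
    \<open>4 n\<close>.\<close>
  have "CARD('n bit0 bit0) = 2 * (2 * CARD('n) - 1) + 2" "2 * CARD('n) - 1 \<ge> 1"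
    using zero_less_card_finite[where 'a='n] by (simp_all del: zero_less_card_finite)
  from weakly_harmonic_complexification[OF this ab(2) _ regs_weakly_harmonic[OF U ab(1) reg j]]
  have "\<exists>\<delta>>0. \<exists>F. chol (ball (cvec p) \<delta>) F \<and> (\<forall>q. Ck q (ball (cvec p) \<delta>) F) \<and>
    ball p \<delta> \<subseteq> box a b \<and> (\<forall>x\<in>ball p \<delta>. F (cvec x) = \<phi> j x)"
    using continuous_on_subset[OF Ck_continuous[OF regs_Ck1[OF reg j]] ab(1)] by blast
  then show ?thesis using ab(1) box_subset_cbox by (metis (no_types, lifting) subset_trans)
qed

text \<open>From here on components may be differentiated repeatedly, although for positive
  \<open>k\<close> regularity asks for one continuous derivative only.\<close>

lemma regs_smooth:
  fixes U :: "'n::finite hspace set"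
  assumes U: "open U" and reg: "regs k U \<phi>" and j: "j \<le> k"
  shows "Ck q U (\<phi> j)"
proof (rule Ck_local)
  fix p assume "p \<in> U"
  from regs_complexification[OF U reg j this] obtain \<delta> F where
    *: "\<delta> > 0" "Ck q (ball (cvec p) \<delta>) F" "\<And>x. x \<in> ball p \<delta> \<Longrightarrow> F (cvec x) = \<phi> j x" by blast
  have "Ck q (ball p \<delta>) (\<lambda>x. F (cvec x))"
    by (rule Ck_compose[OF _ _ Ck_linear[OF bounded_linear_cvec] *(2)]) auto
  then have "Ck q (ball p \<delta>) (\<phi> j)" using Ck_cong[OF open_ball, of p \<delta> "\<lambda>x. F (cvec x)" "\<phi> j" q] *(3) by blast
  then show "\<exists>V. open V \<and> p \<in> V \<and> Ck q V (\<phi> j)" using *(1) by (intro exI[of _ "ball p \<delta>"]) simp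
qed

text \<open>Each component of a regular function is 0-regular: commute the nablas and replace the
  inner one by means of the neighbouring component. The two nablas then have equal primed indices,
  so the result is symmetric in \<open>A\<close> and \<open>B\<close>.\<close>

lemma regs_zero_regular:
  fixes U :: "'n::finite hspace set"
  assumes U: "open U" and reg: "regs k U \<phi>" and j: "j \<le> k"
    and AB: "A < 2 * CARD('n)" "B < 2 * CARD('n)" and x: "x \<in> U"
  shows "nab A P0 (nab B P1 (\<phi> j)) x = nab B P0 (nab A P1 (\<phi> j)) x"
proof (cases "k = 0")
  case True then show ?thesis using reg j AB x by (simp add: regs_def)
next
  case False
  note comm = cdird_commute[OF U regs_smooth[OF U reg] x]
  show ?thesis
  proof (cases "j < k")
    case True
    have n: "nab C P0 (\<phi> j) y = - nab C P1 (\<phi> (Suc j)) y" if "C < 2 * CARD('n)" "y \<in> U" for C y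
      using regs_pairD[OF reg True that] by (simp add: eq_neg_iff_add_eq_0)
    have e: "nab C P0 (nab D P1 (\<phi> j)) x = - nab D P1 (nab C P1 (\<phi> (Suc j))) x"
      if "C < 2 * CARD('n)" "D < 2 * CARD('n)" for C D
    proof -
      have "nab C P0 (nab D P1 (\<phi> j)) x = nab D P1 (nab C P0 (\<phi> j)) x" by (rule comm[OF j])
      also have "\<dots> = nab D P1 (\<lambda>y. (- 1) * nab C P1 (\<phi> (Suc j)) y) x"
        by (rule cdird_cong_open[OF U x]) (simp add: n that)
      also have "\<dots> = - nab D P1 (nab C P1 (\<phi> (Suc j))) x"
        using Ck_nab[OF U regs_smooth[OF U reg, of "Suc j" 2], of 1] True x
        by (subst cdird_cmult) (auto intro: Ck_differentiable)
      finally show ?thesis .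
    qed
    show ?thesis using True unfolding e[OF AB] e[OF AB(2,1)] by (subst comm) auto
  next
    case F: False
    then obtain i where i: "j = Suc i" "i < k" using j False by (cases j) auto
    have n: "nab C P1 (\<phi> j) y = - nab C P0 (\<phi> i) y" if "C < 2 * CARD('n)" "y \<in> U" for C y
      using regs_pairD[OF reg i(2) that] i by (simp add: eq_neg_iff_add_eq_0 add.commute)
    have e: "nab C P0 (nab D P1 (\<phi> j)) x = - nab C P0 (nab D P0 (\<phi> i)) x"
      if "C < 2 * CARD('n)" "D < 2 * CARD('n)" for C D
    proof -
      have "nab C P0 (nab D P1 (\<phi> j)) x = nab C P0 (\<lambda>y. (- 1) * nab D P0 (\<phi> i) y) x"
        by (rule cdird_cong_open[OF U x]) (simp add: n that)
      also have "\<dots> = - nab C P0 (nab D P0 (\<phi> i)) x"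
        using Ck_nab[OF U regs_smooth[OF U reg, of i 2], of 1] i x
        by (subst cdird_cmult) (auto intro: Ck_differentiable)
      finally show ?thesis .
    qed
    show ?thesis using i unfolding e[OF AB] e[OF AB(2,1)] by (subst comm) auto
  qed
qed

text \<open>The operator \<open>D\<^sub>A\<close>, which maps \<open>k\<close>-regular to \<open>(k+1)\<close>-regular functions; regularity makes its two natural
  formulas for the middle components agree (\<open>raise_eq\<close>).\<close>

definition raise :: "nat \<Rightarrow> (nat \<Rightarrow> 'n::finite hspace \<Rightarrow> complex) \<Rightarrow> nat \<Rightarrow> 'n hspace \<Rightarrow> complex" where
  "raise A \<phi> j = (case j of 0 \<Rightarrow> (\<lambda>x. - nab A P1 (\<phi> 0) x) | Suc i \<Rightarrow> nab A P0 (\<phi> i))"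

lemma raise_Suc [simp]: "raise A \<phi> (Suc j) = nab A P0 (\<phi> j)" by (simp add: raise_def)

lemma raise_eq:
  fixes \<phi> :: "nat \<Rightarrow> 'n::finite hspace \<Rightarrow> complex"
  assumes "regs k U \<phi>" "j \<le> k" "A < 2 * CARD('n)" "x \<in> U"
  shows "raise A \<phi> j x = - nab A P1 (\<phi> j) x"
  using regs_pairD[OF assms(1) _ assms(3,4)] assms(2)
  by (cases j) (auto simp: raise_def eq_neg_iff_add_eq_0)

lemma Ck_raise:
  assumes U: "open U" and reg: "regs k U \<phi>" and j: "j \<le> Suc k"
  shows "Ck q U (raise A \<phi> j)"
proof (cases j)
  case 0
  have "Ck q U (\<lambda>x. 0 - nab A P1 (\<phi> 0) x)"
    by (intro Ck_diff U Ck_const Ck_nab[OF U regs_smooth[OF U reg, of 0 "Suc q"]]) auto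
  then show ?thesis by (simp add: raise_def 0)
next
  case (Suc i)
  then show ?thesis using Ck_nab[OF U regs_smooth[OF U reg, of i "Suc q"], of q] j by simp
qed

text \<open>The equation for the pair (\<open>raise A \<phi> j\<close>,
  \<open>raise A \<phi> (Suc j)\<close>) is the 0-regularity of the single component
  \<open>\<phi> j\<close>, once the first member is rewritten by \<open>raise_eq\<close>.\<close>

lemma regs_raise:
  fixes U :: "'n::finite hspace set"
  assumes U: "open U" and reg: "regs k U \<phi>" and A: "A < 2 * CARD('n)"
  shows "regs (Suc k) U (raise A \<phi>)"
proof -
  have "nab B P0 (raise A \<phi> j) x + nab B P1 (raise A \<phi> (Suc j)) x = 0"
    if j: "j \<le> k" and B: "B < 2 * CARD('n)" and x: "x \<in> U" for j B x
  proof -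
    have "nab B P0 (raise A \<phi> j) x = nab B P0 (\<lambda>y. (- 1) * nab A P1 (\<phi> j) y) x"
      by (rule cdird_cong_open[OF U x]) (simp add: raise_eq[OF reg j A])
    also have "\<dots> = - nab B P0 (nab A P1 (\<phi> j)) x"
      using Ck_nab[OF U regs_smooth[OF U reg j, of 2], of 1] x
      by (subst cdird_cmult) (auto intro: Ck_differentiable)
    also have "\<dots> = - nab A P0 (nab B P1 (\<phi> j)) x"
      using regs_zero_regular[OF U reg j B A x] by simp
    also have "\<dots> = - nab B P1 (nab A P0 (\<phi> j)) x"
      using cdird_commute[OF U regs_smooth[OF U reg j] x] by simp
    finally show ?thesis by simp
  qed
  moreover have "\<forall>j\<le>Suc k. Ck 1 U (raise A \<phi> j)" using Ck_raise[OF U reg] by blast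
  ultimately show ?thesis by (simp add: regs_def less_Suc_eq_le del: Ck.simps One_nat_def)
qed

section \<open>Multiplication operators and the Euler field\<close>

definition Lcomp :: "nat \<Rightarrow> (nat \<Rightarrow> 'n::finite hspace \<Rightarrow> complex) \<Rightarrow> nat \<Rightarrow> 'n hspace \<Rightarrow> complex" where
  "Lcomp B \<phi> j x = zvar B P0 x * \<phi> j x + zvar B P1 x * \<phi> (Suc j) x"

lemma Lop_tens:
  assumes "f x = tens (Suc k) (\<lambda>j. \<phi> j x)"
  shows "Lop B f x = tens k (\<lambda>j. Lcomp B \<phi> j x)"
  by (auto simp: fun_eq_iff Lop_def assms tens_def Lcomp_def)

lemma Ck_Lcomp: "open U \<Longrightarrow> Ck r U (\<phi> j) \<Longrightarrow> Ck r U (\<phi> (Suc j)) \<Longrightarrow> Ck r U (Lcomp B \<phi> j)"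
  unfolding Lcomp_def[abs_def] by (intro Ck_add Ck_mult Ck_zvar)

lemma zlin_nvec_antisym:
  assumes "A < 2 * CARD('n::finite)" "B < 2 * CARD('n)"
  shows "zlin B P1 (nvec A P0 :: complex ^ ('n bit0 bit0)) = - zlin B P0 (nvec A P1 :: complex ^ ('n bit0 bit0))"
  by (simp add: zlin_nvec_10[OF assms] zlin_nvec_01[OF assms])

lemma nab_Lcomp:
  fixes \<phi> :: "nat \<Rightarrow> 'n::finite hspace \<Rightarrow> complex"
  assumes "\<phi> j differentiable (at x)" "\<phi> (Suc j) differentiable (at x)"
  shows "nab A a (Lcomp B \<phi> j) x = zvar B P0 x * nab A a (\<phi> j) x + zlin B P0 (nvec A a :: complex ^ ('n bit0 bit0)) * \<phi> j x
    + (zvar B P1 x * nab A a (\<phi> (Suc j)) x + zlin B P1 (nvec A a :: complex ^ ('n bit0 bit0)) * \<phi> (Suc j) x)"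
  unfolding Lcomp_def[abs_def]
  by (subst cdird_add) (auto intro!: differentiable_mult assms zvar_differentiable simp: cdird_mult assms zvar_differentiable cdird_zvar)

text \<open>The terms in which a nabla hits \<open>z_B\<close> vanish for equal primed indices and
  cancel in the middle component by antisymmetry.\<close>

lemma nab_Lcomp_pair:
  fixes \<phi> :: "nat \<Rightarrow> 'n::finite hspace \<Rightarrow> complex"
  assumes "\<phi> j differentiable (at x)" "\<phi> (Suc j) differentiable (at x)" "\<phi> (Suc (Suc j)) differentiable (at x)"
    and AB: "A < 2 * CARD('n)" "B < 2 * CARD('n)"
  shows "nab A P0 (Lcomp B \<phi> j) x + nab A P1 (Lcomp B \<phi> (Suc j)) x =
    zvar B P0 x * (nab A P0 (\<phi> j) x + nab A P1 (\<phi> (Suc j)) x) +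
    zvar B P1 x * (nab A P0 (\<phi> (Suc j)) x + nab A P1 (\<phi> (Suc (Suc j))) x)"
  by (simp add: nab_Lcomp assms(1-3) zlin_nvec_same[OF AB] zlin_nvec_antisym[OF AB] algebra_simps)

text \<open>For positive \<open>k\<close> the pair identity suffices. For \<open>k = 0\<close> the
  target condition is of second order and has to be checked separately.\<close>

lemma regs_Lcomp:
  fixes U :: "'n::finite hspace set"
  assumes U: "open U" and reg: "regs (Suc k) U \<phi>" and B: "B < 2 * CARD('n)"
  shows "regs k U (Lcomp B \<phi>)"
proof -
  let ?N = "nvec :: nat \<Rightarrow> pindex \<Rightarrow> complex ^ ('n bit0 bit0)"
  have d: "\<phi> j differentiable (at x)" if "j \<le> Suc k" "x \<in> U" for j x
    using regs_smooth[OF U reg that(1), of 1] that by (auto intro: Ck_differentiable)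
  have c: "Ck r U (Lcomp B \<phi> j)" if "j \<le> k" for j r
    using that by (intro Ck_Lcomp U regs_smooth[OF U reg]) auto
  have p: "nab A P0 (\<phi> j) x + nab A P1 (\<phi> (Suc j)) x = 0" if "A < 2 * CARD('n)" "j \<le> k" "x \<in> U" for A j x
    using regs_pairD[OF reg _ that(1,3)] that(2) by simp
  have pair: "nab A P0 (Lcomp B \<phi> j) x + nab A P1 (Lcomp B \<phi> (Suc j)) x = 0"
    if "A < 2 * CARD('n)" "j < k" "x \<in> U" for A j x
    using that by (subst nab_Lcomp_pair) (auto intro: d B simp: p)
  have "nab A P0 (nab C P1 (Lcomp B \<phi> 0)) x = nab C P0 (nab A P1 (Lcomp B \<phi> 0)) x"
    if A: "A < 2 * CARD('n)" and C: "C < 2 * CARD('n)" and x: "x \<in> U" for A C x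
  proof -
    have e: "nab A P0 (nab C P1 (Lcomp B \<phi> 0)) x = zlin B P0 (?N C P1) * nab A P0 (\<phi> 0) x
        + zlin B P0 (?N A P1) * nab C P0 (\<phi> 0) x
        + zvar B P0 x * nab A P0 (nab C P1 (\<phi> 0)) x + zvar B P1 x * nab A P0 (nab C P1 (\<phi> 1)) x"
      if A: "A < 2 * CARD('n)" and C: "C < 2 * CARD('n)" for A C
    proof -
      have d2: "nab C P1 (\<phi> j) differentiable (at x)" if "j \<le> 1" for j
        using Ck_nab[OF U regs_smooth[OF U reg, of j 2], of 1] that x by (auto intro: Ck_differentiable)
      have "nab A P0 (nab C P1 (Lcomp B \<phi> 0)) x =
        nab A P0 (\<lambda>x. zvar B P0 x * nab C P1 (\<phi> 0) x + zlin B P0 (?N C P1) * \<phi> 0 x + zvar B P1 x * nab C P1 (\<phi> 1) x) x"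
        by (rule cdird_cong_open[OF U x]) (simp add: nab_Lcomp d zlin_nvec_same[OF C B])
      also have "\<dots> = zvar B P0 x * nab A P0 (nab C P1 (\<phi> 0)) x + zlin B P0 (?N C P1) * nab A P0 (\<phi> 0) x
        + (zvar B P1 x * nab A P0 (nab C P1 (\<phi> 1)) x + zlin B P1 (?N A P0) * nab C P1 (\<phi> 1) x)"
        by (simp add: cdird_add cdird_mult differentiable_add differentiable_mult zvar_differentiable d2 d x
            cdird_zvar zlin_nvec_same[OF A B])
      \<comment> \<open>Together with antisymmetry this puts the first-order terms into a form
        symmetric in \<open>A\<close> and \<open>C\<close>; the second-order terms are symmetric by
        \<open>regs_zero_regular\<close>.\<close>
      also have "nab C P1 (\<phi> 1) x = - nab C P0 (\<phi> 0) x"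
        using p[OF C _ x, of 0] by (simp add: eq_neg_iff_add_eq_0 add.commute)
      finally show ?thesis by (simp add: zlin_nvec_antisym[OF A B])
    qed
    show ?thesis unfolding e[OF A C] e[OF C A]
      using regs_zero_regular[OF U reg _ A C x, of 0] regs_zero_regular[OF U reg _ A C x, of 1] by simp
  qed
  then show ?thesis using c pair by (simp add: regs_def del: Ck.simps One_nat_def)
qed

section \<open>Dilations in the variable q_0\<close>

definition proj0 :: "'n::finite hspace \<Rightarrow> 'n hspace" where
  "proj0 x = (\<chi> i. if \<exists>r<4. i = qidx 0 r then x $ i else 0)"

definition dilate :: "real \<Rightarrow> 'n::finite hspace \<Rightarrow> 'n hspace" where
  "dilate t x = (x - proj0 x) + t *\<^sub>R proj0 x"

lemma bounded_linear_proj0: "bounded_linear (proj0 :: 'n::finite hspace \<Rightarrow> 'n hspace)"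
proof -
  have "linear (proj0 :: 'n hspace \<Rightarrow> 'n hspace)" by (rule linearI) (auto simp: proj0_def vec_eq_iff)
  then show ?thesis by (simp add: linear_conv_bounded_linear)
qed

lemma bounded_linear_dilate: "bounded_linear (dilate t)"
  unfolding dilate_def[abs_def]
  by (intro bounded_linear_add bounded_linear_sub bounded_linear_ident bounded_linear_proj0
      bounded_linear_compose[OF bounded_linear_scaleR_right bounded_linear_proj0])

lemma dilate_nth: "dilate t x $ i = (if \<exists>r<4. i = qidx 0 r then t * x $ i else x $ i)"
  by (auto simp: dilate_def proj0_def)

lemma dilate_1 [simp]: "dilate 1 x = x" by (simp add: dilate_def)

lemma norm_dilate_le: "0 \<le> t \<Longrightarrow> t \<le> 1 \<Longrightarrow> norm (dilate t x) \<le> norm x"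
  unfolding norm_vec_def
  by (rule L2_set_mono) (auto simp: dilate_nth abs_mult intro!: mult_left_le_one_le)

text \<open>A centre with \<open>proj0 p = 0\<close> is fixed by every dilation, and dilations with
  \<open>t\<close> in the unit interval do not increase norms.\<close>

lemma dilate_in_ball:
  assumes "proj0 p = 0" "x \<in> ball p \<delta>" "t \<in> {0..1}"
  shows "dilate t x \<in> ball p \<delta>"
proof -
  have "dilate t p = p" using assms(1) by (simp add: dilate_def)
  then have "dilate t x - p = dilate t (x - p)"
    by (simp add: linear_diff[OF bounded_linear.linear[OF bounded_linear_dilate]])
  then show ?thesis using norm_dilate_le[of t "x - p"] assms(2,3)
    by (simp add: dist_norm norm_minus_commute[of p])
qed

text \<open>\<open>nvec A a\<close> is supported in the block of one quaternion, which the dilation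
  scales as a whole: by \<open>t\<close> for the block of q_0, by 1 for the others.\<close>

lemma dilate_nvec:
  fixes F :: "'n::finite hspace \<Rightarrow> complex"
  assumes "F differentiable (at (dilate t x))" "A < 2 * CARD('n)"
  shows "nab A a (\<lambda>x. F (dilate t x)) x = (if A < 2 then of_real t else 1) * nab A a F (dilate t x)"
proof -
  note bd = bounded_linear_imp_differentiable[OF bounded_linear_dilate]
  have 1: "nab A a (\<lambda>x. F (dilate t x)) x = dird (dilate t (Revec (nvec A a))) F (dilate t x)
     + \<i> * dird (dilate t (Imvec (nvec A a))) F (dilate t x)"
    by (simp add: cdird_def dird_chain[OF bd assms(1)] dird_linear[OF bounded_linear_dilate])
  have q: "(\<exists>r<4. qidx (A div 2) s = (qidx 0 r :: 'n bit0 bit0)) \<longleftrightarrow> A < 2" if "s < 4" for s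
  proof -
    have "qidx (A div 2) s = (qidx 0 r :: 'n bit0 bit0) \<longleftrightarrow> A div 2 = 0 \<and> s = r" if "r < 4" for r
      using qidx_eq_iff[of "A div 2" 0 s r, where 'n='n] assms(2) that \<open>s < 4\<close> by simp
    then have "(\<exists>r<4. qidx (A div 2) s = (qidx 0 r :: 'n bit0 bit0)) \<longleftrightarrow> A div 2 = 0" using that by metis
    then show ?thesis by auto
  qed
  have "dilate t (Revec (nvec A a :: complex ^ ('n bit0 bit0))) = (if A < 2 then t else 1) *\<^sub>R Revec (nvec A a)"
    "dilate t (Imvec (nvec A a :: complex ^ ('n bit0 bit0))) = (if A < 2 then t else 1) *\<^sub>R Imvec (nvec A a)"
    using q[of 0] q[of 1] q[of 2] q[of 3]
    by (auto simp: vec_eq_iff dilate_nth Revec_def Imvec_def nvec_def Let_def axis_def split: pindex.split)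
  then show ?thesis unfolding 1
    by (simp add: cdird_def linear_scale[OF linear_dird[OF assms(1)]] scaleR_conv_of_real[where 'a=complex] algebra_simps)
qed

text \<open>The coefficients are taken at \<open>x\<close> and the derivatives at \<open>y\<close>.
  With \<open>y\<close> on the ray of \<open>x\<close> this gives a radial derivative without
  rescaling, and with \<open>x = y\<close> the Euler field itself.\<close>

lemma euler_identity:
  fixes F :: "'n::finite hspace \<Rightarrow> complex"
  assumes "F differentiable (at y)"
  shows "- zvar 0 P0 x * nab 1 P1 F y + zvar 0 P1 x * nab 1 P0 F y + zvar 1 P0 x * nab 0 P1 F y - zvar 1 P1 x * nab 0 P0 F y
    = 2 * dird (proj0 x) F y"
proof -
  have p: "proj0 x = (\<Sum>r<4. (x $ qidx 0 r) *\<^sub>R axis (qidx 0 r) 1)"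
  proof (simp only: vec_eq_iff, intro allI)
    fix i :: "'n bit0 bit0"
    have q: "qidx 0 r = (qidx 0 s :: 'n bit0 bit0) \<longleftrightarrow> r = s" if "r < 4" "s < 4" for r s
      using qidx_eq_iff[of 0 0 r s, where 'n='n] that by simp
    show "proj0 x $ i = (\<Sum>r<4. (x $ qidx 0 r) *\<^sub>R axis (qidx 0 r) 1) $ i"
    proof (cases "\<exists>r<4. i = qidx 0 r")
      case True
      then obtain s where s: "s < 4" "i = qidx 0 s" by blast
      have "(\<Sum>r<4. (x $ qidx 0 r) *\<^sub>R axis (qidx 0 r) 1) $ i = (\<Sum>r<4. if r = s then x $ i else 0)"
        unfolding sum_component by (intro sum.cong) (use s in \<open>auto simp: axis_def q\<close>)
      then show ?thesis using s by (auto simp: proj0_def)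
    next
      case False
      then show ?thesis by (auto simp: proj0_def axis_def intro!: sum.neutral[symmetric])
    qed
  qed
  have D: "dird (proj0 x) F y = (\<Sum>r<4. of_real (x $ qidx 0 r) * dird (axis (qidx 0 r) 1) F y)"
    unfolding p linear_sum[OF linear_dird[OF assms]]
    by (simp add: linear_scale[OF linear_dird[OF assms]] scaleR_conv_of_real[where 'a=complex])
  show ?thesis unfolding D
    by (simp add: zvar_eq zlin_def nvec_def Let_def cdird_add_dir cdird_axis assms numeral_eq_Suc algebra_simps)
qed

lemma zvar_dilate:
  fixes x :: "'n::finite hspace"
  assumes "A < 2" shows "zvar A a (dilate t x) = of_real t * zvar A a x"
proof -
  have A: "A div 2 = 0" using assms by simp
  have "dilate t x $ qidx 0 r = t * x $ qidx 0 r" if "r < 4" for r using that by (auto simp: dilate_nth)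
  then show ?thesis by (auto simp: zvar_eq zlin_def Let_def A algebra_simps split: pindex.split)
qed

text \<open>Weight exponent 0 serves for surjectivity; exponent 1 serves for the kernel, where the
  homogeneity of \<open>zvar\<close> has to absorb one factor \<open>t\<close>.\<close>

definition avg :: "nat \<Rightarrow> ('n::finite hspace \<Rightarrow> complex) \<Rightarrow> 'n hspace \<Rightarrow> complex" where
  "avg m G x = integral (cbox 0 1) (\<lambda>t. of_real t ^ m * G (dilate t x))"

lemma parCk_dilate:
  fixes p :: "'n::finite hspace" and G :: "'n hspace \<Rightarrow> complex"
  assumes p: "proj0 p = 0" and G: "Ck r (ball p \<delta>) G"
  shows "parCk r (ball p \<delta>) (cbox 0 1) (\<lambda>x t. of_real t ^ m * G (dilate t x))"
proof -
  have d: "Ck r UNIV (\<lambda>q. (fst q - proj0 (fst q)) + snd q *\<^sub>R proj0 (fst q) :: 'n hspace)" for r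
    by (intro Ck_add Ck_diff Ck_scaleR Ck_linear open_UNIV bounded_linear_fst bounded_linear_snd
        bounded_linear_compose[OF bounded_linear_proj0 bounded_linear_fst])
  define W :: "('n hspace \<times> real) set" where "W = (\<lambda>q. dilate (snd q) (fst q)) -` ball p \<delta>"
  have W: "open W" unfolding W_def dilate_def
    using Ck_continuous[OF d[of 0]] by (intro open_vimage open_ball)
  have "Ck r W (\<lambda>q. of_real (snd q) ^ m * G (dilate (snd q) (fst q)))"
  proof (rule Ck_mult[OF W Ck_power[OF W]])
    show "Ck r W (\<lambda>q. complex_of_real (snd q))"
      by (rule Ck_linear[OF bounded_linear_compose[OF bounded_linear_of_real bounded_linear_snd]])
    show "Ck r W (\<lambda>q. G (dilate (snd q) (fst q)))"
      by (rule Ck_compose[OF W open_ball Ck_subset[OF d[folded dilate_def] subset_UNIV] G]) (auto simp: W_def)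
  qed
  moreover have "ball p \<delta> \<times> cbox 0 1 \<subseteq> W" using dilate_in_ball[OF p] by (auto simp: W_def simp del: mem_ball)
  ultimately show ?thesis using parCk_of_Ck[OF open_ball, of r W _ p \<delta> "cbox 0 1"] by fastforce
qed

lemma Ck_avg:
  "proj0 p = 0 \<Longrightarrow> Ck r (ball p \<delta>) G \<Longrightarrow> Ck r (ball p \<delta>) (avg m G)"
  unfolding avg_def[abs_def] by (rule Ck_parametric_integral[OF open_ball parCk_dilate])

lemma nab_avg:
  fixes p :: "'n::finite hspace"
  assumes p: "proj0 p = 0" and G: "Ck 1 (ball p \<delta>) G" and x: "x \<in> ball p \<delta>" and A: "A < 2 * CARD('n)"
  shows "nab A a (avg m G) x = integral (cbox 0 1) (\<lambda>t. of_real t ^ m * ((if A < 2 then of_real t else 1) * nab A a G (dilate t x)))"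
proof -
  have par: "parCk (Suc 0) (ball p \<delta>) (cbox 0 1) (\<lambda>x t. of_real t ^ m * G (dilate t x))"
    using parCk_dilate[OF p G] by simp
  have Gd: "G differentiable (at (dilate t x))" if "t \<in> {0..1}" for t
    using dilate_in_ball[OF p x that] G by (auto intro: Ck_differentiable)
  have gd: "(\<lambda>x. G (dilate t x)) differentiable (at x)" if "t \<in> {0..1}" for t
    using differentiable_chain_at[OF bounded_linear_imp_differentiable[OF bounded_linear_dilate] Gd[OF that]]
    by (simp add: o_def)
  have "nab A a (avg m G) x = integral (cbox 0 1) (\<lambda>t. nab A a (\<lambda>x. of_real t ^ m * G (dilate t x)) x)"
    unfolding avg_def[abs_def] by (rule cdird_parametric_integral[OF open_ball par x])
  also have "\<dots> = integral (cbox 0 1) (\<lambda>t. of_real t ^ m * ((if A < 2 then of_real t else 1) * nab A a G (dilate t x)))"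
    using Gd gd A by (intro integral_cong) (simp add: cdird_cmult dilate_nvec)
  finally show ?thesis .
qed

text \<open>The chain-rule factor depends on \<open>A\<close> but not on the primed index, so both
  terms of a regularity equation acquire the same weight.\<close>

lemma regs_avg:
  fixes p :: "'n::finite hspace"
  assumes p: "proj0 p = 0" and reg: "regs (Suc k) (ball p \<delta>) \<phi>"
  shows "regs (Suc k) (ball p \<delta>) (\<lambda>j. avg m (\<phi> j))"
proof -
  have c: "Ck 1 (ball p \<delta>) (\<phi> j)" if "j \<le> Suc k" for j by (rule regs_Ck1[OF reg that])
  have "nab A P0 (avg m (\<phi> j)) x + nab A P1 (avg m (\<phi> (Suc j))) x = 0"
    if A: "A < 2 * CARD('n)" and j: "j < Suc k" and x: "x \<in> ball p \<delta>" for A j x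
  proof -
    have "nab A P0 (avg m (\<phi> j)) x = integral (cbox 0 1) (\<lambda>t. - (of_real t ^ m * ((if A < 2 then of_real t else 1) * nab A P1 (\<phi> (Suc j)) (dilate t x))))"
      unfolding nab_avg[OF p c[OF less_imp_le[OF j]] x A]
      using regs_pairD[OF reg j A] dilate_in_ball[OF p x]
      by (intro integral_cong) (auto simp: eq_neg_iff_add_eq_0 simp del: mem_ball simp flip: distrib_left)
    then show ?thesis using c j by (simp add: nab_avg[OF p _ x A] del: One_nat_def Ck.simps)
  qed
  then show ?thesis using Ck_avg[OF p c] by (simp add: regs_def del: One_nat_def Ck.simps)
qed

lemma regs_add_scale:
  fixes U :: "'n::finite hspace set"
  assumes U: "open U" and f: "regs (Suc k) U f" and g: "regs (Suc k) U g"
  shows "regs (Suc k) U (\<lambda>j x. c * f j x + d * g j x)"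
proof -
  have F: "Ck 1 U (f j)" "Ck 1 U (g j)" if "j \<le> Suc k" for j using regs_Ck1[OF f that] regs_Ck1[OF g that] .
  have D: "f j differentiable (at x)" "g j differentiable (at x)" if "j \<le> Suc k" "x \<in> U" for j x
    using F[OF that(1)] that(2) by (auto intro: Ck_differentiable)
  have "nab A P0 (\<lambda>x. c * f j x + d * g j x) x + nab A P1 (\<lambda>x. c * f (Suc j) x + d * g (Suc j) x) x = 0"
    if "A < 2 * CARD('n)" "j < Suc k" "x \<in> U" for A j x
  proof -
    have "nab A P0 (\<lambda>x. c * f j x + d * g j x) x + nab A P1 (\<lambda>x. c * f (Suc j) x + d * g (Suc j) x) x
      = c * (nab A P0 (f j) x + nab A P1 (f (Suc j)) x) + d * (nab A P0 (g j) x + nab A P1 (g (Suc j)) x)"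
      using that by (simp add: cdird_add cdird_mult D differentiable_mult algebra_simps)
    then show ?thesis using regs_pairD[OF f that(2,1,3)] regs_pairD[OF g that(2,1,3)] by simp
  qed
  moreover have "Ck 1 U (\<lambda>x. c * f j x + d * g j x)" if "j \<le> Suc k" for j
    by (intro Ck_add Ck_mult Ck_const U F that)
  ultimately show ?thesis by (simp add: regs_def del: One_nat_def Ck.simps)
qed

lemma less_twice_card: "0 < 2 * CARD('n::finite)" "1 < 2 * CARD('n::finite)" "Suc 0 < 2 * CARD('n::finite)"
  using zero_less_card_finite[where 'a='n] by (simp_all del: zero_less_card_finite)

lemma dilate_line: "dilate t x = (x - proj0 x) + t *\<^sub>R proj0 x"
  by (simp add: dilate_def)

lemma proj0_dilate: "proj0 (dilate t x) = t *\<^sub>R proj0 x"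
  by (auto simp: proj0_def vec_eq_iff dilate_nth)

text \<open>Along the ray through a point, the Euler identity turns
  \<open>L\<^sub>0 D\<^sub>1 F - L\<^sub>1 D\<^sub>0 F\<close> into twice the radial derivative of \<open>F\<close>.\<close>

lemma surjective_near_X:
  fixes p :: "'n::finite hspace"
  assumes p: "proj0 p = 0" and reg: "regs k (ball p \<delta>) F"
    and zero: "\<And>x j. x \<in> ball p \<delta> \<Longrightarrow> proj0 x = 0 \<Longrightarrow> j \<le> k \<Longrightarrow> F j x = 0"
  obtains f g where "regs (Suc k) (ball p \<delta>) f" "regs (Suc k) (ball p \<delta>) g"
    "\<And>x j. x \<in> ball p \<delta> \<Longrightarrow> j \<le> k \<Longrightarrow> Lcomp 0 f j x + Lcomp 1 g j x = F j x"
proof -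
  let ?B = "ball p \<delta>"
  have r: "regs (Suc k) ?B (raise 1 F)" "regs (Suc k) ?B (raise 0 F)"
    by (rule regs_raise[OF open_ball reg]; rule less_twice_card)+
  \<comment> \<open>The summand with coefficient 0 only brings the family into the form of
    \<open>regs_add_scale\<close>.\<close>
  define f where "f = (\<lambda>j x. 1 / 2 * avg 0 (raise 1 F j) x + 0 * avg 0 (raise 1 F j) x)"
  define g where "g = (\<lambda>j x. - 1 / 2 * avg 0 (raise 0 F j) x + 0 * avg 0 (raise 0 F j) x)"
  have fr: "regs (Suc k) ?B f" "regs (Suc k) ?B g"
    unfolding f_def g_def by (intro regs_add_scale open_ball regs_avg[OF p] r)+
  have "Lcomp 0 f j x + Lcomp 1 g j x = F j x" if x: "x \<in> ball p \<delta>" and j: "j \<le> k" for x j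
  proof -
    have in_B: "dilate t x \<in> ?B" if "t \<in> {0..1}" for t by (rule dilate_in_ball[OF p x that])
    have Fd: "F j differentiable (at y)" if "y \<in> ?B" for y
      by (rule Ck_differentiable[OF regs_Ck1[OF reg j] _ that]) simp
    have i: "((\<lambda>t. raise A F m (dilate t x)) has_integral avg 0 (raise A F m) x) (cbox 0 1)"
      if m: "m \<le> Suc k" for A m
    proof -
      have "Ck 0 ?B (raise A F m)" by (rule Ck_raise[OF open_ball reg m])
      then have "continuous_on (cbox 0 1) (\<lambda>t. of_real t ^ 0 * raise A F m (dilate t x))"
        by (rule parCk_slice[OF parCk_dilate[OF p] x])
      from integrable_integral[OF integrable_continuous[OF this]] show ?thesis unfolding avg_def by simp
    qed
    have "((\<lambda>t. zvar 0 P0 x * (1 / 2 * raise 1 F j (dilate t x)) + zvar 0 P1 x * (1 / 2 * raise 1 F (Suc j) (dilate t x))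
      + (zvar 1 P0 x * (- 1 / 2 * raise 0 F j (dilate t x)) + zvar 1 P1 x * (- 1 / 2 * raise 0 F (Suc j) (dilate t x))))
      has_integral (Lcomp 0 f j x + Lcomp 1 g j x)) (cbox 0 1)"
      unfolding Lcomp_def f_def g_def mult_zero_left add_0_right
      using j by (intro has_integral_add has_integral_mult_right i) auto
    then have "((\<lambda>t. dird (proj0 x) (F j) (dilate t x)) has_integral (Lcomp 0 f j x + Lcomp 1 g j x)) (cbox 0 1)"
    proof (rule has_integral_eq[rotated])
      fix t :: real assume "t \<in> cbox 0 1"
      then have t: "dilate t x \<in> ?B" using in_B by simp
      show "zvar 0 P0 x * (1 / 2 * raise 1 F j (dilate t x)) + zvar 0 P1 x * (1 / 2 * raise 1 F (Suc j) (dilate t x))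
        + (zvar 1 P0 x * (- 1 / 2 * raise 0 F j (dilate t x)) + zvar 1 P1 x * (- 1 / 2 * raise 0 F (Suc j) (dilate t x)))
        = dird (proj0 x) (F j) (dilate t x)"
      proof -
        have half: "a * (1 / 2 * - x) + b * (1 / 2 * y) + (c * (- 1 / 2 * - z) + d * (- 1 / 2 * w)) = D"
          if "- a * x + b * y + c * z - d * w = 2 * D" for a b c d x y z w D :: complex
        proof -
          have "a * (1 / 2 * - x) + b * (1 / 2 * y) + (c * (- 1 / 2 * - z) + d * (- 1 / 2 * w))
            = 1 / 2 * (- a * x + b * y + c * z - d * w)" by (simp add: algebra_simps)
          then show ?thesis unfolding that by simp
        qed
        show ?thesis
          unfolding raise_Suc raise_eq[OF reg j less_twice_card(1) t] raise_eq[OF reg j less_twice_card(2) t]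
          by (rule half[OF euler_identity[OF Fd[OF t]]])
      qed
    qed
    moreover have "((\<lambda>t. dird (proj0 x) (F j) (dilate t x)) has_integral (F j (dilate 1 x) - F j (dilate 0 x))) {0..1}"
      by (rule fundamental_theorem_of_calculus)
        (use in_B Fd in \<open>auto intro!: has_vector_derivative_at_within has_vector_derivative_line simp: dilate_line simp del: mem_ball\<close>)
    \<comment> \<open>The ray starts on X; here the vanishing of the given section on X
      enters.\<close>
    moreover have "F j (dilate 0 x) = 0"
      using zero[OF in_B[of 0] _ j] by (simp add: proj0_dilate)
    ultimately show ?thesis by (auto dest: has_integral_unique)
  qed
  with fr show ?thesis by (rule that)
qed

text \<open>Differentiate the relation along a nabla of index \<open>A\<close>. The terms in which
  \<open>z_0\<close> or \<open>z_1\<close> is differentiated leave \<open>2 g\<close> or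
  \<open>- 2 f\<close>, and the regularity of \<open>f\<close> and \<open>g\<close> brings the
  remaining terms to components of the same index \<open>j\<close>.\<close>

lemma zvar_sum_zero_derivative:
  fixes f g :: "nat \<Rightarrow> 'n::finite hspace \<Rightarrow> complex"
  assumes U: "open U" and f: "regs (Suc k) U f" and g: "regs (Suc k) U g"
    and eq: "\<And>x j. x \<in> U \<Longrightarrow> j \<le> k \<Longrightarrow> Lcomp 0 f j x + Lcomp 1 g j x = 0"
    and x: "x \<in> U" and j: "j \<le> Suc k" and A: "A < 2"
  shows "zvar 0 P1 x * nab A P0 (f j) x - zvar 0 P0 x * nab A P1 (f j) x
    + zvar 1 P1 x * nab A P0 (g j) x - zvar 1 P0 x * nab A P1 (g j) x
    = (if A = 0 then 2 * g j x else - 2 * f j x)"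
proof -
  have fd: "f i differentiable (at x)" "g i differentiable (at x)" if "i \<le> Suc k" for i
    using Ck_differentiable[OF regs_Ck1[OF f that] _ x] Ck_differentiable[OF regs_Ck1[OF g that] _ x] by auto
  have A': "A < 2 * CARD('n)" using A less_twice_card[where 'n='n] by linarith
  have 0: "nab A a (Lcomp 0 f i) x + nab A a (Lcomp 1 g i) x = 0" if "i \<le> k" for a i
  proof -
    have "Lcomp 0 f i differentiable (at x)" "Lcomp 1 g i differentiable (at x)"
      using that by (auto intro!: Ck_differentiable[OF Ck_Lcomp[OF U], of 1] regs_smooth[OF U f] regs_smooth[OF U g] x simp del: Ck.simps One_nat_def)
    then have "nab A a (Lcomp 0 f i) x + nab A a (Lcomp 1 g i) x = nab A a (\<lambda>x. Lcomp 0 f i x + Lcomp 1 g i x) x"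
      by (simp add: cdird_add)
    also have "\<dots> = nab A a (\<lambda>_. 0) x" by (rule cdird_cong_open[OF U x]) (rule eq[OF _ that])
    finally show ?thesis by simp
  qed
  have fp: "nab A P1 (f (Suc i)) x = - nab A P0 (f i) x" "nab A P1 (g (Suc i)) x = - nab A P0 (g i) x" if "i \<le> k" for i
    using regs_pairD[OF f _ A' x] regs_pairD[OF g _ A' x] that by (simp_all add: eq_neg_iff_add_eq_0 add.commute)
  note z = zlin_nvec_same[OF A' less_twice_card(1)] zlin_nvec_same[OF A' less_twice_card(2)]
    zlin_nvec_10[OF A' less_twice_card(1)] zlin_nvec_10[OF A' less_twice_card(2)]
    zlin_nvec_01[OF A' less_twice_card(1)] zlin_nvec_01[OF A' less_twice_card(2)]
  have A01: "A = 0 \<or> A = 1" using A by auto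
  show ?thesis
  proof (cases "j \<le> k")
    case True
    have "nab A P1 (Lcomp 0 f j) x + nab A P1 (Lcomp 1 g j) x = 0" by (rule 0[OF True])
    then show ?thesis using A01 True
      unfolding nab_Lcomp[of f j, OF fd(1) fd(1)[OF Suc_le_mono[THEN iffD2, OF True]], OF le_SucI[OF True]]
        nab_Lcomp[of g j, OF fd(2) fd(2)[OF Suc_le_mono[THEN iffD2, OF True]], OF le_SucI[OF True]]
        fp[OF True] z
      by (elim disjE; hypsubst) (simp_all add: partner_def algebra_simps)
  next
    case False
    \<comment> \<open>The relation has no component \<open>Suc k\<close>; differentiating component
      \<open>k\<close> along \<open>P0\<close> instead of \<open>P1\<close> reaches
      \<open>f j\<close> and \<open>g j\<close>.\<close>
    then have j': "j = Suc k" using j by simp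
    have "nab A P0 (Lcomp 0 f k) x + nab A P0 (Lcomp 1 g k) x = 0" by (rule 0) simp
    then have c: "zvar 0 P0 x * nab A P0 (f k) x + zvar 0 P1 x * nab A P0 (f j) x
      + zvar 1 P0 x * nab A P0 (g k) x + zvar 1 P1 x * nab A P0 (g j) x
      = (if A = 0 then 2 * g j x else - 2 * f j x)"
      using A01 unfolding j' nab_Lcomp[of f k, OF fd(1) fd(1), OF le_SucI[OF order_refl] order_refl]
        nab_Lcomp[of g k, OF fd(2) fd(2), OF le_SucI[OF order_refl] order_refl] z
      by (elim disjE; hypsubst) (simp_all add: partner_def algebra_simps add_eq_0_iff)
    show ?thesis unfolding c[symmetric] using fp[OF order_refl] unfolding j' by algebra
  qed
qed

text \<open>Let \<open>G\<close> be \<open>g j\<close> for \<open>A = 0\<close> and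
  \<open>- f j\<close> for \<open>A = 1\<close>. The Euler identity and the differentiated relation
  combine to: component \<open>j\<close> of \<open>L_A h0\<close> is the Euler derivative of
  \<open>G\<close> plus \<open>G\<close>. Along a ray this is the derivative of \<open>t G\<close>,
  whose boundary term at 0 vanishes because of the factor \<open>t\<close>.\<close>

lemma exact_near_X:
  fixes p :: "'n::finite hspace"
  assumes p: "proj0 p = 0" and f: "regs (Suc k) (ball p \<delta>) f" and g: "regs (Suc k) (ball p \<delta>) g"
    and eq: "\<And>x j. x \<in> ball p \<delta> \<Longrightarrow> j \<le> k \<Longrightarrow> Lcomp 0 f j x + Lcomp 1 g j x = 0"
  obtains h where "regs (Suc (Suc k)) (ball p \<delta>) h"
    "\<And>x j. x \<in> ball p \<delta> \<Longrightarrow> j \<le> Suc k \<Longrightarrow> Lcomp 0 h j x = g j x"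
    "\<And>x j. x \<in> ball p \<delta> \<Longrightarrow> j \<le> Suc k \<Longrightarrow> Lcomp 1 h j x = - f j x"
proof -
  let ?B = "ball p \<delta>"
  define h0 where "h0 = (\<lambda>j x. 1 / 2 * raise 1 g j x + 1 / 2 * raise 0 f j x)"
  have h0: "regs (Suc (Suc k)) ?B h0"
    unfolding h0_def by (intro regs_add_scale open_ball regs_raise f g less_twice_card)
  define h where "h = (\<lambda>j. avg 1 (h0 j))"
  have h: "regs (Suc (Suc k)) ?B h" unfolding h_def by (rule regs_avg[OF p h0])
  have main: "Lcomp A h j x = (if A = 0 then g j x else - f j x)"
    if A: "A < 2" and x: "x \<in> ?B" and j: "j \<le> Suc k" for A x j
  proof -
    define G where "G = (if A = 0 then g j else (\<lambda>x. - f j x))"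
    have in_B: "dilate t x \<in> ?B" if "t \<in> {0..1}" for t by (rule dilate_in_ball[OF p x that])
    have fd: "f j differentiable (at y)" "g j differentiable (at y)" if "y \<in> ?B" for y
      using Ck_differentiable[OF regs_Ck1[OF f j] _ that] Ck_differentiable[OF regs_Ck1[OF g j] _ that] by auto
    have Gd: "G differentiable (at y)" if "y \<in> ?B" for y
      using fd[OF that] by (auto simp: G_def)
    have dG: "dird v G y = (if A = 0 then dird v (g j) y else - dird v (f j) y)" if "y \<in> ?B" for v y
      using dird_mult[of "\<lambda>_. - 1" y "f j" v] fd[OF that] by (simp add: G_def)
    have i: "((\<lambda>t. of_real t * h0 m (dilate t x)) has_integral h m x) (cbox 0 1)" if m: "m \<le> Suc (Suc k)" for m
    proof -
      have "Ck 0 ?B (h0 m)" by (rule regs_smooth[OF open_ball h0 m])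
      then have "continuous_on (cbox 0 1) (\<lambda>t. of_real t ^ 1 * h0 m (dilate t x))"
        by (rule parCk_slice[OF parCk_dilate[OF p] x])
      from integrable_integral[OF integrable_continuous[OF this]] show ?thesis unfolding h_def avg_def by simp
    qed
    have "((\<lambda>t. zvar A P0 x * (of_real t * h0 j (dilate t x)) + zvar A P1 x * (of_real t * h0 (Suc j) (dilate t x)))
      has_integral Lcomp A h j x) (cbox 0 1)"
      unfolding Lcomp_def using j by (intro has_integral_add has_integral_mult_right i) auto
    then have "((\<lambda>t. t *\<^sub>R dird (proj0 x) G (dilate t x) + G (dilate t x)) has_integral Lcomp A h j x) (cbox 0 1)"
    proof (rule has_integral_eq[rotated])
      fix t :: real assume "t \<in> cbox 0 1"
      then have t: "dilate t x \<in> ?B" using in_B by simp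
      define y where "y = dilate t x"
      have y: "y \<in> ?B" using t by (simp add: y_def)
      have pr: "dird (proj0 y) F y = t *\<^sub>R dird (proj0 x) F y" if "F differentiable (at y)" for F :: "'n hspace \<Rightarrow> complex"
        by (simp add: y_def proj0_dilate linear_scale[OF linear_dird[OF that, unfolded y_def]])
      have r: "h0 j y = - 1 / 2 * nab 1 P1 (g j) y - 1 / 2 * nab 0 P1 (f j) y"
        "h0 (Suc j) y = 1 / 2 * nab 1 P0 (g j) y + 1 / 2 * nab 0 P0 (f j) y"
        using raise_eq[OF g j less_twice_card(2) y] raise_eq[OF f j less_twice_card(1) y] by (simp_all add: h0_def)
      \<comment> \<open>The weight \<open>t\<close> moves the coefficients from \<open>x\<close> to
        the point of the ray, where the derivatives are taken.\<close>
      have "zvar A P0 x * (of_real t * h0 j y) + zvar A P1 x * (of_real t * h0 (Suc j) y)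
        = zvar A P0 y * h0 j y + zvar A P1 y * h0 (Suc j) y"
        by (simp add: y_def zvar_dilate[OF A] mult_ac)
      also have "\<dots> = (if A = 0 then dird (proj0 y) (g j) y + g j y else - dird (proj0 y) (f j) y - f j y)"
      proof -
        note e = euler_identity[OF fd(1)[OF y], of y] euler_identity[OF fd(2)[OF y], of y]
        note c = zvar_sum_zero_derivative[OF open_ball f g eq y j A]
        have half: "a * (- 1 / 2 * x - 1 / 2 * x') + b * (1 / 2 * w + 1 / 2 * w') = s"
          if "b * w - a * x + b * w' - a * x' = 2 * s" for a b x x' w w' s :: complex
        proof -
          have "a * (- 1 / 2 * x - 1 / 2 * x') + b * (1 / 2 * w + 1 / 2 * w')
            = 1 / 2 * (b * w - a * x + b * w' - a * x')" by (simp add: algebra_simps)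
          then show ?thesis unfolding that by simp
        qed
        have "A = 0 \<or> A = 1" using A by auto
        then show ?thesis
        proof
          assume A0: "A = 0"
          have "zvar 0 P1 y * nab 1 P0 (g j) y - zvar 0 P0 y * nab 1 P1 (g j) y
            + zvar 0 P1 y * nab 0 P0 (f j) y - zvar 0 P0 y * nab 0 P1 (f j) y
            = 2 * (dird (proj0 y) (g j) y + g j y)"
            using e(2) c[unfolded A0 if_P[OF refl]] by algebra
          from half[OF this] show ?thesis unfolding r A0 by simp
        next
          assume A1: "A = 1"
          have "zvar 1 P1 y * nab 1 P0 (g j) y - zvar 1 P0 y * nab 1 P1 (g j) y
            + zvar 1 P1 y * nab 0 P0 (f j) y - zvar 1 P0 y * nab 0 P1 (f j) y
            = 2 * (- dird (proj0 y) (f j) y - f j y)"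
            using e(1) c[unfolded A1 if_not_P[OF one_neq_zero]] by algebra
          from half[OF this] show ?thesis unfolding r A1 by simp
        qed
      qed
      also have "\<dots> = t *\<^sub>R dird (proj0 x) G y + G y"
        using dG[OF y, of "proj0 x"] pr[OF fd(1)[OF y]] pr[OF fd(2)[OF y]]
        by (cases "A = 0") (simp_all add: G_def)
      finally show "zvar A P0 x * (of_real t * h0 j (dilate t x)) + zvar A P1 x * (of_real t * h0 (Suc j) (dilate t x))
        = t *\<^sub>R dird (proj0 x) G (dilate t x) + G (dilate t x)" by (simp only: y_def)
    qed
    moreover have "((\<lambda>t. t *\<^sub>R dird (proj0 x) G (dilate t x) + G (dilate t x)) has_integral
       (1 *\<^sub>R G (dilate 1 x) - 0 *\<^sub>R G (dilate 0 x))) {0..1}"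
    proof (rule fundamental_theorem_of_calculus)
      fix t :: real assume t: "t \<in> {0..1}"
      have "((\<lambda>t. G (dilate t x)) has_vector_derivative dird (proj0 x) G (dilate t x)) (at t)"
        unfolding dilate_line by (rule has_vector_derivative_line) (use Gd in_B[OF t] in \<open>simp add: dilate_line\<close>)
      then have "((\<lambda>t. t *\<^sub>R G (dilate t x)) has_vector_derivative
          (t *\<^sub>R dird (proj0 x) G (dilate t x) + 1 *\<^sub>R G (dilate t x))) (at t)"
        by (intro has_vector_derivative_scaleR) (auto intro: derivative_eq_intros)
      then show "((\<lambda>t. t *\<^sub>R G (dilate t x)) has_vector_derivative
          (t *\<^sub>R dird (proj0 x) G (dilate t x) + G (dilate t x))) (at t within {0..1})"
        by (simp add: has_vector_derivative_at_within)
    qed simp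
    ultimately have "Lcomp A h j x = G x" by (auto dest: has_integral_unique)
    then show ?thesis by (simp add: G_def)
  qed
  show ?thesis by (rule that[OF h]) (use main[of 0] main[of 1] in auto)
qed

section \<open>The kernel of the second map off X\<close>

definition zdet :: "'n::finite hspace \<Rightarrow> complex" where
  "zdet x = zvar 0 P0 x * zvar 1 P1 x - zvar 0 P1 x * zvar 1 P0 x"

text \<open>The determinant of the rows by which \<open>L_0\<close> and \<open>L_1\<close> act is
  the squared norm of q_0, so the two multiplications can be inverted together exactly off
  X.\<close>

lemma zdet_eq: "zdet x = of_real ((x $ qidx 0 0)\<^sup>2 + (x $ qidx 0 1)\<^sup>2 + (x $ qidx 0 2)\<^sup>2 + (x $ qidx 0 3)\<^sup>2)"
  by (simp add: zdet_def zvar_eq zlin_def Let_def complex_eq_iff power2_eq_square algebra_simps)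

lemma proj0_eq_0_iff: "proj0 x = 0 \<longleftrightarrow> (\<forall>r<4. x $ qidx 0 r = 0)"
  by (auto simp: proj0_def vec_eq_iff)

lemma zdet_eq_0_iff: "zdet x = 0 \<longleftrightarrow> proj0 x = 0"
proof -
  have "zdet x = 0 \<longleftrightarrow> x $ qidx 0 0 = 0 \<and> x $ qidx 0 1 = 0 \<and> x $ qidx 0 2 = 0 \<and> x $ qidx 0 3 = 0"
    unfolding zdet_eq of_real_eq_0_iff by (auto simp: add_nonneg_eq_0_iff)
  also have "\<dots> \<longleftrightarrow> proj0 x = 0"
    unfolding proj0_eq_0_iff by (auto simp: numeral_eq_Suc less_Suc_eq)
  finally show ?thesis .
qed

text \<open>Cramer's rule for each pair of consecutive components of \<open>h\<close>. An inner
  component receives two formulas, from the pair before and the pair after it; they agree because of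
  the relation between \<open>f\<close> and \<open>g\<close>.\<close>

lemma exact_off_X:
  fixes U :: "'n::finite hspace set"
  assumes U: "open U" and off: "\<And>x. x \<in> U \<Longrightarrow> proj0 x \<noteq> 0"
    and f: "regs (Suc k) U f" and g: "regs (Suc k) U g"
    and eq: "\<And>x j. x \<in> U \<Longrightarrow> j \<le> k \<Longrightarrow> Lcomp 0 f j x + Lcomp 1 g j x = 0"
  obtains h where "regs (Suc (Suc k)) U h"
    "\<And>x j. x \<in> U \<Longrightarrow> j \<le> Suc k \<Longrightarrow> Lcomp 0 h j x = g j x"
    "\<And>x j. x \<in> U \<Longrightarrow> j \<le> Suc k \<Longrightarrow> Lcomp 1 h j x = - f j x"
proof -
  \<comment> \<open>Only the last component, of index \<open>k + 2\<close>, is not the first member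
    of a pair and needs the second Cramer formula.\<close>
  define h where "h = (\<lambda>j x. if j \<le> Suc k then (zvar 0 P1 x * f j x + zvar 1 P1 x * g j x) * inverse (zdet x)
    else - (zvar 0 P0 x * f (Suc k) x + zvar 1 P0 x * g (Suc k) x) * inverse (zdet x))"
  have nz: "zdet x \<noteq> 0" if "x \<in> U" for x using off[OF that] by (simp add: zdet_eq_0_iff)
  have h_Suc: "h (Suc j) x = - (zvar 0 P0 x * f j x + zvar 1 P0 x * g j x) * inverse (zdet x)"
    if x: "x \<in> U" and j: "j \<le> Suc k" for x j
  proof (cases "j \<le> k")
    case True
    have "zvar 0 P1 x * f (Suc j) x + zvar 1 P1 x * g (Suc j) x = - (zvar 0 P0 x * f j x + zvar 1 P0 x * g j x)"
      using eq[OF x True] unfolding Lcomp_def by (simp add: eq_neg_iff_add_eq_0 algebra_simps)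
    then show ?thesis using True by (simp add: h_def)
  qed (use j in \<open>simp add: h_def le_Suc_eq\<close>)
  have L0: "Lcomp 0 h j x = g j x" and L1: "Lcomp 1 h j x = - f j x" if x: "x \<in> U" and j: "j \<le> Suc k" for x j
  proof -
    have hj: "h j x = (zvar 0 P1 x * f j x + zvar 1 P1 x * g j x) * inverse (zdet x)" using j by (simp add: h_def)
    have "Lcomp 0 h j x = (zdet x * inverse (zdet x)) * g j x" "Lcomp 1 h j x = - (zdet x * inverse (zdet x)) * f j x"
      unfolding Lcomp_def h_Suc[OF x j] hj zdet_def by (simp_all add: algebra_simps)
    then show "Lcomp 0 h j x = g j x" "Lcomp 1 h j x = - f j x" using nz[OF x] by simp_all
  qed
  have c: "Ck 1 U (h j)" for j
  proof -
    have z: "Ck 1 U zdet" unfolding zdet_def[abs_def] by (intro Ck_diff Ck_mult Ck_zvar U)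
    have fg: "Ck 1 U (f i)" "Ck 1 U (g i)" if "i \<le> Suc k" for i using regs_Ck1[OF f that] regs_Ck1[OF g that] .
    have "Ck 1 U (\<lambda>x. (zvar 0 P1 x * f j x + zvar 1 P1 x * g j x) * inverse (zdet x))" if "j \<le> Suc k"
      by (intro Ck_mult Ck_add Ck_zvar Ck_inverse U z nz fg that)
    moreover have "Ck 1 U (\<lambda>x. (0 - (zvar 0 P0 x * f (Suc k) x + zvar 1 P0 x * g (Suc k) x)) * inverse (zdet x))"
      by (intro Ck_mult Ck_add Ck_diff Ck_zvar Ck_inverse Ck_const U z nz fg order_refl)
    ultimately show ?thesis by (cases "j \<le> Suc k") (simp_all add: h_def[abs_def] del: Ck.simps One_nat_def)
  qed
  have hd: "h j differentiable (at x)" if "x \<in> U" for j x by (rule Ck_differentiable[OF c _ that]) simp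
  \<comment> \<open>Regularity is proved through the defects \<open>e\<close>:
    \<open>nab_Lcomp_pair\<close> and the regularity of \<open>f\<close> and \<open>g\<close> give a
    homogeneous linear system for two consecutive defects, with determinant
    \<open>zdet\<close>.\<close>
  define e where "e = (\<lambda>A j x. nab A P0 (h j) x + nab A P1 (h (Suc j)) x)"
  have pair: "e A j x = 0 \<and> e A (Suc j) x = 0" if A: "A < 2 * CARD('n)" and j: "j \<le> k" and x: "x \<in> U" for A j x
  proof -
    have l0: "nab A a (Lcomp 0 h i) x = nab A a (g i) x" if "i \<le> Suc k" for a i
      by (rule cdird_cong_open[OF U x]) (simp add: L0 that)
    have l1: "nab A a (Lcomp 1 h i) x = - nab A a (f i) x" if i: "i \<le> Suc k" for a i
    proof -
      have "nab A a (Lcomp 1 h i) x = nab A a (\<lambda>x. (- 1) * f i x) x"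
        by (rule cdird_cong_open[OF U x]) (simp add: L1[OF _ i] del: One_nat_def)
      then show ?thesis
        using Ck_differentiable[OF regs_Ck1[OF f i] _ x] by (simp only: cdird_cmult) simp
    qed
    have "zvar 0 P0 x * e A j x + zvar 0 P1 x * e A (Suc j) x = 0"
      using nab_Lcomp_pair[of h j x A 0, OF hd[OF x] hd[OF x] hd[OF x] A less_twice_card(1)]
        regs_pairD[OF g _ A x, of j] j by (simp add: l0 e_def)
    moreover have "zvar 1 P0 x * e A j x + zvar 1 P1 x * e A (Suc j) x = 0"
      using nab_Lcomp_pair[of h j x A 1, OF hd[OF x] hd[OF x] hd[OF x] A less_twice_card(2)]
        regs_pairD[OF f _ A x, of j] j l1[of j P0] l1[of "Suc j" P1] by (simp add: e_def add_eq_0_iff)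
    ultimately have "zdet x * e A j x = 0" "zdet x * e A (Suc j) x = 0" unfolding zdet_def by algebra+
    then show ?thesis using nz[OF x] by simp
  qed
  \<comment> \<open>The defect of index \<open>Suc k\<close> is reached as the second member of the
    pair starting at \<open>k\<close>.\<close>
  have "e A j x = 0" if "A < 2 * CARD('n)" "j \<le> Suc k" "x \<in> U" for A j x
    using pair[of A j x] pair[of A "j - 1" x] that by (cases "j \<le> k") (auto simp: le_Suc_eq)
  then have "regs (Suc (Suc k)) U h"
    using c by (simp add: regs_def e_def less_Suc_eq_le del: Ck.simps One_nat_def)
  then show ?thesis by (rule that) (use L0 L1 in auto)
qed

section \<open>Solving a multiplication equation off X\<close>

lemma bounded_bilinear_vscale: "bounded_bilinear ((*s) :: complex \<Rightarrow> complex ^ 'm::finite \<Rightarrow> complex ^ 'm)"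
proof -
  have "bilinear ((*s) :: complex \<Rightarrow> complex ^ 'm \<Rightarrow> complex ^ 'm)"
    unfolding bilinear_def by (auto intro!: linearI simp: vec_eq_iff algebra_simps)
  then show ?thesis by (simp add: bilinear_conv_bounded_bilinear)
qed

lemmas Ck_vscale = Ck_bilinear[OF bounded_bilinear_vscale]

text \<open>Stated for an arbitrary ordering of the primed indices, so that either coordinate
  \<open>zvar 1 a\<close> may be the nonvanishing one.\<close>

lemma zlin_nvec_partner:
  assumes "a \<noteq> b" "A < 2 * CARD('n::finite)" "B < 2 * CARD('n)"
  shows "zlin B a (nvec A b :: complex ^ ('n bit0 bit0)) = 0 \<longleftrightarrow> B \<noteq> partner A"
    and "zlin B b (nvec A a :: complex ^ ('n bit0 bit0)) = - zlin B a (nvec A b :: complex ^ ('n bit0 bit0))"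
  using assms(1) by (cases a; cases b; simp add: zlin_nvec_10[OF assms(2,3)] zlin_nvec_01[OF assms(2,3)])+

text \<open>The complex vector fields \<open>V\<^sub>A = \<nabla>\<^sub>A\<^sup>b + \<nu> \<nabla>\<^sub>A\<^sup>a\<close> commute and annihilate \<open>\<nu>\<close>, so in the complexification
  their leaves are affine; the system \<open>V\<^sub>A Y = \<nabla>\<^sub>A\<^sup>a G\<close> is solved by integrating the closed leafwise form
  along segments.\<close>

lemma leafwise_primitive:
  fixes U :: "'n::finite hspace set"
  assumes U: "open U" and G: "regs 0 U (\<lambda>_. G)" and p: "p \<in> U" and ab: "a \<noteq> b" and za: "zvar 1 a p \<noteq> 0"
  obtains \<delta> Y where "\<delta> > 0" "ball p \<delta> \<subseteq> U" "\<And>x. x \<in> ball p \<delta> \<Longrightarrow> zvar 1 a x \<noteq> 0" "Ck 1 (ball p \<delta>) Y"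
    "\<And>A x. A < 2 * CARD('n) \<Longrightarrow> x \<in> ball p \<delta> \<Longrightarrow>
       nab A b Y x + (- zvar 1 b x * inverse (zvar 1 a x)) * nab A a Y x = nab A a G x"
proof -
  obtain \<delta>0 F where \<delta>0: "\<delta>0 > 0" and hol: "chol (ball (cvec p) \<delta>0) F" and smooth: "\<And>q. Ck q (ball (cvec p) \<delta>0) F"
    and sub: "ball p \<delta>0 \<subseteq> U" and FG: "\<And>x. x \<in> ball p \<delta>0 \<Longrightarrow> F (cvec x) = G x"
    using regs_complexification[OF U G order_refl p] by metis
  let ?W = "ball (cvec p) \<delta>0"
  let ?N = "2 * CARD('n)"
  define \<nu> where "\<nu> = (\<lambda>x::'n hspace. - zvar 1 b x * inverse (zvar 1 a x))"
  \<comment> \<open>Normalizes the functions \<open>c\<close>: the derivative of \<open>c B\<close>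
    along \<open>V A\<close> is 1 for \<open>A = B\<close> and 0 otherwise, so they are leaf
    coordinates, chosen to vanish at \<open>p\<close>.\<close>
  define K where "K = (\<lambda>A. zlin (partner A) a (nvec A b :: complex ^ ('n bit0 bit0)))"
  define c where "c = (\<lambda>A (x :: 'n hspace). (zvar (partner A) a x + - zvar (partner A) a p) * inverse (K A) :: complex)"
  define V where "V = (\<lambda>A x. nvec A b + \<nu> x *s nvec A a :: complex ^ ('n bit0 bit0))"
  \<comment> \<open>Displacement inside the complex leaf: \<open>cvec x - L x\<close> is its point
    with all leaf coordinates 0, and is unchanged to first order when \<open>x\<close> moves along a
    field \<open>V A\<close>.\<close>
  define L where "L = (\<lambda>x. \<Sum>A<?N. c A x *s V A x)"
  define Fa where "Fa = (\<lambda>A. dird (nvec A a) F)"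
  have K: "K A \<noteq> 0" if "A < ?N" for A
    using zlin_nvec_partner(1)[OF ab that partner_less[OF that]] by (simp add: K_def)
  define U1 where "U1 = {x::'n hspace. zvar 1 a x \<noteq> 0}"
  have U1: "open U1" unfolding U1_def
    using Ck_continuous[OF Ck_zvar[of 0 UNIV]] by (intro open_Collect_neq continuous_intros) auto
  have Ck\<nu>: "Ck r U1 \<nu>" for r
  proof -
    have "Ck r U1 (\<lambda>x. (0 - zvar 1 b x) * inverse (zvar 1 a x))"
      by (intro Ck_mult Ck_diff Ck_const Ck_zvar Ck_inverse U1) (simp add: U1_def)
    then show ?thesis by (simp add: \<nu>_def)
  qed
  have Ckc: "Ck r S (c A)" if "open S" for r S A
    unfolding c_def by (intro Ck_mult Ck_add Ck_const Ck_zvar that)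
  have CkV: "Ck r U1 (V A)" for r A
    unfolding V_def by (intro Ck_add Ck_vscale Ck_const Ck\<nu> U1)
  have CkL: "Ck r U1 L" for r
    unfolding L_def by (intro Ck_sum Ck_vscale Ckc CkV U1)
  have pU1: "p \<in> U1" using za by (simp add: U1_def)
  have Lp: "L p = 0" by (simp add: L_def c_def)
  have "isCont L p" using Ck_continuous[OF CkL[of 0]] U1 pU1 by (simp add: continuous_on_eq_continuous_at)
  then obtain d1 where d1: "d1 > 0" "\<And>x. dist x p < d1 \<Longrightarrow> norm (L x) < \<delta>0 / 2"
    using \<delta>0 Lp unfolding continuous_at_eps_delta by (metis half_gt_zero dist_0_norm dist_commute)
  obtain d2 where d2: "d2 > 0" "ball p d2 \<subseteq> U1" using U1 pU1 openE by blast
  \<comment> \<open>Half of \<open>\<delta>0\<close> is spent on the distance of \<open>x\<close>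
    from \<open>p\<close>, the other half on \<open>L x\<close>, so the segments
    \<open>\<gamma> x\<close> remain in the domain of \<open>F\<close>.\<close>
  define \<delta> where "\<delta> = min (\<delta>0 / 2) (min d1 d2)"
  have \<delta>: "\<delta> > 0" "ball p \<delta> \<subseteq> ball p \<delta>0" "ball p \<delta> \<subseteq> U1" using \<delta>0 d1 d2 by (auto simp: \<delta>_def)
  define \<gamma> where "\<gamma> = (\<lambda>x s. (cvec x - L x) + s *\<^sub>R L x)"
  have \<gamma>_in: "\<gamma> x s \<in> ?W" if "x \<in> ball p \<delta>" "s \<in> {0..1}" for x s
  proof -
    have "\<gamma> x s - cvec p = cvec (x - p) - (1 - s) *\<^sub>R L x" by (simp add: \<gamma>_def cvec_diff algebra_simps)
    then have "norm (\<gamma> x s - cvec p) \<le> norm (x - p) + norm ((1 - s) *\<^sub>R L x)"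
      by (metis norm_cvec norm_triangle_ineq4)
    moreover have "norm ((1 - s) *\<^sub>R L x) \<le> norm (L x)" using that(2) by (auto intro!: mult_left_le_one_le)
    moreover have "norm (L x) < \<delta>0 / 2" using that(1) by (intro d1) (simp add: \<delta>_def dist_commute)
    moreover have "norm (x - p) < \<delta>0 / 2" using that(1) by (simp add: \<delta>_def dist_norm norm_minus_commute)
    ultimately show ?thesis by (simp add: dist_norm norm_minus_commute)
  qed
  have CkFa: "Ck r ?W (Fa A)" for r A unfolding Fa_def by (rule Ck_dird[OF smooth[of "Suc r"]]) simp
  have holFa: "chol ?W (Fa A)" for A unfolding Fa_def by (rule chol_dird[OF open_ball smooth hol])
  \<comment> \<open>The leafwise one-form with coefficients \<open>Fa A\<close> in the coordinates
    \<open>c A\<close>, evaluated along the segment from the base point to \<open>x\<close>;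
    \<open>Y\<close> is its Poincare primitive.\<close>
  define H where "H = (\<lambda>x s. \<Sum>A<?N. c A x * Fa A (\<gamma> x s))"
  define Y where "Y = (\<lambda>x. integral (cbox 0 1) (H x))"
  have par: "parCk 1 (ball p \<delta>) (cbox 0 1) H"
  proof -
    let ?P = "ball p \<delta> \<times> (UNIV :: real set)"
    have P: "open ?P" by (intro open_Times) auto
    have Lf: "Ck 1 ?P (\<lambda>q. L (fst q))"
      by (rule Ck_compose[OF P U1 Ck_linear[OF bounded_linear_fst] CkL]) (use \<delta>(3) in auto)
    have \<gamma>f: "Ck 1 ?P (\<lambda>q. \<gamma> (fst q) (snd q))"
      unfolding \<gamma>_def
      by (intro Ck_add Ck_diff Ck_scaleR P Lf Ck_linear bounded_linear_snd bounded_linear_compose[OF bounded_linear_cvec bounded_linear_fst])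
    define W where "W = ?P \<inter> (\<lambda>q. \<gamma> (fst q) (snd q)) -` ?W"
    have W: "open W" unfolding W_def
      by (rule continuous_open_preimage[OF Ck_continuous[OF \<gamma>f] P open_ball])
    have WP: "W \<subseteq> ?P" by (auto simp: W_def)
    have "Ck 1 W (\<lambda>q. H (fst q) (snd q))"
      unfolding H_def
    proof (intro Ck_sum Ck_mult W)
      fix A
      show "Ck 1 W (\<lambda>q. c A (fst q))"
        by (rule Ck_compose[OF W open_UNIV Ck_linear[OF bounded_linear_fst] Ckc]) auto
      show "Ck 1 W (\<lambda>q. Fa A (\<gamma> (fst q) (snd q)))"
        by (rule Ck_compose[OF W open_ball Ck_subset[OF \<gamma>f WP] CkFa]) (auto simp: W_def)
    qed
    moreover have "ball p \<delta> \<times> cbox 0 1 \<subseteq> W" using \<gamma>_in by (auto simp: W_def simp del: mem_ball)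
    ultimately have "parCk 1 (ball p \<delta>) (cbox 0 1) (\<lambda>x t. H (fst (x,t)) (snd (x,t)))"
      by (rule parCk_of_Ck[OF open_ball])
    then show ?thesis by (simp only: fst_conv snd_conv)
  qed
  have CkY: "Ck 1 (ball p \<delta>) Y" unfolding Y_def by (rule Ck_parametric_integral[OF open_ball par])
  \<comment> \<open>At real points this is 0-regularity of \<open>G\<close>. The segments run
    through nonreal points, so the identity theorem has to extend it.\<close>
  have closed: "dird (nvec A b) (Fa B) z = dird (nvec B b) (Fa A) z"
    if A: "A < ?N" and B: "B < ?N" and z: "z \<in> ?W" for A B z
  proof -
    define E where "E = (\<lambda>z. dird (nvec A b) (Fa B) z + (- 1) * dird (nvec B b) (Fa A) z)"
    have "chol ?W E" unfolding E_def
      by (intro chol_add chol_mult chol_const chol_dird[OF open_ball CkFa holFa])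
    moreover have "E (cvec x) = 0" if x: "x \<in> ball p \<delta>0" for x
    proof -
      have xW: "cvec y \<in> ?W" if "y \<in> ball p \<delta>0" for y using that by simp
      have 1: "Fa C (cvec y) = nab C a G y" if "y \<in> ball p \<delta>0" for C y
        using cdird_restrict[OF hol xW[OF that], of "nvec C a"] cdird_cong_open[OF open_ball that FG, where v="nvec C a"]
        by (simp add: Fa_def)
      have 2: "dird (nvec D b) (Fa C) (cvec x) = nab D b (nab C a G) x" for C D
        using cdird_restrict[OF holFa xW[OF x], of "nvec D b"] cdird_cong_open[OF open_ball x 1, where v="nvec D b"] by simp
      have xU: "x \<in> U" using x sub by blast
      have z0: "nab C P0 (nab D P1 G) x = nab D P0 (nab C P1 G) x" if "C < ?N" "D < ?N" for C D
        by (rule regs_zero_regular[OF U G order_refl that xU])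
      have "nab A b (nab B a G) x = nab B b (nab A a G) x"
        using ab z0[OF A B] z0[OF B A] cdird_commute[OF U regs_smooth[OF U G order_refl] xU]
        by (cases a; cases b) auto
      then show ?thesis by (simp add: E_def 2)
    qed
    ultimately have "E z = 0" using chol_zero_of_real_zero z by blast
    then show ?thesis by (simp add: E_def)
  qed
  have main: "nab A b Y x + \<nu> x * nab A a Y x = nab A a G x" if A: "A < ?N" and x: "x \<in> ball p \<delta>" for A x
  proof -
    have xU1: "x \<in> U1" using x \<delta> by blast
    define w where "w = V A x"
    have zl: "zlin B a w = zlin B a (nvec A b :: complex ^ ('n bit0 bit0))" if "B < ?N" for B
      by (simp add: w_def V_def zlin_add zlin_scale zlin_nvec_same[OF A that])
    have cd: "cdird w (c B) x = (if B = A then 1 else 0)" if B: "B < ?N" for B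
    proof -
      have "cdird w (c B) x = zlin (partner B) a w * inverse (K B)"
      proof -
        have "cdird w (\<lambda>x. zvar (partner B) a x + - zvar (partner B) a p) x = zlin (partner B) a w"
          by (subst cdird_add) (auto simp: zvar_differentiable cdird_zvar)
        moreover have "cdird w (c B) x = (zvar (partner B) a x + - zvar (partner B) a p) * cdird w (\<lambda>_. inverse (K B)) x
          + cdird w (\<lambda>x. zvar (partner B) a x + - zvar (partner B) a p) x * inverse (K B)"
          unfolding c_def by (rule cdird_mult) (intro differentiable_add zvar_differentiable differentiable_const)+
        ultimately show ?thesis by simp
      qed
      then show ?thesis
        unfolding zl[OF partner_less[OF B]]
        using zlin_nvec_partner(1)[OF ab A partner_less[OF B]] K[OF A] partner_eq_iff[of B A] by (auto simp: K_def)
    qed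
    have \<nu>d: "\<nu> differentiable (at x)" by (rule Ck_differentiable[OF Ck\<nu>[of 1] _ xU1]) simp
    \<comment> \<open>Differentiate \<open>\<nu> * z_1^a = - z_1^b\<close>; by antisymmetry the
      derivative of \<open>z_1^b\<close> along \<open>w\<close> is \<open>- \<nu>\<close> times that
      of \<open>z_1^a\<close>.\<close>
    have c\<nu>: "cdird w \<nu> x = 0"
    proof -
      have "\<nu> y * zvar 1 a y = - 1 * zvar 1 b y" if "y \<in> U1" for y using that by (simp add: \<nu>_def U1_def)
      then have "cdird w (\<lambda>y. \<nu> y * zvar 1 a y) x = cdird w (\<lambda>y. - 1 * zvar 1 b y) x"
        by (intro cdird_cong_open[OF U1 xU1])
      then have "\<nu> x * zlin 1 a w + cdird w \<nu> x * zvar 1 a x = - 1 * zlin 1 b w"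
        by (simp only: cdird_mult[OF \<nu>d zvar_differentiable] cdird_cmult[OF zvar_differentiable] cdird_zvar)
      moreover have "zlin 1 b w = - \<nu> x * zlin 1 a (nvec A b :: complex ^ ('n bit0 bit0))"
        by (simp add: w_def V_def zlin_add zlin_scale zlin_nvec_same[OF A less_twice_card(2)]
            zlin_nvec_partner(2)[OF ab A less_twice_card(2)] del: One_nat_def)
      ultimately have "cdird w \<nu> x * zvar 1 a x = 0"
        unfolding zl[OF less_twice_card(2)] by simp
      then show ?thesis using xU1 by (simp add: U1_def)
    qed
    have cdiff: "c B differentiable (at x)" for B by (rule Ck_differentiable[OF Ckc[OF open_UNIV, of 1]]) auto
    have c\<gamma>: "(\<chi> l. cdird w (\<lambda>x. \<gamma> x s $ l) x) = s *\<^sub>R w" for s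
    proof -
      have "cdird w (\<lambda>x. \<gamma> x s $ l) x = of_real s * w $ l" for l
      proof -
        have e: "\<gamma> y s $ l = of_real (y $ l) + of_real (s - 1) * (\<Sum>B<?N. c B y * (nvec B b $ l + \<nu> y * nvec B a $ l))" for y
          by (simp add: \<gamma>_def L_def V_def scaleR_conv_of_real[where 'a=complex] algebra_simps)
        have t: "(\<lambda>y. c B y * (nvec B b $ l + \<nu> y * nvec B a $ l)) differentiable (at x)" for B
          by (intro differentiable_mult differentiable_add cdiff \<nu>d) auto
        have "(\<lambda>y. complex_of_real (y $ l)) differentiable (at x)"
          by (rule bounded_linear_imp_differentiable[OF bounded_linear_compose[OF bounded_linear_of_real bounded_linear_vec_nth]])
        then have "cdird w (\<lambda>x. \<gamma> x s $ l) x = w $ l + of_real (s - 1) * (\<Sum>B<?N. cdird w (\<lambda>y. c B y * (nvec B b $ l + \<nu> y * nvec B a $ l)) x)"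
          unfolding e by (simp add: cdird_add cdird_of_real_nth cdird_cmult cdird_sum t differentiable_mult differentiable_sum del: of_real_diff)
        also have "(\<Sum>B<?N. cdird w (\<lambda>y. c B y * (nvec B b $ l + \<nu> y * nvec B a $ l)) x) = (\<Sum>B<?N. if B = A then w $ l else 0)"
        proof (rule sum.cong[OF refl])
          fix B assume "B \<in> {..<?N}"
          then show "cdird w (\<lambda>y. c B y * (nvec B b $ l + \<nu> y * nvec B a $ l)) x = (if B = A then w $ l else 0)"
            using cd[of B] c\<nu> by (simp add: cdird_mult cdird_add cdiff \<nu>d differentiable_add differentiable_mult w_def V_def)
        qed
        also have "\<dots> = w $ l" using A by simp
        finally show ?thesis by (simp add: algebra_simps)
      qed
      then show ?thesis by (simp add: vec_eq_iff scaleR_conv_of_real[where 'a=complex])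
    qed
    have \<gamma>d: "(\<lambda>x. \<gamma> x s) differentiable (at x)" for s
      unfolding \<gamma>_def using Ck_differentiable[OF CkL[of 1] _ xU1]
      by (intro differentiable_add differentiable_diff differentiable_scaleR bounded_linear_imp_differentiable[OF bounded_linear_cvec]) auto
    \<comment> \<open>Closedness exchanges \<open>V A\<close> and \<open>V B\<close> between
      direction and coefficient; the sum of \<open>c B\<close> times \<open>V B\<close> is then
      \<open>L x\<close>, the velocity of the segment. What results is the derivative in
      \<open>s\<close> of \<open>s *\<^sub>R Fa A (\<gamma> x s)\<close>.\<close>
    have integrand: "cdird w (\<lambda>x. H x s) x = s *\<^sub>R dird (L x) (Fa A) (\<gamma> x s) + 1 *\<^sub>R Fa A (\<gamma> x s)"
      if s: "s \<in> {0..1}" for s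
    proof -
      note g = \<gamma>_in[OF x s]
      have Fd: "(\<lambda>x. Fa B (\<gamma> x s)) differentiable (at x)" for B
        using differentiable_chain_at[OF \<gamma>d[of s], of "Fa B"] Ck_differentiable[OF CkFa[of 1] _ g] by (simp add: o_def)
      have lin: "linear (\<lambda>v. dird v (Fa B) (\<gamma> x s))" for B
        by (rule linear_dird[OF Ck_differentiable[OF CkFa[of 1] _ g]]) simp
      have ch: "cdird w (\<lambda>x. Fa B (\<gamma> x s)) x = s *\<^sub>R dird w (Fa B) (\<gamma> x s)" for B
        unfolding cdird_chain[OF \<gamma>d holFa g] c\<gamma> by (rule linear_scale[OF lin])
      have sw: "dird w (Fa B) (\<gamma> x s) = dird (V B x) (Fa A) (\<gamma> x s)" if B: "B < ?N" for B
      proof -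
        have "dird (nvec A a) (Fa B) (\<gamma> x s) = dird (nvec B a) (Fa A) (\<gamma> x s)"
          unfolding Fa_def by (rule dird_commute[OF open_ball smooth g])
        then show ?thesis using closed[OF A B g]
          by (simp add: w_def V_def chol_add_dir[OF holFa g] chol_scale[OF holFa g])
      qed
      have "cdird w (\<lambda>x. H x s) x = (\<Sum>B<?N. c B x * cdird w (\<lambda>x. Fa B (\<gamma> x s)) x + cdird w (c B) x * Fa B (\<gamma> x s))"
        unfolding H_def by (simp add: cdird_sum cdird_mult differentiable_mult cdiff Fd)
      also have "\<dots> = (\<Sum>B<?N. of_real s * (c B x * dird (V B x) (Fa A) (\<gamma> x s)) + (if B = A then Fa A (\<gamma> x s) else 0))"
        by (intro sum.cong refl) (simp add: ch sw cd scaleR_conv_of_real)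
      also have "\<dots> = of_real s * dird (L x) (Fa A) (\<gamma> x s) + Fa A (\<gamma> x s)"
        using A by (simp add: sum.distrib L_def chol_sum_dir[OF holFa g] chol_scale[OF holFa g] flip: sum_distrib_left)
      finally show ?thesis by (simp add: scaleR_conv_of_real)
    qed
    have "cdird w Y x = integral (cbox 0 1) (\<lambda>s. cdird w (\<lambda>x. H x s) x)"
      unfolding Y_def using par x by (intro cdird_parametric_integral[OF open_ball]) auto
    also have "\<dots> = integral (cbox 0 1) (\<lambda>s. s *\<^sub>R dird (L x) (Fa A) (\<gamma> x s) + 1 *\<^sub>R Fa A (\<gamma> x s))"
      by (intro integral_cong integrand) simp
    also have "\<dots> = 1 *\<^sub>R Fa A (\<gamma> x 1) - 0 *\<^sub>R Fa A (\<gamma> x 0)"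
      unfolding cbox_interval
    proof (intro integral_unique fundamental_theorem_of_calculus)
      fix s :: real assume s: "s \<in> {0..1}"
      have "((\<lambda>s. Fa A (\<gamma> x s)) has_vector_derivative dird (L x) (Fa A) (\<gamma> x s)) (at s)"
        unfolding \<gamma>_def
        by (rule has_vector_derivative_line) (use Ck_differentiable[OF CkFa[of 1] _ \<gamma>_in[OF x s]] in \<open>simp add: \<gamma>_def\<close>)
      then have "((\<lambda>s. s *\<^sub>R Fa A (\<gamma> x s)) has_vector_derivative
         (s *\<^sub>R dird (L x) (Fa A) (\<gamma> x s) + 1 *\<^sub>R Fa A (\<gamma> x s))) (at s)"
        by (intro has_vector_derivative_scaleR) (auto intro: derivative_eq_intros)
      then show "((\<lambda>s. s *\<^sub>R Fa A (\<gamma> x s)) has_vector_derivative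
         (s *\<^sub>R dird (L x) (Fa A) (\<gamma> x s) + 1 *\<^sub>R Fa A (\<gamma> x s))) (at s within {0..1})"
        by (rule has_vector_derivative_at_within)
    qed simp
    also have "\<dots> = Fa A (cvec x)" by (simp add: \<gamma>_def)
    also have "\<dots> = nab A a G x"
    proof -
      have x0: "x \<in> ball p \<delta>0" using x \<delta> by blast
      then have "cvec x \<in> ?W" by simp
      from cdird_restrict[OF hol this, of "nvec A a"] cdird_cong_open[OF open_ball x0 FG, where v="nvec A a"]
      show ?thesis by (simp add: Fa_def)
    qed
    finally show ?thesis
      using Ck_differentiable[OF CkY _ x] by (simp add: w_def V_def cdird_add_dir cdird_scale_dir)
  qed
  show ?thesis
    by (rule that[OF \<delta>(1) _ _ CkY]) (use \<delta> sub main in \<open>auto simp: U1_def \<nu>_def subset_iff simp del: One_nat_def\<close>)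
qed

text \<open>The multiplication equation is solved downwards from the last component
  \<open>- Y / z_1^a\<close>. The equation for \<open>Y\<close> says exactly that the top defect of
  regularity vanishes, and the regularity of \<open>F\<close> carries this down to the lower
  ones.\<close>

lemma leafwise_chain:
  fixes B :: "'n::finite hspace set"
  assumes B: "open B" and ab: "a \<noteq> b" and za: "\<And>x. x \<in> B \<Longrightarrow> zvar 1 a x \<noteq> 0"
    and F: "\<And>m. m \<le> k \<Longrightarrow> Ck 1 B (F m)"
    and pair: "\<And>A m x. A < 2 * CARD('n) \<Longrightarrow> m < k \<Longrightarrow> x \<in> B \<Longrightarrow> nab A a (F m) x + nab A b (F (Suc m)) x = 0"
    and Y: "Ck 1 B Y"
    and VY: "\<And>A x. A < 2 * CARD('n) \<Longrightarrow> x \<in> B \<Longrightarrow>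
       nab A b Y x + (- zvar 1 b x * inverse (zvar 1 a x)) * nab A a Y x = nab A a (F k) x"
  obtains g where "\<And>m. m \<le> Suc k \<Longrightarrow> Ck 1 B (g m)"
    "\<And>m x. m \<le> k \<Longrightarrow> x \<in> B \<Longrightarrow> zvar 1 a x * g m x + zvar 1 b x * g (Suc m) x = F m x"
    "\<And>A m x. A < 2 * CARD('n) \<Longrightarrow> m \<le> k \<Longrightarrow> x \<in> B \<Longrightarrow> nab A a (g m) x + nab A b (g (Suc m)) x = 0"
proof -
  \<comment> \<open>The recursion counts from the top: \<open>gg i\<close> is component
    \<open>Suc k - i\<close>.\<close>
  define gg where "gg = rec_nat (\<lambda>x. - 1 * Y x * inverse (zvar 1 a x))
    (\<lambda>i h x. (F (k - i) x - zvar 1 b x * h x) * inverse (zvar 1 a x))"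
  have gg0: "gg 0 = (\<lambda>x. - 1 * Y x * inverse (zvar 1 a x))"
    and ggS: "gg (Suc i) = (\<lambda>x. (F (k - i) x - zvar 1 b x * gg i x) * inverse (zvar 1 a x))" for i
    by (simp_all add: gg_def)
  define g where "g = (\<lambda>m. gg (Suc k - m))"
  have inv: "Ck 1 B (\<lambda>x. inverse (zvar 1 a x))" by (intro Ck_inverse B Ck_zvar za)
  have "Ck 1 B (gg i)" for i
  proof (induction i)
    case 0 show ?case unfolding gg0 by (intro Ck_mult B inv Y Ck_const)
  next
    case (Suc i) show ?case unfolding ggS by (intro Ck_mult Ck_diff B inv Suc Ck_zvar F) simp
  qed
  then have Ckg: "Ck 1 B (g m)" for m by (simp add: g_def del: Ck.simps One_nat_def)
  have gd: "g m differentiable (at x)" if "x \<in> B" for m x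
    by (rule Ck_differentiable[OF Ckg _ that]) simp
  have rel: "zvar 1 a x * g m x + zvar 1 b x * g (Suc m) x = F m x" if m: "m \<le> k" and x: "x \<in> B" for m x
  proof -
    have "Suc k - m = Suc (k - m)" "Suc k - Suc m = k - m" "k - (k - m) = m" using m by auto
    then have "g m x = (F m x - zvar 1 b x * g (Suc m) x) * inverse (zvar 1 a x)" by (simp only: g_def ggS)
    then have "zvar 1 a x * g m x = (zvar 1 a x * inverse (zvar 1 a x)) * (F m x - zvar 1 b x * g (Suc m) x)"
      by (simp only: mult_ac)
    also have "\<dots> = F m x - zvar 1 b x * g (Suc m) x" using za[OF x] by (simp del: One_nat_def)
    finally show ?thesis by simp
  qed
  have gk: "zvar 1 a x * g (Suc k) x = - 1 * Y x" if x: "x \<in> B" for x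
    using za[OF x] by (simp add: g_def gg0)
  define e where "e = (\<lambda>A m x. nab A a (g m) x + nab A b (g (Suc m)) x)"
  have "e A m x = 0" if A: "A < 2 * CARD('n)" and m: "m \<le> k" and x: "x \<in> B" for A m x
  proof -
    define \<kappa> where "\<kappa> = zlin 1 a (nvec A b :: complex ^ ('n bit0 bit0))"
    note z = zvar_differentiable cdird_zvar zlin_nvec_same[OF A less_twice_card(2)]
      zlin_nvec_partner(2)[OF ab A less_twice_card(2), folded \<kappa>_def] \<kappa>_def[symmetric]
    have D: "cdird v (\<lambda>x. zvar 1 a x * g m x + zvar 1 b x * g (Suc m) x) x =
        zvar 1 a x * cdird v (g m) x + zlin 1 a v * g m x + (zvar 1 b x * cdird v (g (Suc m)) x + zlin 1 b v * g (Suc m) x)" for v m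
      by (simp add: cdird_add cdird_mult differentiable_mult gd[OF x] zvar_differentiable cdird_zvar del: One_nat_def)
    have DF: "cdird v (\<lambda>x. zvar 1 a x * g m x + zvar 1 b x * g (Suc m) x) x = cdird v (F m) x" if "m \<le> k" for v m
      by (rule cdird_cong_open[OF B x]) (rule rel[OF that])
    have ek: "e A k x = 0"
    proof -
      have "cdird v (\<lambda>x. zvar 1 a x * g (Suc k) x) x = cdird v (\<lambda>x. - 1 * Y x) x" for v
        by (rule cdird_cong_open[OF B x]) (rule gk)
      then have y: "zvar 1 a x * cdird v (g (Suc k)) x + zlin 1 a v * g (Suc k) x = - 1 * cdird v Y x" for v
        by (simp only: cdird_mult[OF zvar_differentiable gd[OF x]] cdird_cmult[OF Ck_differentiable[OF Y zero_less_one x]] cdird_zvar)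
      define i where "i = inverse (zvar 1 a x)"
      have i: "i * zvar 1 a x = 1" using za[OF x] by (simp add: i_def)
      have 1: "zvar 1 a x * nab A a (g k) x + (zvar 1 b x * nab A a (g (Suc k)) x - \<kappa> * g (Suc k) x) = nab A a (F k) x"
        using D[of "nvec A a" k] DF[OF order_refl, of "nvec A a"] by (simp add: z del: One_nat_def)
      have 2: "nab A b Y x - zvar 1 b x * i * nab A a Y x = nab A a (F k) x"
        using VY[OF A x] by (simp add: i_def)
      have 3: "zvar 1 a x * nab A a (g (Suc k)) x = - nab A a Y x"
        "zvar 1 a x * nab A b (g (Suc k)) x + \<kappa> * g (Suc k) x = - nab A b Y x"
        using y[of "nvec A a"] y[of "nvec A b"] by (simp_all add: z del: One_nat_def)
      have "z * (n1 + n3) = 0"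
        if 1: "z * n1 + (q * n2 - P) = f" and 2: "yb - q * i * ya = f" and 3: "z * n2 = - ya" "z * n3 + P = - yb"
          and i: "i * z = 1" for z n1 n2 n3 q P f ya yb i :: complex
      proof -
        have "q * n2 = q * (i * z) * n2" using i by simp
        also have "\<dots> = q * i * (z * n2)" by (simp only: mult_ac)
        finally have "q * n2 = - (q * i * ya)" unfolding 3 by simp
        moreover have "z * n1 = f - (q * n2 - P)" using 1 by (simp only: eq_diff_eq)
        moreover have "z * n3 = - yb - P" using 3(2) by (simp only: eq_diff_eq)
        ultimately show ?thesis unfolding 2[symmetric] by (simp add: distrib_left)
      qed
      from this[OF 1 2 3 i] have "zvar 1 a x * e A k x = 0" unfolding e_def .
      then show ?thesis using za[OF x] by simp
    qed
    \<comment> \<open>The terms with \<open>\<kappa>\<close>, in which \<open>z_1\<close> is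
      differentiated, cancel between components \<open>m\<close> and \<open>Suc m\<close>, so
      \<open>z_1^a e_m + z_1^b e_{m+1}\<close> equals the defect of \<open>F\<close>, which is
      0.\<close>
    have step: "e A m x = 0" if "m < k" "e A (Suc m) x = 0" for m
    proof -
      have 1: "zvar 1 a x * nab A a (g m) x + (zvar 1 b x * nab A a (g (Suc m)) x - \<kappa> * g (Suc m) x) = nab A a (F m) x"
        using D[of "nvec A a" m] DF[of m "nvec A a"] that by (simp add: z del: One_nat_def)
      have 2: "zvar 1 a x * nab A b (g (Suc m)) x + \<kappa> * g (Suc m) x + zvar 1 b x * nab A b (g (Suc (Suc m))) x = nab A b (F (Suc m)) x"
        using D[of "nvec A b" "Suc m"] DF[of "Suc m" "nvec A b"] that by (simp add: z del: One_nat_def)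
      have "zvar 1 a x * e A m x = (nab A a (F m) x + nab A b (F (Suc m)) x) - zvar 1 b x * e A (Suc m) x"
        unfolding e_def 1[symmetric] 2[symmetric] by (simp add: algebra_simps)
      then have "zvar 1 a x * e A m x = 0"
        unfolding pair[OF A that(1) x] that(2) by simp
      then show ?thesis using za[OF x] by simp
    qed
    show ?thesis using m by (induction rule: inc_induct) (auto intro: ek step)
  qed
  then show ?thesis using that[of g] Ckg rel unfolding e_def by blast
qed

lemma regs_0I: "open U \<Longrightarrow> regs k U F \<Longrightarrow> j \<le> k \<Longrightarrow> regs 0 U (\<lambda>_. F j)"
  unfolding regs_def[of 0] using regs_smooth regs_zero_regular by auto

lemma regs_subset: "regs k U \<phi> \<Longrightarrow> V \<subseteq> U \<Longrightarrow> regs k V \<phi>"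
  unfolding regs_def by (auto intro: Ck_subset simp del: Ck.simps One_nat_def split: if_splits)

text \<open>A nonzero determinant forces a nonzero entry in the row of \<open>z_1\<close>; the
  choice of that entry decides whether the solution descends from the last component or ascends from
  the first.\<close>

lemma surjective_off_X:
  fixes U :: "'n::finite hspace set"
  assumes U: "open U" and p: "p \<in> U" "proj0 p \<noteq> 0" and F: "regs k U F"
  obtains \<delta> g where "\<delta> > 0" "ball p \<delta> \<subseteq> U" "regs (Suc k) (ball p \<delta>) g"
    "\<And>x j. x \<in> ball p \<delta> \<Longrightarrow> j \<le> k \<Longrightarrow> Lcomp 1 g j x = F j x"
proof -
  have "zdet p \<noteq> 0" using p zdet_eq_0_iff by blast
  then consider "zvar 1 P0 p \<noteq> 0" | "zvar 1 P1 p \<noteq> 0" unfolding zdet_def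
    by (cases "zvar 1 P0 p = 0") auto
  then show ?thesis
  proof cases
    case 1
    obtain \<delta> Y where d: "\<delta> > 0" "ball p \<delta> \<subseteq> U" "\<And>x. x \<in> ball p \<delta> \<Longrightarrow> zvar 1 P0 x \<noteq> 0" "Ck 1 (ball p \<delta>) Y"
      "\<And>A x. A < 2 * CARD('n) \<Longrightarrow> x \<in> ball p \<delta> \<Longrightarrow>
         nab A P1 Y x + (- zvar 1 P1 x * inverse (zvar 1 P0 x)) * nab A P0 Y x = nab A P0 (F k) x"
      using leafwise_primitive[OF U regs_0I[OF U F order_refl] p(1) _ 1, of P1] by blast
    note Fb = regs_subset[OF F d(2)]
    obtain g where g: "\<And>m. m \<le> Suc k \<Longrightarrow> Ck 1 (ball p \<delta>) (g m)"
      "\<And>m x. m \<le> k \<Longrightarrow> x \<in> ball p \<delta> \<Longrightarrow> zvar 1 P0 x * g m x + zvar 1 P1 x * g (Suc m) x = F m x"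
      "\<And>A m x. A < 2 * CARD('n) \<Longrightarrow> m \<le> k \<Longrightarrow> x \<in> ball p \<delta> \<Longrightarrow> nab A P0 (g m) x + nab A P1 (g (Suc m)) x = 0"
      using leafwise_chain[OF open_ball _ d(3) regs_Ck1[OF Fb] regs_pairD[OF Fb] d(4,5)] by blast
    have "regs (Suc k) (ball p \<delta>) g" using g(1,3) by (simp add: regs_def less_Suc_eq_le del: Ck.simps One_nat_def)
    then show ?thesis using that[OF d(1,2)] g(2) by (simp add: Lcomp_def del: One_nat_def)
  next
    case 2
    obtain \<delta> Y where d: "\<delta> > 0" "ball p \<delta> \<subseteq> U" "\<And>x. x \<in> ball p \<delta> \<Longrightarrow> zvar 1 P1 x \<noteq> 0" "Ck 1 (ball p \<delta>) Y"
      "\<And>A x. A < 2 * CARD('n) \<Longrightarrow> x \<in> ball p \<delta> \<Longrightarrow>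
         nab A P0 Y x + (- zvar 1 P0 x * inverse (zvar 1 P1 x)) * nab A P1 Y x = nab A P1 (F 0) x"
      using leafwise_primitive[OF U regs_0I[OF U F le0] p(1) _ 2, of P0] by blast
    note Fb = regs_subset[OF F d(2)]
    \<comment> \<open>Exchanging the primed indices amounts to reversing the order of the
      components, so \<open>leafwise_chain\<close> applies to the reversed family.\<close>
    define F' where "F' = (\<lambda>m. F (k - m))"
    have F1: "Ck 1 (ball p \<delta>) (F' m)" if "m \<le> k" for m unfolding F'_def by (rule regs_Ck1[OF Fb]) simp
    have F2: "nab A P1 (F' m) x + nab A P0 (F' (Suc m)) x = 0" if "A < 2 * CARD('n)" "m < k" "x \<in> ball p \<delta>" for A m x
    proof -
      have "Suc (k - Suc m) = k - m" using that by simp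
      then show ?thesis using regs_pairD[OF Fb _ that(1,3), of "k - Suc m"] that(2) by (simp add: F'_def add.commute)
    qed
    have F3: "F' k = F 0" by (simp add: F'_def)
    obtain g where g: "\<And>m. m \<le> Suc k \<Longrightarrow> Ck 1 (ball p \<delta>) (g m)"
      "\<And>m x. m \<le> k \<Longrightarrow> x \<in> ball p \<delta> \<Longrightarrow> zvar 1 P1 x * g m x + zvar 1 P0 x * g (Suc m) x = F' m x"
      "\<And>A m x. A < 2 * CARD('n) \<Longrightarrow> m \<le> k \<Longrightarrow> x \<in> ball p \<delta> \<Longrightarrow> nab A P1 (g m) x + nab A P0 (g (Suc m)) x = 0"
      using leafwise_chain[OF open_ball _ d(3) F1 F2 d(4,5)[folded F3]] by blast
    define h where "h = (\<lambda>j. g (Suc k - j))"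
    have h: "h j = g (Suc (k - j))" "h (Suc j) = g (k - j)" if "j \<le> k" for j
      using that by (simp_all add: h_def Suc_diff_le)
    have "regs (Suc k) (ball p \<delta>) h"
      unfolding regs_def
    proof (simp only: nat.simps if_False, intro conjI allI impI ballI)
      fix j assume "j \<le> Suc k"
      show "Ck 1 (ball p \<delta>) (h j)" unfolding h_def by (rule g(1)) simp
    next
      fix A j x assume *: "A < 2 * CARD('n)" "j < Suc k" "x \<in> ball p \<delta>"
      then have "j \<le> k" by simp
      then show "nab A P0 (h j) x + nab A P1 (h (Suc j)) x = 0"
        using g(3)[OF *(1) _ *(3), of "k - j"] by (simp add: h add.commute)
    qed
    moreover have "Lcomp 1 h j x = F j x" if "x \<in> ball p \<delta>" "j \<le> k" for x j
      using g(2)[of "k - j" x] that by (simp add: Lcomp_def h F'_def add.commute del: One_nat_def)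
    ultimately show ?thesis using that[OF d(1,2)] by blast
  qed
qed

section \<open>Sheaf axioms\<close>

text \<open>Functions cut out by a condition that is local, depends only on values on the open set
  and is stable under differences form a sheaf; gluing is pointwise.\<close>

lemma sheaf_onI:
  fixes F :: "'x::topological_space set \<Rightarrow> ('x \<Rightarrow> 'v::ab_group_add) set"
  assumes F: "\<And>U. F U = {f. P U f \<and> (\<forall>x. x \<notin> U \<longrightarrow> f x = 0)}"
    and zero: "\<And>U. open U \<Longrightarrow> P U (\<lambda>x. 0)"
    and diff: "\<And>U f g. open U \<Longrightarrow> P U f \<Longrightarrow> P U g \<Longrightarrow> P U (\<lambda>x. f x - g x)"
    and subset: "\<And>U V f. open U \<Longrightarrow> open V \<Longrightarrow> V \<subseteq> U \<Longrightarrow> P U f \<Longrightarrow> P V f"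
    and cong: "\<And>U f g. open U \<Longrightarrow> P U f \<Longrightarrow> (\<And>x. x \<in> U \<Longrightarrow> f x = g x) \<Longrightarrow> P U g"
    and glue: "\<And>\<U> f. (\<And>U. U \<in> \<U> \<Longrightarrow> open U \<and> P U f) \<Longrightarrow> P (\<Union>\<U>) f"
  shows "sheaf_on \<Omega> F"
  unfolding sheaf_on_def
proof (intro conjI allI impI)
  fix U assume "open U \<and> U \<subseteq> \<Omega>"
  then have U: "open U" by simp
  show "\<forall>s\<in>F U. \<forall>x. x \<notin> U \<longrightarrow> s x = 0" by (simp add: F)
  show "0 \<in> F U" using zero[OF U] by (simp add: F zero_fun_def)
  show "\<forall>s\<in>F U. \<forall>t\<in>F U. s - t \<in> F U"
    using diff[OF U] by (auto simp: F fun_diff_def)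
  fix V s assume *: "open V \<and> V \<subseteq> U \<and> s \<in> F U"
  then have "P V s" using subset[OF U] by (auto simp: F)
  then have "P V (restr V s)" by (rule cong[rotated]) (use * in \<open>auto simp: restr_def\<close>)
  then show "restr V s \<in> F V" by (simp add: F restr_def)
next
  fix \<U> s
  assume A: "(\<forall>U\<in>\<U>. open U \<and> U \<subseteq> \<Omega> \<and> s U \<in> F U) \<and> (\<forall>U\<in>\<U>. \<forall>V\<in>\<U>. restr (U \<inter> V) (s U) = restr (U \<inter> V) (s V))"
  \<comment> \<open>An arbitrary member of the cover supplies each value; agreement on overlaps
    makes the choice immaterial, and 0 is the required value off the union.\<close>
  define t where "t = (\<lambda>x. if x \<in> \<Union>\<U> then s (SOME U. U \<in> \<U> \<and> x \<in> U) x else 0)"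
  have t: "t x = s U x" if "U \<in> \<U>" "x \<in> U" for U x
  proof -
    have "\<exists>U. U \<in> \<U> \<and> x \<in> U" using that by blast
    from someI_ex[OF this] obtain V where V: "V = (SOME U. U \<in> \<U> \<and> x \<in> U)" "V \<in> \<U>" "x \<in> V" by blast
    have "restr (V \<inter> U) (s V) x = restr (V \<inter> U) (s U) x" using A V(2) that(1) by metis
    then show ?thesis using V that by (auto simp: restr_def t_def)
  qed
  have "P U t" if "U \<in> \<U>" for U
  proof -
    have "open U" "P U (s U)" using A that by (auto simp: F)
    then show ?thesis by (rule cong) (simp add: t[OF that])
  qed
  then have "P (\<Union>\<U>) t" using A by (intro glue) auto
  then have tF: "t \<in> F (\<Union>\<U>)" by (auto simp: F t_def)
  show "\<exists>!t. t \<in> F (\<Union>\<U>) \<and> (\<forall>U\<in>\<U>. restr U t = s U)"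
  proof (rule ex1I[of _ t], intro conjI ballI tF)
    fix U assume U: "U \<in> \<U>"
    then have "s U \<in> F U" using A by blast
    then show "restr U t = s U" using t[OF U] by (auto simp: fun_eq_iff restr_def F)
  next
    fix t' assume t': "t' \<in> F (\<Union>\<U>) \<and> (\<forall>U\<in>\<U>. restr U t' = s U)"
    show "t' = t"
    proof
      fix x
      show "t' x = t x"
      proof (cases "x \<in> \<Union>\<U>")
        case True
        then obtain U where U: "U \<in> \<U>" "x \<in> U" by blast
        then have "restr U t' x = s U x" using t' by metis
        then show ?thesis using U t by (simp add: restr_def)
      qed (use t' tF in \<open>auto simp: F\<close>)
    qed
  qed
qed

lemma k_regular_on_cong:
  assumes "open U" "k_regular_on k U f" "\<And>x. x \<in> U \<Longrightarrow> f x = g x"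
  shows "k_regular_on k U g"
  using assms unfolding k_regular_on_iff[OF assms(1)] by auto

lemma k_regular_on_subset:
  assumes "open U" "open V" "V \<subseteq> U" "k_regular_on k U f"
  shows "k_regular_on k V f"
  using assms regs_subset unfolding k_regular_on_iff[OF assms(1)] k_regular_on_iff[OF assms(2)] by blast

lemma regs_local:
  fixes U :: "'n::finite hspace set"
  assumes "\<And>x. x \<in> U \<Longrightarrow> \<exists>V. open V \<and> x \<in> V \<and> regs k V \<phi>"
  shows "regs k U \<phi>"
proof (cases "k = 0")
  case True
  have "Ck 2 U (\<phi> 0)"
  proof (rule Ck_local)
    fix x assume "x \<in> U"
    then obtain V where "open V" "x \<in> V" "regs k V \<phi>" using assms by blast
    then show "\<exists>V. open V \<and> x \<in> V \<and> Ck 2 V (\<phi> 0)" using True unfolding regs_def by auto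
  qed
  moreover have "nab A P0 (nab B P1 (\<phi> 0)) x = nab B P0 (nab A P1 (\<phi> 0)) x"
    if "A < 2 * CARD('n)" "B < 2 * CARD('n)" "x \<in> U" for A B x
  proof -
    obtain V where "x \<in> V" "regs k V \<phi>" using assms \<open>x \<in> U\<close> by blast
    then show ?thesis using True that unfolding regs_def by auto
  qed
  ultimately show ?thesis using True by (simp add: regs_def del: Ck.simps)
next
  case False
  have "Ck 1 U (\<phi> j)" if "j \<le> k" for j using assms regs_Ck1[OF _ that] by (intro Ck_local) blast
  then show ?thesis using assms False regs_pairD unfolding regs_def by (metis (no_types, lifting))
qed

text \<open>Components are chosen pointwise over the whole union before regularity is considered, so
  one family serves for all members of the cover.\<close>

lemma k_regular_on_Union:
  fixes f :: "'n::finite hspace \<Rightarrow> tensor"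
  assumes "\<And>U. U \<in> \<U> \<Longrightarrow> open U \<and> k_regular_on k U f"
  shows "k_regular_on k (\<Union>\<U>) f"
proof -
  have "\<forall>x\<in>\<Union>\<U>. \<exists>\<phi>. f x = tens k \<phi>"
    using assms unfolding k_regular_on_def sym_power_iff by blast
  then obtain \<phi> where \<phi>: "\<And>x. x \<in> \<Union>\<U> \<Longrightarrow> f x = tens k (\<phi> x)" by metis
  define \<psi> where "\<psi> = (\<lambda>j x. \<phi> x j)"
  have \<psi>: "f x = tens k (\<lambda>j. \<psi> j x)" if "x \<in> \<Union>\<U>" for x using \<phi>[OF that] by (simp add: \<psi>_def)
  have "regs k U \<psi>" if "U \<in> \<U>" for U
    using k_regular_on_tens[of U f k \<psi>] assms[OF that] \<psi> that by blast
  then have "regs k (\<Union>\<U>) \<psi>" using assms by (intro regs_local) blast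
  then show ?thesis using k_regular_on_tens[of "\<Union>\<U>" f k \<psi>] \<psi> assms by blast
qed

lemma tens_lincomb: "tens k \<phi> l - tens k \<psi> l = tens k (\<lambda>j. \<phi> j - \<psi> j) l"
  by (simp add: tens_def)

lemma regs_diff:
  fixes U :: "'n::finite hspace set"
  assumes U: "open U" and f: "regs k U f" and g: "regs k U g"
  shows "regs k U (\<lambda>j x. f j x - g j x)"
proof (cases k)
  case (Suc m)
  then show ?thesis using regs_add_scale[OF U, of m f g 1 "- 1"] f g by simp
next
  case 0
  note s = regs_smooth[OF U f, of 0 2] regs_smooth[OF U g, of 0 2]
  have d: "f 0 differentiable (at x)" "g 0 differentiable (at x)" if "x \<in> U" for x
    using Ck_differentiable[OF s(1) _ that] Ck_differentiable[OF s(2) _ that] by auto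
  have nd: "nab A a (f 0) differentiable (at x)" "nab A a (g 0) differentiable (at x)" if "x \<in> U" for A a x
    using Ck_differentiable[OF Ck_nab[OF U s(1), of 1] _ that] Ck_differentiable[OF Ck_nab[OF U s(2), of 1] _ that] by auto
  have "nab A a (nab B b (\<lambda>x. f 0 x - g 0 x)) x = nab A a (nab B b (f 0)) x - nab A a (nab B b (g 0)) x"
    if x: "x \<in> U" for A a B b x
  proof -
    have "nab A a (nab B b (\<lambda>x. f 0 x - g 0 x)) x = nab A a (\<lambda>x. nab B b (f 0) x - nab B b (g 0) x) x"
      by (rule cdird_cong_open[OF U x]) (rule cdird_diff[OF d])
    also have "\<dots> = nab A a (nab B b (f 0)) x - nab A a (nab B b (g 0)) x"
      by (rule cdird_diff[OF nd[OF x]])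
    finally show ?thesis .
  qed
  moreover have "Ck 2 U (\<lambda>x. f 0 x - g 0 x)" by (intro Ck_diff U s) auto
  ultimately show ?thesis using f g 0 by (simp add: regs_def del: Ck.simps)
qed

lemma k_regular_on_diff:
  assumes U: "open U" and "k_regular_on k U f" "k_regular_on k U g"
  shows "k_regular_on k U (\<lambda>x. f x - g x)"
proof -
  obtain \<phi> \<psi> where "\<forall>x\<in>U. f x = tens k (\<lambda>j. \<phi> j x)" "regs k U \<phi>" "\<forall>x\<in>U. g x = tens k (\<lambda>j. \<psi> j x)" "regs k U \<psi>"
    using assms unfolding k_regular_on_iff[OF U] by blast
  then show ?thesis unfolding k_regular_on_iff[OF U]
    by (intro exI[of _ "\<lambda>j x. \<phi> j x - \<psi> j x"]) (auto simp: fun_eq_iff tens_lincomb intro: regs_diff[OF U])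
qed

lemma k_regular_on_0: "open U \<Longrightarrow> k_regular_on k U (\<lambda>x. 0)"
proof -
  assume U: "open U"
  have c: "cdird v (\<lambda>_::'a hspace. 0) = (\<lambda>_. 0)" for v by (rule ext) simp
  have "regs k U (\<lambda>_ _. 0)" unfolding regs_def c by (simp del: Ck.simps)
  then show ?thesis unfolding k_regular_on_iff[OF U]
    by (intro exI[of _ "\<lambda>_ _. 0"]) (simp add: fun_eq_iff tens_def)
qed

lemma sheaf_on_regular: "sheaf_on \<Omega> (regular_sheaf k :: 'n::finite hspace set \<Rightarrow> _)"
  by (rule sheaf_onI[where P="k_regular_on k"])
    (auto simp: regular_sheaf_def intro: k_regular_on_0 k_regular_on_diff k_regular_on_subset k_regular_on_Union
      intro: k_regular_on_cong)

lemma sheaf_on_ideal: "sheaf_on \<Omega> (ideal_sheaf X k :: 'n::finite hspace set \<Rightarrow> _)"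
  by (rule sheaf_onI[where P="\<lambda>U f. k_regular_on k U f \<and> (\<forall>x\<in>X \<inter> U. f x = 0)"])
    (auto simp: ideal_sheaf_def regular_sheaf_def intro: k_regular_on_0 k_regular_on_diff k_regular_on_subset k_regular_on_Union
      intro: k_regular_on_cong)

lemma sheaf_on_regular_sum:
  "sheaf_on \<Omega> (sheaf_sum (regular_sheaf k) (regular_sheaf m) :: 'n::finite hspace set \<Rightarrow> _)"
proof (rule sheaf_onI[where P="\<lambda>U p. k_regular_on k U (\<lambda>x. fst (p x)) \<and> k_regular_on m U (\<lambda>x. snd (p x))"])
  fix U :: "'n hspace set"
  show "sheaf_sum (regular_sheaf k) (regular_sheaf m) U = {p. (k_regular_on k U (\<lambda>x. fst (p x)) \<and> k_regular_on m U (\<lambda>x. snd (p x)))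
    \<and> (\<forall>x. x \<notin> U \<longrightarrow> p x = 0)}" (is "?L = ?R")
  proof
    show "?L \<subseteq> ?R" by (auto simp: sheaf_sum_def regular_sheaf_def zero_prod_def)
    show "?R \<subseteq> ?L"
    proof
      fix p assume p: "p \<in> ?R"
      then have *: "p = (\<lambda>x. (fst (p x), snd (p x)))" "(\<lambda>x. fst (p x)) \<in> regular_sheaf k U" "(\<lambda>x. snd (p x)) \<in> regular_sheaf m U"
        by (auto simp: regular_sheaf_def)
      show "p \<in> ?L" unfolding sheaf_sum_def by (intro CollectI exI conjI) (rule *)+
    qed
  qed
qed (auto intro: k_regular_on_0 k_regular_on_diff k_regular_on_subset k_regular_on_Union k_regular_on_cong)

section \<open>Exactness\<close>

lemma tens_eq_iff: "tens k \<phi> = tens k \<psi> \<longleftrightarrow> (\<forall>j\<le>k. \<phi> j = \<psi> j)"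
proof
  assume eq: "tens k \<phi> = tens k \<psi>"
  show "\<forall>j\<le>k. \<phi> j = \<psi> j"
  proof (intro allI impI)
    fix j assume j: "j \<le> k"
    have c: "count_list (replicate m P1) P1 = m" "count_list (replicate m P0) P1 = 0" for m
      by (induction m) auto
    show "\<phi> j = \<psi> j"
      using fun_cong[OF eq, of "replicate j P1 @ replicate (k - j) P0"] j by (simp add: tens_def c)
  qed
next
  assume "\<forall>j\<le>k. \<phi> j = \<psi> j"
  then show "tens k \<phi> = tens k \<psi>" using count_le_length by (force simp: fun_eq_iff tens_def)
qed

lemma tens_0_iff: "tens k \<phi> = 0 \<longleftrightarrow> (\<forall>j\<le>k. \<phi> j = 0)"
  using tens_eq_iff[of k \<phi> "\<lambda>_. 0"] by (simp add: tens_def[abs_def] fun_eq_iff)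

lemma tens_arith:
  "tens k \<phi> + tens k \<psi> = tens k (\<lambda>j. \<phi> j + \<psi> j)" "- tens k \<phi> = tens k (\<lambda>j. - \<phi> j)"
  by (simp_all add: fun_eq_iff tens_def)

lemma regular_sheaf_iff:
  fixes U :: "'n::finite hspace set"
  assumes "open U"
  shows "f \<in> regular_sheaf k U \<longleftrightarrow> (\<exists>\<phi>. regs k U \<phi> \<and> (\<forall>x. f x = (if x \<in> U then tens k (\<lambda>j. \<phi> j x) else 0)))"
  unfolding regular_sheaf_def k_regular_on_iff[OF assms] by auto

lemma qcoord_0_iff: "qcoord 0 x = 0 \<longleftrightarrow> proj0 x = 0"
proof -
  have "qcoord 0 x = (x $ qidx 0 0, x $ qidx 0 1, x $ qidx 0 2, x $ qidx 0 3)"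
    unfolding qcoord_def coord_quad by simp
  then show ?thesis unfolding proj0_eq_0_iff by (auto simp: zero_prod_def numeral_eq_Suc less_Suc_eq)
qed

lemma zvar_proj0: "proj0 x = 0 \<Longrightarrow> A < 2 \<Longrightarrow> zvar A a x = 0"
  using zvar_dilate[of A a 0 x] by (simp add: dilate_def)

lemma Lop_zero [simp]: "f x = 0 \<Longrightarrow> Lop B f x = 0"
  by (simp add: Lop_def fun_eq_iff)

lemma Lop_restr: "Lop B (restr V f) x = (if x \<in> V then Lop B f x else 0)"
  by (simp add: restr_def Lop_def fun_eq_iff)

lemma Lop_regular:
  fixes U :: "'n::finite hspace set"
  assumes U: "open U" and f: "f \<in> regular_sheaf (Suc k) U" and B: "B < 2 * CARD('n)"
  shows "Lop B f \<in> regular_sheaf k U"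
proof -
  obtain \<phi> where \<phi>: "regs (Suc k) U \<phi>" "\<And>x. f x = (if x \<in> U then tens (Suc k) (\<lambda>j. \<phi> j x) else 0)"
    using f unfolding regular_sheaf_iff[OF U] by blast
  have "Lop B f x = (if x \<in> U then tens k (\<lambda>j. Lcomp B \<phi> j x) else 0)" for x
    using Lop_tens[of f x k \<phi> B] by (auto simp: \<phi>(2))
  then show ?thesis using regs_Lcomp[OF U \<phi>(1) B] unfolding regular_sheaf_iff[OF U] by blast
qed

lemma regular_sheaf_uminus:
  assumes "open U" "f \<in> regular_sheaf k U" shows "(\<lambda>x. - f x) \<in> regular_sheaf k U"
proof -
  have "(\<lambda>x. 0 - f x) \<in> regular_sheaf k U"
    using assms k_regular_on_diff[OF _ k_regular_on_0] by (auto simp: regular_sheaf_def)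
  then show ?thesis by simp
qed

lemma regular_sheaf_add:
  assumes U: "open U" and f: "f \<in> regular_sheaf k U" and g: "g \<in> regular_sheaf k U"
  shows "(\<lambda>x. f x + g x) \<in> regular_sheaf k U"
proof -
  have "k_regular_on k U (\<lambda>x. f x - - g x)"
    using f regular_sheaf_uminus[OF U g] by (intro k_regular_on_diff U) (auto simp: regular_sheaf_def)
  then show ?thesis using f g by (simp add: regular_sheaf_def)
qed

lemma sheaf_hom_Ltilde:
  "sheaf_hom \<Omega> (regular_sheaf (k + 2) :: 'n::finite hspace set \<Rightarrow> _)
     (sheaf_sum (regular_sheaf (k + 1)) (regular_sheaf (k + 1))) Ltilde"
  unfolding sheaf_hom_def
proof (intro allI impI conjI ballI)
  fix U :: "'n hspace set" assume "open U \<and> U \<subseteq> \<Omega>"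
  then have U: "open U" by simp
  show "Ltilde U s \<in> sheaf_sum (regular_sheaf (k + 1)) (regular_sheaf (k + 1)) U" if "s \<in> regular_sheaf (k + 2) U" for s
    unfolding Ltilde_def sheaf_sum_def
    using Lop_regular[OF U _ less_twice_card(1)] Lop_regular[OF U _ less_twice_card(2)] regular_sheaf_uminus[OF U] that
    by fastforce
  show "Ltilde U (s + t) = Ltilde U s + Ltilde U t" for s t
    by (simp add: Ltilde_def fun_eq_iff plus_fun_def Lop_def algebra_simps)
  show "Ltilde V (restr V s) = restr V (Ltilde U s)" for V s
    by (simp add: Ltilde_def fun_eq_iff Lop_restr restr_def[of _ "\<lambda>x. (_ x, _ x)"] zero_prod_def)
qed

lemma sheaf_hom_Lscr:
  assumes X: "X = {q \<in> \<Omega>. qcoord 0 q = 0}"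
  shows "sheaf_hom \<Omega> (sheaf_sum (regular_sheaf (k + 1)) (regular_sheaf (k + 1)))
    (ideal_sheaf X k :: 'n::finite hspace set \<Rightarrow> _) Lscr"
  unfolding sheaf_hom_def
proof (intro allI impI conjI ballI)
  fix U :: "'n hspace set" assume "open U \<and> U \<subseteq> \<Omega>"
  then have U: "open U" by simp
  show "Lscr U s \<in> ideal_sheaf X k U" if s: "s \<in> sheaf_sum (regular_sheaf (k + 1)) (regular_sheaf (k + 1)) U" for s
  proof -
    obtain f g where fg: "s = (\<lambda>x. (f x, g x))" "f \<in> regular_sheaf (Suc k) U" "g \<in> regular_sheaf (Suc k) U"
      using s by (auto simp: sheaf_sum_def)
    have "Lscr U s \<in> regular_sheaf k U"
      using regular_sheaf_add[OF U Lop_regular[OF U fg(2) less_twice_card(1)] Lop_regular[OF U fg(3) less_twice_card(2)]]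
      by (simp add: Lscr_def fg(1))
    moreover have "Lscr U s x = 0" if "x \<in> X \<inter> U" for x
      using that zvar_proj0[of x] by (simp add: X qcoord_0_iff Lscr_def Lop_def fun_eq_iff)
    ultimately show ?thesis by (simp add: ideal_sheaf_def)
  qed
  show "Lscr U (s + t) = Lscr U s + Lscr U t" for s t
    by (simp add: Lscr_def fun_eq_iff Lop_def algebra_simps)
  show "Lscr V (restr V s) = restr V (Lscr U s)" for V s
    by (simp add: Lscr_def fun_eq_iff restr_def Lop_def)
qed

text \<open>Off X two consecutive components solve a homogeneous system with nonzero determinant. X
  has empty interior, so continuity gives the rest.\<close>

lemma Ltilde_injective:
  fixes U :: "'n::finite hspace set"
  assumes U: "open U" and s: "s \<in> regular_sheaf (k + 2) U" and 0: "Ltilde U s = 0"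
  shows "s = 0"
proof -
  obtain \<phi> where \<phi>: "regs (k + 2) U \<phi>" "\<And>x. s x = (if x \<in> U then tens (k + 2) (\<lambda>j. \<phi> j x) else 0)"
    using s unfolding regular_sheaf_iff[OF U] by blast
  have L: "Lcomp B \<phi> j x = 0" if "x \<in> U" "j \<le> Suc k" "B = 0 \<or> B = 1" for B j x
  proof -
    have "Lop 0 s x = 0" "Lop 1 s x = 0" using fun_cong[OF 0, of x] by (simp_all add: Ltilde_def zero_prod_def)
    then have "Lop B s x = 0" using that(3) by auto
    moreover have "Lop B s x = tens (Suc k) (\<lambda>j. Lcomp B \<phi> j x)"
      using that(1) by (intro Lop_tens) (simp add: \<phi>(2))
    ultimately show ?thesis using that(2) by (simp add: tens_0_iff)
  qed
  have off: "\<phi> j x = 0" if x: "x \<in> U" "zdet x \<noteq> 0" and j: "j \<le> k + 2" for x j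
  proof -
    have "\<phi> i x = 0 \<and> \<phi> (Suc i) x = 0" if "i \<le> Suc k" for i
    proof -
      have e: "zvar 0 P0 x * \<phi> i x + zvar 0 P1 x * \<phi> (Suc i) x = 0" "zvar 1 P0 x * \<phi> i x + zvar 1 P1 x * \<phi> (Suc i) x = 0"
        using L[OF x(1) that, of 0] L[OF x(1) that, of 1] by (simp_all add: Lcomp_def del: One_nat_def)
      have "zdet x * \<phi> i x = 0" "zdet x * \<phi> (Suc i) x = 0" unfolding zdet_def using e by algebra+
      then show ?thesis using x(2) by simp
    qed
    \<comment> \<open>The last component \<open>k + 2\<close> occurs only as the second member of
      the pair starting at \<open>Suc k\<close>.\<close>
    from this[of j] this[of "Suc k"] show ?thesis using j by (cases "j = k + 2") auto
  qed
  have "\<phi> j x = 0" if x: "x \<in> U" and j: "j \<le> k + 2" for x j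
  proof (cases "proj0 x = 0")
    case False then show ?thesis using off[OF x _ j] zdet_eq_0_iff by blast
  next
    case True
    \<comment> \<open>Any direction within q_0 leaves X immediately; the real unit is taken.\<close>
    define e :: "'n hspace" where "e = axis (qidx 0 0) 1"
    have c: "((\<lambda>t. x + t *\<^sub>R e) \<longlongrightarrow> x) (at 0)"
      by (rule tendsto_eq_intros refl | simp)+
    have "isCont (\<phi> j) x"
      using Ck_continuous[OF regs_Ck1[OF \<phi>(1) j]] U x by (simp add: continuous_on_eq_continuous_at)
    then have l: "((\<lambda>t. \<phi> j (x + t *\<^sub>R e)) \<longlongrightarrow> \<phi> j x) (at 0)" by (rule isCont_tendsto_compose[OF _ c])
    have nz: "zdet (x + t *\<^sub>R e) \<noteq> 0" if "t \<noteq> 0" for t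
    proof -
      have "(x + t *\<^sub>R e) $ qidx 0 0 = t"
        using True unfolding proj0_eq_0_iff by (simp add: e_def axis_def)
      then show ?thesis unfolding zdet_eq_0_iff proj0_eq_0_iff using that by (metis zero_less_numeral)
    qed
    have "\<forall>\<^sub>F t in at 0. x + t *\<^sub>R e \<in> U"
      using topological_tendstoD[OF c U x] .
    moreover have "\<forall>\<^sub>F t in at (0::real). t \<noteq> 0" by (simp add: eventually_at_filter)
    ultimately have "\<forall>\<^sub>F t in at 0. \<phi> j (x + t *\<^sub>R e) = 0"
      by eventually_elim (use off nz j in auto)
    then have "((\<lambda>t. \<phi> j (x + t *\<^sub>R e)) \<longlongrightarrow> 0) (at 0)" by (rule tendsto_eventually)
    then show ?thesis using l tendsto_unique[of "at (0::real)"] by (metis trivial_limit_at)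
  qed
  then show ?thesis by (auto simp: fun_eq_iff \<phi>(2) tens_def count_le_length) (metis count_le_length)
qed

lemma local_section:
  assumes "open V" "regs k V \<phi>"
  shows "(\<lambda>x. if x \<in> V then tens k (\<lambda>j. \<phi> j x) else 0) \<in> regular_sheaf k V"
  using assms by (auto simp: regular_sheaf_iff)

lemma exact_middle:
  fixes U :: "'n::finite hspace set"
  assumes U: "open U" and f: "f \<in> regular_sheaf (k + 1) U" and g: "g \<in> regular_sheaf (k + 1) U"
    and 0: "Lscr U (\<lambda>x. (f x, g x)) = 0" and p: "p \<in> U"
  shows "\<exists>V. open V \<and> p \<in> V \<and> V \<subseteq> U \<and> (\<exists>s\<in>regular_sheaf (k + 2) V. Ltilde V s = restr V (\<lambda>x. (f x, g x)))"
proof -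
  obtain \<phi> where \<phi>: "regs (Suc k) U \<phi>" "\<And>x. f x = (if x \<in> U then tens (Suc k) (\<lambda>j. \<phi> j x) else 0)"
    using f unfolding regular_sheaf_iff[OF U] by auto
  obtain \<psi> where \<psi>: "regs (Suc k) U \<psi>" "\<And>x. g x = (if x \<in> U then tens (Suc k) (\<lambda>j. \<psi> j x) else 0)"
    using g unfolding regular_sheaf_iff[OF U] by auto
  have eq: "Lcomp 0 \<phi> j x + Lcomp 1 \<psi> j x = 0" if "x \<in> U" "j \<le> k" for x j
  proof -
    have "Lop 0 f x = tens k (\<lambda>j. Lcomp 0 \<phi> j x)" "Lop 1 g x = tens k (\<lambda>j. Lcomp 1 \<psi> j x)"
      using that by (auto intro!: Lop_tens simp: \<phi>(2) \<psi>(2))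
    moreover have "Lop 0 f x + Lop 1 g x = 0" using fun_cong[OF 0, of x] by (simp add: Lscr_def)
    ultimately show ?thesis using that(2) by (simp add: tens_arith tens_0_iff)
  qed
  obtain V h where V: "open V" "p \<in> V" "V \<subseteq> U" and h: "regs (Suc (Suc k)) V h"
    "\<And>x j. x \<in> V \<Longrightarrow> j \<le> Suc k \<Longrightarrow> Lcomp 0 h j x = \<psi> j x" "\<And>x j. x \<in> V \<Longrightarrow> j \<le> Suc k \<Longrightarrow> Lcomp 1 h j x = - \<phi> j x"
  proof (cases "proj0 p = 0")
    case True
    obtain \<delta> where \<delta>: "\<delta> > 0" "ball p \<delta> \<subseteq> U" using U p openE by blast
    obtain h where "regs (Suc (Suc k)) (ball p \<delta>) h"
      "\<And>x j. x \<in> ball p \<delta> \<Longrightarrow> j \<le> Suc k \<Longrightarrow> Lcomp 0 h j x = \<psi> j x"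
      "\<And>x j. x \<in> ball p \<delta> \<Longrightarrow> j \<le> Suc k \<Longrightarrow> Lcomp 1 h j x = - \<phi> j x"
    proof (rule exact_near_X[OF True regs_subset[OF \<phi>(1) \<delta>(2)] regs_subset[OF \<psi>(1) \<delta>(2)]])
      show "Lcomp 0 \<phi> j x + Lcomp 1 \<psi> j x = 0" if "x \<in> ball p \<delta>" "j \<le> k" for x j
        using that \<delta>(2) by (intro eq) auto
    qed (auto simp del: One_nat_def)
    then show ?thesis using that[of "ball p \<delta>" h] \<delta> by simp
  next
    case False
    define V where "V = U \<inter> {x. proj0 x \<noteq> 0}"
    have V: "open V" unfolding V_def
      by (intro open_Int U open_Collect_neq linear_continuous_on bounded_linear_proj0 continuous_on_const)
    have VU: "V \<subseteq> U" "p \<in> V" using p False by (auto simp: V_def)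
    obtain h where "regs (Suc (Suc k)) V h"
      "\<And>x j. x \<in> V \<Longrightarrow> j \<le> Suc k \<Longrightarrow> Lcomp 0 h j x = \<psi> j x"
      "\<And>x j. x \<in> V \<Longrightarrow> j \<le> Suc k \<Longrightarrow> Lcomp 1 h j x = - \<phi> j x"
    proof (rule exact_off_X[OF V _ regs_subset[OF \<phi>(1) VU(1)] regs_subset[OF \<psi>(1) VU(1)]])
    qed (use eq VU in \<open>auto simp: V_def simp del: One_nat_def\<close>)
    then show ?thesis using that[OF V VU(2,1)] by blast
  qed
  define s where "s = (\<lambda>x. if x \<in> V then tens (k + 2) (\<lambda>j. h j x) else 0)"
  have "s \<in> regular_sheaf (k + 2) V" unfolding s_def using local_section[OF V(1), of "k + 2" h] h(1) by simp
  moreover have "Ltilde V s = restr V (\<lambda>x. (f x, g x))"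
  proof
    fix x
    show "Ltilde V s x = restr V (\<lambda>x. (f x, g x)) x"
    proof (cases "x \<in> V")
      case True
      have "Lop B s x = tens (Suc k) (\<lambda>j. Lcomp B h j x)" for B
        by (rule Lop_tens) (simp add: s_def True)
      moreover have "tens (Suc k) (\<lambda>j. Lcomp 0 h j x) = tens (Suc k) (\<lambda>j. \<psi> j x)"
        "tens (Suc k) (\<lambda>j. Lcomp 1 h j x) = tens (Suc k) (\<lambda>j. - \<phi> j x)"
        unfolding tens_eq_iff using h(2,3)[OF True] by blast+
      ultimately show ?thesis using True V(3) by (auto simp: Ltilde_def restr_def \<phi>(2) \<psi>(2) tens_arith)
    qed (simp add: Ltilde_def restr_def s_def zero_prod_def)
  qed
  ultimately show ?thesis using V by blast
qed

lemma Lscr_surjective: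
  fixes U :: "'n::finite hspace set"
  assumes U: "open U" and t: "t \<in> regular_sheaf k U" and zero: "\<And>x. x \<in> U \<Longrightarrow> proj0 x = 0 \<Longrightarrow> t x = 0" and p: "p \<in> U"
  shows "\<exists>V. open V \<and> p \<in> V \<and> V \<subseteq> U \<and>
    (\<exists>s\<in>sheaf_sum (regular_sheaf (k + 1)) (regular_sheaf (k + 1)) V. Lscr V s = restr V t)"
proof -
  obtain F where F: "regs k U F" "\<And>x. t x = (if x \<in> U then tens k (\<lambda>j. F j x) else 0)"
    using t unfolding regular_sheaf_iff[OF U] by auto
  obtain V f g where V: "open V" "p \<in> V" "V \<subseteq> U" and fg: "regs (Suc k) V f" "regs (Suc k) V g"
    "\<And>x j. x \<in> V \<Longrightarrow> j \<le> k \<Longrightarrow> Lcomp 0 f j x + Lcomp 1 g j x = F j x"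
  proof (cases "proj0 p = 0")
    case True
    obtain \<delta> where \<delta>: "\<delta> > 0" "ball p \<delta> \<subseteq> U" using U p openE by blast
    have z: "F j x = 0" if "x \<in> ball p \<delta>" "proj0 x = 0" "j \<le> k" for x j
    proof -
      have "x \<in> U" using that \<delta> by blast
      then show ?thesis using zero[OF _ that(2)] that(3) by (simp add: F(2) tens_0_iff)
    qed
    obtain f g where "regs (Suc k) (ball p \<delta>) f" "regs (Suc k) (ball p \<delta>) g"
      "\<And>x j. x \<in> ball p \<delta> \<Longrightarrow> j \<le> k \<Longrightarrow> Lcomp 0 f j x + Lcomp 1 g j x = F j x"
      using surjective_near_X[OF True regs_subset[OF F(1) \<delta>(2)] z] by blast
    then show ?thesis using that[of "ball p \<delta>" f g] \<delta> by simp
  next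
    case False
    obtain \<delta> g where g: "\<delta> > 0" "ball p \<delta> \<subseteq> U" "regs (Suc k) (ball p \<delta>) g"
      "\<And>x j. x \<in> ball p \<delta> \<Longrightarrow> j \<le> k \<Longrightarrow> Lcomp 1 g j x = F j x"
      using surjective_off_X[OF U p False F(1)] by blast
    \<comment> \<open>Off X the first entry of the preimage is 0, written as a difference so that
      \<open>regs_diff\<close> gives its regularity.\<close>
    have "regs (Suc k) (ball p \<delta>) (\<lambda>j x. g j x - g j x)" by (rule regs_diff[OF open_ball g(3,3)])
    then show ?thesis using that[of "ball p \<delta>" "\<lambda>j x. g j x - g j x" g] g by (simp add: Lcomp_def[of 0])
  qed
  define s where "s = (\<lambda>x. (if x \<in> V then tens (k + 1) (\<lambda>j. f j x) else 0, if x \<in> V then tens (k + 1) (\<lambda>j. g j x) else 0))"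
  have "s \<in> sheaf_sum (regular_sheaf (k + 1)) (regular_sheaf (k + 1)) V"
  proof -
    have l: "(\<lambda>x. if x \<in> V then tens (k + 1) (\<lambda>j. f j x) else 0) \<in> regular_sheaf (k + 1) V"
      "(\<lambda>x. if x \<in> V then tens (k + 1) (\<lambda>j. g j x) else 0) \<in> regular_sheaf (k + 1) V"
      by (rule local_section[OF V(1)]; use fg in simp)+
    show ?thesis unfolding s_def sheaf_sum_def by (intro CollectI exI conjI) (rule refl l)+
  qed
  moreover have "Lscr V s = restr V t"
  proof
    fix x
    show "Lscr V s x = restr V t x"
    proof (cases "x \<in> V")
      case True
      have "Lop 0 (\<lambda>y. fst (s y)) x = tens k (\<lambda>j. Lcomp 0 f j x)" "Lop 1 (\<lambda>y. snd (s y)) x = tens k (\<lambda>j. Lcomp 1 g j x)"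
        by (auto intro!: Lop_tens simp: s_def True)
      moreover have "tens k (\<lambda>j. Lcomp 0 f j x + Lcomp 1 g j x) = tens k (\<lambda>j. F j x)"
        unfolding tens_eq_iff using fg(3)[OF True] by blast
      ultimately show ?thesis using True V(3) by (auto simp: Lscr_def restr_def F(2) tens_arith)
    qed (simp add: Lscr_def restr_def s_def)
  qed
  ultimately show ?thesis using V by blast
qed

theorem theorem1p1:
  fixes \<Omega> X :: "'n::finite hspace set" and k :: nat
  assumes "open \<Omega>" and "connected \<Omega>" and "\<Omega> \<noteq> {}"
    and "X = {q \<in> \<Omega>. qcoord 0 q = 0}"
  shows "short_exact_sequence_of_sheaves \<Omega>
           (regular_sheaf (k + 2)) Ltilde
           (sheaf_sum (regular_sheaf (k + 1)) (regular_sheaf (k + 1))) Lscr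
           (ideal_sheaf X k)"
  unfolding short_exact_sequence_of_sheaves_def
proof (intro conjI)
  let ?R = "regular_sheaf :: nat \<Rightarrow> 'n hspace set \<Rightarrow> _"
  let ?S = "sheaf_sum (?R (k + 1)) (?R (k + 1))"
  show "sheaf_on \<Omega> (?R (k + 2))" by (rule sheaf_on_regular)
  show "sheaf_on \<Omega> ?S" by (rule sheaf_on_regular_sum)
  show "sheaf_on \<Omega> (ideal_sheaf X k)" by (rule sheaf_on_ideal)
  show "sheaf_hom \<Omega> (?R (k + 2)) ?S Ltilde" by (rule sheaf_hom_Ltilde)
  show "sheaf_hom \<Omega> ?S (ideal_sheaf X k) Lscr" by (rule sheaf_hom_Lscr[OF assms(4)])
  show "exact_at \<Omega> (zero_sheaf :: 'n hspace set \<Rightarrow> ('n hspace \<Rightarrow> tensor) set) zero_hom (?R (k + 2)) Ltilde"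
    unfolding exact_at_def
  proof (intro allI impI)
    fix U :: "'n hspace set" assume "open U \<and> U \<subseteq> \<Omega>"
    then have U: "open U" by simp
    have 0: "0 \<in> ?R (k + 2) U" using k_regular_on_0[OF U] by (simp add: regular_sheaf_def zero_fun_def)
    have "kernel_sheaf (?R (k + 2)) Ltilde U = {0}"
      using Ltilde_injective[OF U] 0 by (auto simp: kernel_sheaf_def Ltilde_def Lop_def fun_eq_iff zero_prod_def)
    moreover have "image_sheaf (zero_sheaf :: 'n hspace set \<Rightarrow> ('n hspace \<Rightarrow> tensor) set) (?R (k + 2)) zero_hom U = {0}"
    proof
      show "image_sheaf (zero_sheaf :: 'n hspace set \<Rightarrow> ('n hspace \<Rightarrow> tensor) set) (?R (k + 2)) zero_hom U \<subseteq> {0}"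
      proof
        fix t assume t: "t \<in> image_sheaf (zero_sheaf :: 'n hspace set \<Rightarrow> ('n hspace \<Rightarrow> tensor) set) (?R (k + 2)) zero_hom U"
        have "t x = 0" for x
        proof (cases "x \<in> U")
          case True
          then obtain V where V: "x \<in> V" "(\<lambda>_. 0) = restr V t"
            using t by (auto simp: image_sheaf_def zero_hom_def)
          show ?thesis using fun_cong[OF V(2), of x] V(1) by (simp add: restr_def)
        next
          case False
          then show ?thesis using t by (simp add: image_sheaf_def regular_sheaf_def)
        qed
        then show "t \<in> {0}" by (simp add: fun_eq_iff)
      qed
      show "{0} \<subseteq> image_sheaf (zero_sheaf :: 'n hspace set \<Rightarrow> ('n hspace \<Rightarrow> tensor) set) (?R (k + 2)) zero_hom U"
        using 0 U by (auto simp: image_sheaf_def zero_hom_def zero_sheaf_def restr_def fun_eq_iff)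
    qed
    ultimately show "image_sheaf (zero_sheaf :: 'n hspace set \<Rightarrow> ('n hspace \<Rightarrow> tensor) set) (?R (k + 2)) zero_hom U
      = kernel_sheaf (?R (k + 2)) Ltilde U" by simp
  qed
  show "exact_at \<Omega> (?R (k + 2)) Ltilde ?S Lscr"
    unfolding exact_at_def
  proof (intro allI impI equalityI subsetI)
    fix U :: "'n hspace set" and t assume "open U \<and> U \<subseteq> \<Omega>"
    then have U: "open U" by simp
    {
      assume t: "t \<in> image_sheaf (?R (k + 2)) ?S Ltilde U"
      then have tS: "t \<in> ?S U" by (simp add: image_sheaf_def)
      have "Lscr U t x = 0" for x
      proof (cases "x \<in> U")
        case True
        then obtain V s where V: "x \<in> V" "Ltilde V s = restr V t" and s: "s \<in> ?R (k + 2) V"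
          using t by (auto simp: image_sheaf_def)
        \<comment> \<open>The composite of the two maps is 0 because \<open>L_0\<close> and
          \<open>L_1\<close> commute; the mixed terms match by symmetry in the first two
          indices.\<close>
        have "s x \<in> sym_power (k + 2)" using s V(1) by (simp add: regular_sheaf_def k_regular_on_def)
        moreover have "mset (P0 # P1 # l) = mset (P1 # P0 # l)" for l by simp
        ultimately have sym: "s x (P0 # P1 # l) = s x (P1 # P0 # l)" for l unfolding sym_power_def by blast
        have "t x = (- Lop 1 s x, Lop 0 s x)" using fun_cong[OF V(2), of x] V(1) by (simp add: restr_def Ltilde_def)
        then show ?thesis by (simp add: Lscr_def Lop_def fun_eq_iff sym algebra_simps)
      next
        case False
        then have "t x = 0" using tS by (auto simp: sheaf_sum_def regular_sheaf_def zero_prod_def)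
        then show ?thesis by (simp add: Lscr_def)
      qed
      then show "t \<in> kernel_sheaf ?S Lscr U" using tS by (simp add: kernel_sheaf_def fun_eq_iff)
    next
      assume t: "t \<in> kernel_sheaf ?S Lscr U"
      then obtain f g where fg: "t = (\<lambda>x. (f x, g x))" "f \<in> ?R (k + 1) U" "g \<in> ?R (k + 1) U"
        by (auto simp: kernel_sheaf_def sheaf_sum_def)
      have "Lscr U (\<lambda>x. (f x, g x)) = 0" using t fg(1) by (simp add: kernel_sheaf_def)
      from exact_middle[OF U fg(2,3) this] show "t \<in> image_sheaf (?R (k + 2)) ?S Ltilde U"
        using t unfolding image_sheaf_def fg(1) kernel_sheaf_def by blast
    }
  qed
  show "exact_at \<Omega> ?S Lscr (ideal_sheaf X k) (zero_hom :: 'n hspace set \<Rightarrow> ('n hspace \<Rightarrow> tensor) \<Rightarrow> ('n hspace \<Rightarrow> tensor))"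
    unfolding exact_at_def
  proof (intro allI impI equalityI subsetI)
    fix U :: "'n hspace set" and t :: "'n hspace \<Rightarrow> tensor" assume "open U \<and> U \<subseteq> \<Omega>"
    then have U: "open U" "U \<subseteq> \<Omega>" by simp_all
    show "t \<in> image_sheaf ?S (ideal_sheaf X k) Lscr U \<Longrightarrow>
      t \<in> kernel_sheaf (ideal_sheaf X k) (zero_hom :: 'n hspace set \<Rightarrow> ('n hspace \<Rightarrow> tensor) \<Rightarrow> ('n hspace \<Rightarrow> tensor)) U"
      by (auto simp: image_sheaf_def kernel_sheaf_def zero_hom_def fun_eq_iff)
    assume "t \<in> kernel_sheaf (ideal_sheaf X k) (zero_hom :: 'n hspace set \<Rightarrow> ('n hspace \<Rightarrow> tensor) \<Rightarrow> ('n hspace \<Rightarrow> tensor)) U"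
    then have t: "t \<in> ideal_sheaf X k U" by (simp add: kernel_sheaf_def)
    then have tR: "t \<in> ?R k U" and z: "\<And>x. x \<in> U \<Longrightarrow> proj0 x = 0 \<Longrightarrow> t x = 0"
      using U(2) by (auto simp: ideal_sheaf_def assms(4) qcoord_0_iff)
    show "t \<in> image_sheaf ?S (ideal_sheaf X k) Lscr U"
      using t Lscr_surjective[OF U(1) tR z] unfolding image_sheaf_def by blast
  qed
qed

end
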